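(* There is an algorithm in the hash-ordered neighbor access model that, given a positive integer $s$ and $\delta\in(0,1)$, on an $n$-vertex graph with $m$ edges, with probability at least $1-\delta$ returns $s$ oriented edges sampled uniformly without replacement from $\vec E$, and has expected query complexity $O\!\left(\sqrt s\,\frac{n\log(n)\log(n/\delta)}{\sqrt m}+s\log^2 n\log(n/\delta)\right)$.
   Context: $G=(V,E)$ is an undirected graph with $n$ vertices and $m$ edges; $\vec E$ denotes the set of oriented edges obtained by replacing each undirected edge $\{u,v\}$ by $(u,v)$ and $(v,u)$. Hash-ordered neighbor access model: the algorithm knows $n$ and may query the $i$-th vertex, the degree $d(v)$, the $i$-th neighbor of $v$, $id(v)$, and a hash value $h(v)$, where the $h(v)$ are independent and uniform on $[0,1]$; each vertex's neighbor list is ordered by increasing hash value. Each query has unit cost. *)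

theory Defs
  imports "HOL-Probability.Probability"
begin

text \<open>
  A finite simple undirected graph together with the data through which it can be accessed.
  Natural numbers serve as vertex names; neither the names nor the enumeration \<open>vertex_at\<close> nor
  the identifiers \<open>vertex_id\<close> bear any relation to the edges or to each other.
\<close>

record access_graph =
  verts :: "nat set"
  edges :: "nat set set"
  vertex_at :: "nat \<Rightarrow> nat"
  vertex_id :: "nat \<Rightarrow> nat"

definition wf_access_graph :: "access_graph \<Rightarrow> bool" where
  "wf_access_graph G \<longleftrightarrow>
     finite (verts G) \<and>
     edges G \<subseteq> {{u, v} |u v. u \<in> verts G \<and> v \<in> verts G \<and> u \<noteq> v} \<and>
     bij_betw (vertex_at G) {1..card (verts G)} (verts G) \<and>
     inj_on (vertex_id G) (verts G)"

definition oriented_edges :: "access_graph \<Rightarrow> (nat \<times> nat) set" where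
  "oriented_edges G = {(u, v). {u, v} \<in> edges G}"

definition neighbors :: "access_graph \<Rightarrow> nat \<Rightarrow> nat set" where
  "neighbors G v = {u. {v, u} \<in> edges G}"

definition deg :: "access_graph \<Rightarrow> nat \<Rightarrow> nat" where
  "deg G v = card (neighbors G v)"

text \<open>The sort is stable, so equal hash values (an event of probability 0) are ordered by name.\<close>

definition neighbor_list :: "access_graph \<Rightarrow> (nat \<Rightarrow> real) \<Rightarrow> nat \<Rightarrow> nat list" where
  "neighbor_list G h v = sort_key h (sorted_list_of_set (neighbors G v))"

datatype query =
    Vertex nat
  | Degree nat
  | Neighbor nat nat
  | Ident nat
  | Hash nat

datatype answer =
    IsVertex nat
  | IsNat nat
  | IsHash real
  | Invalid

text \<open>Vertices and neighbors are counted from 1. Ill-posed queries are answered by \<open>Invalid\<close>.\<close>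

fun respond :: "access_graph \<Rightarrow> (nat \<Rightarrow> real) \<Rightarrow> query \<Rightarrow> answer" where
  "respond G h (Vertex i) =
     (if 1 \<le> i \<and> i \<le> card (verts G) then IsVertex (vertex_at G i) else Invalid)"
| "respond G h (Degree v) = (if v \<in> verts G then IsNat (deg G v) else Invalid)"
| "respond G h (Neighbor v i) =
     (if v \<in> verts G \<and> 1 \<le> i \<and> i \<le> deg G v
      then IsVertex (neighbor_list G h v ! (i - 1)) else Invalid)"
| "respond G h (Ident v) = (if v \<in> verts G then IsNat (vertex_id G v) else Invalid)"
| "respond G h (Hash v) = (if v \<in> verts G then IsHash (h v) else Invalid)"

text \<open>
  A deterministic adaptive query algorithm is a decision tree all of whose paths are finite;
  a randomized one is a family of such trees indexed by the outcome of its internal coins,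
  an infinite sequence of independent uniform numbers in \<open>[0,1]\<close>.
\<close>

datatype 'a dtree =
    Return 'a
  | Ask query "answer \<Rightarrow> 'a dtree"

type_synonym 'a rand_alg = "(nat \<Rightarrow> real) \<Rightarrow> 'a dtree"

primrec result :: "'a dtree \<Rightarrow> (query \<Rightarrow> answer) \<Rightarrow> 'a" where
  "result (Return x) orc = x"
| "result (Ask q k) orc = result (k (orc q)) orc"

primrec num_queries :: "'a dtree \<Rightarrow> (query \<Rightarrow> answer) \<Rightarrow> nat" where
  "num_queries (Return x) orc = 0"
| "num_queries (Ask q k) orc = Suc (num_queries (k (orc q)) orc)"

definition unit_uniform :: "real measure" where
  "unit_uniform = uniform_measure lborel {0..1}"

definition coin_space :: "(nat \<Rightarrow> real) measure" where
  "coin_space = (\<Pi>\<^sub>M i\<in>UNIV. unit_uniform)"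

definition hash_space :: "access_graph \<Rightarrow> (nat \<Rightarrow> real) measure" where
  "hash_space G = (\<Pi>\<^sub>M v\<in>verts G. unit_uniform)"

definition run_space :: "access_graph \<Rightarrow> ((nat \<Rightarrow> real) \<times> (nat \<Rightarrow> real)) measure" where
  "run_space G = coin_space \<Otimes>\<^sub>M hash_space G"

definition alg_output :: "'a rand_alg \<Rightarrow> access_graph \<Rightarrow> (nat \<Rightarrow> real) \<times> (nat \<Rightarrow> real) \<Rightarrow> 'a" where
  "alg_output A G = (\<lambda>(c, h). result (A c) (respond G h))"

definition alg_cost :: "'a rand_alg \<Rightarrow> access_graph \<Rightarrow> (nat \<Rightarrow> real) \<times> (nat \<Rightarrow> real) \<Rightarrow> nat" where
  "alg_cost A G = (\<lambda>(c, h). num_queries (A c) (respond G h))"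

definition alg_measurable :: "'a rand_alg \<Rightarrow> access_graph \<Rightarrow> bool" where
  "alg_measurable A G \<longleftrightarrow>
     alg_output A G \<in> run_space G \<rightarrow>\<^sub>M count_space UNIV \<and>
     alg_cost A G \<in> run_space G \<rightarrow>\<^sub>M count_space UNIV"

definition expected_queries :: "'a rand_alg \<Rightarrow> access_graph \<Rightarrow> ennreal" where
  "expected_queries A G = (\<integral>\<^sup>+ x. of_nat (alg_cost A G x) \<partial>run_space G)"

text \<open>
  \<open>uniform_measure M S\<close> is \<open>M\<close> conditioned on \<open>S\<close>: there is an event of probability at least
  \<open>1 - \<delta>\<close> given which the output is exactly uniform on the \<open>s\<close>-element subsets of \<open>X\<close>.
\<close>

definition samples_without_replacement ::
  "'a set rand_alg \<Rightarrow> access_graph \<Rightarrow> 'a set \<Rightarrow> nat \<Rightarrow> real \<Rightarrow> bool" where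
  "samples_without_replacement A G X s \<delta> \<longleftrightarrow>
     (\<exists>S \<in> sets (run_space G).
        measure (run_space G) S \<ge> 1 - \<delta> \<and>
        distr (uniform_measure (run_space G) S) (count_space UNIV) (alg_output A G) =
          measure_pmf (pmf_of_set {Y. Y \<subseteq> X \<and> card Y = s}))"

end

theory Submission
  imports Defs
begin

text \<open>
  Give the \<open>j\<close>-th neighbor slot of every vertex an independent uniform value. The \<open>s\<close> slots with the
  largest values form a uniform sample of oriented edges, so it suffices to find all slots whose value
  is at least \<open>1 - p\<close>, for \<open>p\<close> doubling from about \<open>1 / n\<^sup>2\<close>, until there are \<open>s\<close> of them.

  Slots of light vertices (degree at most \<open>\<tau>\<close>) carry coins, and the cells \<open>(i, j)\<close> with
  \<open>j \<le> \<tau>\<close> and a large coin are probed directly. At a heavy vertex \<open>v\<close> the largest slot value is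
  read off the hash value: it is \<open>(1 - h v) powr (1 / d v)\<close>, so that a value of at least \<open>1 - p\<close> forces
  \<open>h v \<le> p * d v\<close>. Every vertex of degree \<open>d\<close> has, except with small probability, a neighbor whose
  random mark is at most \<open>L / d\<close> with \<open>L = 4 * ln (n / \<delta>)\<close>; scanning the hash-ordered neighbor list of a
  vertex with mark \<open>y\<close> up to hash value \<open>p * L / y\<close> therefore finds all relevant heavy vertices. Failure
  depends on the marks only, hence is independent of the values.

  The threshold \<open>\<tau> = n / (T * sqrt s)\<close> comes from a random time \<open>T\<close> of order \<open>n / sqrt m\<close>, computed from
  the degrees of random vertices only. It affects the cost but not the distribution of the output.
  For the cost of a round, note that it is reached only if fewer than \<open>s\<close> of the slots had a value of at
  least \<open>1 - p / 2\<close>; disregarding the slots of the vertex responsible for a given query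
  makes this event independent of the query, and at least \<open>m\<close> slots remain.
\<close>

section \<open>Products of uniform distributions\<close>

text \<open>Up to logarithms, probing light cells costs \<open>n * \<tau> * s / m\<close> per round
  and scanning costs \<open>n / \<tau>\<close>. They balance at
  \<open>\<tau> = sqrt (m / s)\<close>, but \<open>m\<close> is unknown. With \<open>T\<close> in
  place of \<open>n / sqrt m\<close> the two costs are linear in \<open>1 / T\<close> and in
  \<open>T\<close>, so means of the right order for both suffice and no concentration of
  \<open>T\<close> enters. At a heavy vertex \<open>d\<close> fresh values would be too many to
  inspect without knowing that the vertex matters. Their maximum is tied to the hash value because
  one scan at a neighbor then reveals all candidates around it. The price is that values and list
  orders become dependent. Uniformity is exact on the success event because there every round that
  may end the search yields the same set, whose law is the same for each threshold. Of the
  logarithms in the bound, one \<open>ln n\<close> counts rounds, the second is the mean of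
  \<open>min n (1 / y)\<close> for a uniform mark \<open>y\<close>, and
  \<open>ln (n / \<delta>)\<close> is the mark rate.\<close>

abbreviation unif :: "'i set \<Rightarrow> ('i \<Rightarrow> real) measure" where
  "unif I \<equiv> \<Pi>\<^sub>M i\<in>I. unit_uniform"

lemma sets_unit_uniform [simp]: "sets unit_uniform = sets borel"
  by (simp add: unit_uniform_def)

lemma space_unit_uniform [simp]: "space unit_uniform = UNIV"
  by (simp add: unit_uniform_def)

lemma prob_space_unit_uniform: "prob_space unit_uniform"
  unfolding unit_uniform_def by (rule prob_space_uniform_measure) auto

lemma emeasure_unit_uniform: "A \<in> sets borel \<Longrightarrow> emeasure unit_uniform A = emeasure lborel ({0..1} \<inter> A)"
  unfolding unit_uniform_def by (subst emeasure_uniform_measure) (auto simp: divide_ennreal_def)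

lemma emeasure_unit_uniform_Ioc:
  "0 \<le> a \<Longrightarrow> a \<le> b \<Longrightarrow> b \<le> 1 \<Longrightarrow> emeasure unit_uniform {a<..b} = ennreal (b - a)"
  by (subst emeasure_unit_uniform, simp, subst Int_absorb1) auto

lemma emeasure_unit_uniform_atMost: "emeasure unit_uniform {..t} = ennreal (min 1 t)"
proof -
  have "{0..1} \<inter> {..t} = {0..min 1 t}" by auto
  then show ?thesis
    by (subst emeasure_unit_uniform) (auto simp: emeasure_lborel_Icc_eq min_def ennreal_neg)
qed

lemma emeasure_unit_uniform_greaterThan: "0 \<le> t \<Longrightarrow> emeasure unit_uniform {t<..} = ennreal (1 - min 1 t)"
proof -
  assume "0 \<le> t"
  then have "{0..1} \<inter> {t<..} = {t<..max t 1}" by auto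
  then show ?thesis
    by (subst emeasure_unit_uniform) (auto simp: min_def max_def)
qed

lemma emeasure_unit_uniform_atLeast: "0 \<le> t \<Longrightarrow> t \<le> 1 \<Longrightarrow> emeasure unit_uniform {t..} = ennreal (1 - t)"
proof -
  assume "0 \<le> t" "t \<le> 1"
  then have "{0..1} \<inter> {t..} = {t..1}" by auto
  then show ?thesis
    using \<open>t \<le> 1\<close> by (subst emeasure_unit_uniform) auto
qed

lemma AE_unit_uniform: "AE x in unit_uniform. 0 < x \<and> x < 1"
proof (rule AE_I)
  show "{x \<in> space unit_uniform. \<not> (0 < x \<and> x < 1)} \<subseteq> - {0<..<1}" by auto
  have "{0..1} \<inter> - {0<..<1} = {0, 1::real}" by auto
  then show "emeasure unit_uniform (- {0<..<1}) = 0"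
    by (subst emeasure_unit_uniform) (auto simp: emeasure_lborel_countable)
qed auto

lemma prob_space_unif: "prob_space (unif I)"
  by (intro prob_space_PiM prob_space_unit_uniform)

lemma space_unif: "space (unif I) = extensional I"
  by (simp add: space_PiM PiE_def)

lemma measurable_unif_component: "i \<in> I \<Longrightarrow> (\<lambda>x. x i) \<in> borel_measurable (unif I)"
  using measurable_component_singleton[of i I "\<lambda>_. unit_uniform"] by (simp cong: measurable_cong_sets)

lemma measurable_unifI:
  assumes "\<And>i. i \<in> I \<Longrightarrow> (\<lambda>x. f x i) \<in> borel_measurable M" "\<And>x. x \<in> space M \<Longrightarrow> f x \<in> extensional I"
  shows "f \<in> M \<rightarrow>\<^sub>M unif I"
  using assms by (intro measurable_PiM_single') (auto simp: PiE_def cong: measurable_cong_sets)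

lemma distr_unif_component: "i \<in> I \<Longrightarrow> distr (unif I) unit_uniform (\<lambda>x. x i) = unit_uniform"
  by (rule distr_PiM_component) (auto intro: prob_space_unit_uniform)

lemma distr_unif_reindex:
  assumes "inj_on f I" "f \<in> I \<rightarrow> K"
  shows "distr (unif K) (unif I) (\<lambda>x. \<lambda>i\<in>I. x (f i)) = unif I"
  using distr_PiM_reindex[of K "\<lambda>_. unit_uniform" f I] assms prob_space_unit_uniform by auto

lemma emeasure_unif_component:
  assumes "i \<in> I" "A \<in> sets borel"
  shows "emeasure (unif I) {x \<in> space (unif I). x i \<in> A} = emeasure unit_uniform A"
proof -
  have "emeasure unit_uniform A = emeasure (distr (unif I) unit_uniform (\<lambda>x. x i)) A"
    using assms by (simp add: distr_unif_component)
  also have "\<dots> = emeasure (unif I) {x \<in> space (unif I). x i \<in> A}"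
    using assms by (subst emeasure_distr) (auto intro!: arg_cong2[where f=emeasure] simp: vimage_def)
  finally show ?thesis ..
qed

lemma AE_unif:
  assumes "countable I"
  shows "AE x in unif I. \<forall>i\<in>I. 0 < x i \<and> x i < 1"
proof (subst AE_ball_countable[OF assms])
  show "\<forall>i\<in>I. AE x in unif I. 0 < x i \<and> x i < 1"
  proof
    fix i assume "i \<in> I"
    then show "AE x in unif I. 0 < x i \<and> x i < 1"
      using AE_PiM_component[of I "\<lambda>_. unit_uniform" i "\<lambda>x. 0 < x \<and> x < 1"]
        prob_space_unit_uniform AE_unit_uniform by auto
  qed
qed

section \<open>Independence of functions of disjoint coordinates\<close>

lemma indep_vars_unif:
  assumes "I \<noteq> {}"
  shows "prob_space.indep_vars (unif I) (\<lambda>_. unit_uniform) (\<lambda>i x. x i) I"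
proof -
  interpret prob_space "unif I" by (rule prob_space_unif)
  have "distr (unif I) (unif I) (\<lambda>x. \<lambda>i\<in>I. x i) = distr (unif I) (unif I) (\<lambda>x. x)"
    by (intro distr_cong) (auto simp: space_unif extensional_restrict)
  also have "\<dots> = unif I" by (rule distr_id)
  also have "\<dots> = (\<Pi>\<^sub>M i\<in>I. distr (unif I) unit_uniform (\<lambda>x. x i))"
    by (intro PiM_cong) (auto simp: distr_unif_component)
  finally show ?thesis
    by (subst indep_vars_iff_distr_eq_PiM') (use assms in auto)
qed

text \<open>The dependence hypotheses range over all functions, not only extensional ones, so
  \<open>f\<close> may be evaluated at a vector that keeps its \<open>A\<close>-coordinates and is 0
  elsewhere. Thus \<open>f\<close> factors through the restriction to \<open>A\<close> and
  \<open>g\<close> through that to \<open>B\<close>, and these restrictions are independent.\<close>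

lemma nn_integral_mult_disjoint_coords:
  fixes f g :: "('i \<Rightarrow> real) \<Rightarrow> ennreal"
  assumes f[measurable]: "f \<in> borel_measurable (unif I)" and g[measurable]: "g \<in> borel_measurable (unif I)"
    and sub: "A \<subseteq> I" "B \<subseteq> I" and disj: "A \<inter> B = {}"
    and fA: "\<And>x y. (\<And>i. i \<in> A \<Longrightarrow> x i = y i) \<Longrightarrow> f x = f y"
    and gB: "\<And>x y. (\<And>i. i \<in> B \<Longrightarrow> x i = y i) \<Longrightarrow> g x = g y"
  shows "(\<integral>\<^sup>+x. f x * g x \<partial>unif I) = (\<integral>\<^sup>+x. f x \<partial>unif I) * (\<integral>\<^sup>+x. g x \<partial>unif I)"
proof (cases "I = {}")
  interpret prob_space "unif I" by (rule prob_space_unif)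
  case True
  then have "f = (\<lambda>_. f (\<lambda>_. 0))" "g = (\<lambda>_. g (\<lambda>_. 0))"
    using sub by (auto intro!: fA gB)
  then obtain a b where "f = (\<lambda>_. a)" "g = (\<lambda>_. b)" by blast
  then show ?thesis
    by (simp add: emeasure_space_1)
next
  interpret prob_space "unif I" by (rule prob_space_unif)
  case False
  define ext where "ext C y = (\<lambda>i\<in>I. if i \<in> C then y i else (0::real))" for C :: "'i set" and y
  have ext[measurable]: "ext C \<in> unif C \<rightarrow>\<^sub>M unif I" for C
  proof (intro measurable_unifI)
    fix i assume "i \<in> I"
    then show "(\<lambda>x. ext C x i) \<in> borel_measurable (unif C)"
      by (cases "i \<in> C") (auto simp: ext_def intro: measurable_unif_component)
  qed (auto simp: ext_def)
  have 1: "f (ext A (restrict x A)) = f x" for x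
    using sub by (intro fA) (auto simp: ext_def)
  have 2: "g (ext B (restrict x B)) = g x" for x
    using sub by (intro gB) (auto simp: ext_def)
  have "indep_var (unif A) (\<lambda>x. restrict (\<lambda>i. x i) A) (unif B) (\<lambda>x. restrict (\<lambda>i. x i) B)"
    by (rule indep_var_restrict[OF indep_vars_unif]) (use sub disj False in auto)
  then have "indep_var borel ((\<lambda>y. f (ext A y)) \<circ> (\<lambda>x. restrict x A)) borel ((\<lambda>y. g (ext B y)) \<circ> (\<lambda>x. restrict x B))"
    by (rule indep_var_compose) measurable
  then have "indep_var borel f borel g"
    by (simp add: comp_def 1 2)
  then have "indep_vars (\<lambda>_. borel) (case_bool f g) UNIV"
    unfolding indep_var_def by (rule back_subst[where P="\<lambda>M. indep_vars M (case_bool f g) UNIV"]) (auto split: bool.split)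
  from indep_vars_nn_integral[OF _ this] show ?thesis
    by (simp add: UNIV_bool mult.commute)
qed

lemma emeasure_Int_disjoint_coords:
  assumes "Measurable.pred (unif I) P" "Measurable.pred (unif I) Q"
    and "A \<subseteq> I" "B \<subseteq> I" "A \<inter> B = {}"
    and P: "\<And>x y. (\<And>i. i \<in> A \<Longrightarrow> x i = y i) \<Longrightarrow> P x = P y"
    and Q: "\<And>x y. (\<And>i. i \<in> B \<Longrightarrow> x i = y i) \<Longrightarrow> Q x = Q y"
  shows "emeasure (unif I) {x\<in>space (unif I). P x \<and> Q x} =
    emeasure (unif I) {x\<in>space (unif I). P x} * emeasure (unif I) {x\<in>space (unif I). Q x}"
proof -
  have *: "emeasure (unif I) {x\<in>space (unif I). R x} = (\<integral>\<^sup>+x. indicator {x. R x} x \<partial>unif I)"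
    if [measurable]: "Measurable.pred (unif I) R" for R
  proof -
    have "(\<integral>\<^sup>+x. indicator {x. R x} x \<partial>unif I) = (\<integral>\<^sup>+x. indicator {x\<in>space (unif I). R x} x \<partial>unif I)"
      by (intro nn_integral_cong) (auto simp: indicator_def)
    then show ?thesis by simp
  qed
  have [measurable]: "Measurable.pred (unif I) P" "Measurable.pred (unif I) Q" by fact+
  have "emeasure (unif I) {x\<in>space (unif I). P x \<and> Q x} = (\<integral>\<^sup>+x. indicator {x. P x} x * indicator {x. Q x} x \<partial>unif I)"
    by (subst *) (auto intro!: nn_integral_cong simp: indicator_def)
  also have "\<dots> = (\<integral>\<^sup>+x. indicator {x. P x} x \<partial>unif I) * (\<integral>\<^sup>+x. indicator {x. Q x} x \<partial>unif I)"
  proof (rule nn_integral_mult_disjoint_coords)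
    fix x y :: "'a \<Rightarrow> real" assume "\<And>i. i \<in> A \<Longrightarrow> x i = y i"
    from P[of x y, OF this] show "indicator {x. P x} x = (indicator {x. P x} y :: ennreal)" by (auto simp: indicator_def)
  next
    fix x y :: "'a \<Rightarrow> real" assume "\<And>i. i \<in> B \<Longrightarrow> x i = y i"
    from Q[of x y, OF this] show "indicator {x. Q x} x = (indicator {x. Q x} y :: ennreal)" by (auto simp: indicator_def)
  next
    show "A \<subseteq> I" "B \<subseteq> I" "A \<inter> B = {}" by fact+
    show "indicator {x. P x} \<in> borel_measurable (unif I)" "indicator {x. Q x} \<in> borel_measurable (unif I)"
      by measurable
  qed
  also have "\<dots> = emeasure (unif I) {x\<in>space (unif I). P x} * emeasure (unif I) {x\<in>space (unif I). Q x}"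
    by (simp add: *)
  finally show ?thesis .
qed

lemma sigma_finite_unit_uniform: "sigma_finite_measure unit_uniform"
  by (intro prob_space_imp_sigma_finite prob_space_unit_uniform)

lemma distr_pair_disjoint_coords:
  assumes X[measurable]: "X \<in> unif I \<rightarrow>\<^sub>M M1" and Y[measurable]: "Y \<in> unif I \<rightarrow>\<^sub>M M2"
    and "A \<subseteq> I" "B \<subseteq> I" "A \<inter> B = {}"
    and XA: "\<And>x y. (\<And>i. i \<in> A \<Longrightarrow> x i = y i) \<Longrightarrow> X x = X y"
    and YB: "\<And>x y. (\<And>i. i \<in> B \<Longrightarrow> x i = y i) \<Longrightarrow> Y x = Y y"
  shows "distr (unif I) (M1 \<Otimes>\<^sub>M M2) (\<lambda>x. (X x, Y x)) = distr (unif I) M1 X \<Otimes>\<^sub>M distr (unif I) M2 Y"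
proof (rule pair_measure_eqI[symmetric])
  interpret prob_space "unif I" by (rule prob_space_unif)
  interpret X: prob_space "distr (unif I) M1 X" by (rule prob_space_distr) simp
  interpret Y: prob_space "distr (unif I) M2 Y" by (rule prob_space_distr) simp
  show "sigma_finite_measure (distr (unif I) M1 X)" "sigma_finite_measure (distr (unif I) M2 Y)"
    by unfold_locales
  show "sets (distr (unif I) M1 X \<Otimes>\<^sub>M distr (unif I) M2 Y) = sets (distr (unif I) (M1 \<Otimes>\<^sub>M M2) (\<lambda>x. (X x, Y x)))"
    by (simp cong: sets_pair_measure_cong)
  fix S T assume "S \<in> sets (distr (unif I) M1 X)" "T \<in> sets (distr (unif I) M2 Y)"
  then have [measurable]: "S \<in> sets M1" "T \<in> sets M2" by auto
  have "emeasure (unif I) {x \<in> space (unif I). X x \<in> S \<and> Y x \<in> T} =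
    emeasure (unif I) {x \<in> space (unif I). X x \<in> S} * emeasure (unif I) {x \<in> space (unif I). Y x \<in> T}"
  proof (rule emeasure_Int_disjoint_coords)
    show "A \<subseteq> I" "B \<subseteq> I" "A \<inter> B = {}" by fact+
    show "Measurable.pred (unif I) (\<lambda>x. X x \<in> S)" "Measurable.pred (unif I) (\<lambda>x. Y x \<in> T)"
      by measurable
  next
    fix x y :: "'a \<Rightarrow> real"
    show "(\<And>i. i \<in> A \<Longrightarrow> x i = y i) \<Longrightarrow> (X x \<in> S) = (X y \<in> S)" using XA[of x y] by auto
    show "(\<And>i. i \<in> B \<Longrightarrow> x i = y i) \<Longrightarrow> (Y x \<in> T) = (Y y \<in> T)" using YB[of x y] by auto
  qed
  moreover have "X -` S \<inter> space (unif I) = {x \<in> space (unif I). X x \<in> S}"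
    "Y -` T \<inter> space (unif I) = {x \<in> space (unif I). Y x \<in> T}"
    "(\<lambda>x. (X x, Y x)) -` (S \<times> T) \<inter> space (unif I) = {x \<in> space (unif I). X x \<in> S \<and> Y x \<in> T}"
    by auto
  ultimately show "emeasure (distr (unif I) M1 X) S * emeasure (distr (unif I) M2 Y) T =
    emeasure (distr (unif I) (M1 \<Otimes>\<^sub>M M2) (\<lambda>x. (X x, Y x))) (S \<times> T)"
    by (simp add: emeasure_distr)
qed

text \<open>By Fubini, since every section of the diagonal is a single point.\<close>

lemma AE_unif_distinct:
  assumes "i \<in> I" "j \<in> I" "i \<noteq> j"
  shows "AE x in unif I. x i \<noteq> x j"
proof -
  have [measurable]: "(\<lambda>x. x i) \<in> borel_measurable (unif I)" "(\<lambda>x. x j) \<in> borel_measurable (unif I)"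
    using assms by (auto intro: measurable_unif_component)
  have pm: "(\<lambda>x. (x i, x j)) \<in> unif I \<rightarrow>\<^sub>M unit_uniform \<Otimes>\<^sub>M unit_uniform"
    by (intro measurable_Pair) (use assms in \<open>auto cong: measurable_cong_sets intro: measurable_unif_component\<close>)
  have eq: "distr (unif I) (unit_uniform \<Otimes>\<^sub>M unit_uniform) (\<lambda>x. (x i, x j)) = unit_uniform \<Otimes>\<^sub>M unit_uniform"
    using assms distr_pair_disjoint_coords[of "\<lambda>x. x i" I unit_uniform "\<lambda>x. x j" unit_uniform "{i}" "{j}"]
    by (simp add: distr_unif_component)
  let ?D = "{w \<in> space (unit_uniform \<Otimes>\<^sub>M unit_uniform). fst w = snd w}"
  have D: "?D \<in> sets (unit_uniform \<Otimes>\<^sub>M unit_uniform)"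
  proof -
    have "Measurable.pred (borel \<Otimes>\<^sub>M borel) (\<lambda>w :: real \<times> real. fst w = snd w)"
      unfolding pred_def by (rule borel_measurable_eq) measurable
    moreover have "sets (unit_uniform \<Otimes>\<^sub>M unit_uniform) = sets (borel \<Otimes>\<^sub>M borel)"
      by (intro sets_pair_measure_cong) auto
    ultimately show ?thesis by (simp add: pred_def space_pair_measure)
  qed
  have "emeasure (unif I) {x \<in> space (unif I). x i = x j} = emeasure (unit_uniform \<Otimes>\<^sub>M unit_uniform) ?D"
  proof -
    have "emeasure (unit_uniform \<Otimes>\<^sub>M unit_uniform) ?D =
      emeasure (distr (unif I) (unit_uniform \<Otimes>\<^sub>M unit_uniform) (\<lambda>x. (x i, x j))) ?D"
      by (simp only: eq)
    also have "\<dots> = emeasure (unif I) {x \<in> space (unif I). x i = x j}"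
      using D pm by (subst emeasure_distr) (auto intro!: arg_cong2[where f=emeasure] simp: space_pair_measure)
    finally show ?thesis ..
  qed
  also have "\<dots> = (\<integral>\<^sup>+a. emeasure unit_uniform (Pair a -` ?D) \<partial>unit_uniform)"
    by (rule sigma_finite_measure.emeasure_pair_measure_alt[OF sigma_finite_unit_uniform D])
  also have "\<dots> = (\<integral>\<^sup>+a. 0 \<partial>unit_uniform)"
  proof (intro nn_integral_cong)
    fix a :: real
    have "Pair a -` ?D = {a}" by (auto simp: space_pair_measure)
    moreover have "emeasure lborel ({0..1} \<inter> {a}) = 0" by (rule emeasure_lborel_countable) auto
    ultimately show "emeasure unit_uniform (Pair a -` ?D) = 0"
      by (simp add: emeasure_unit_uniform)
  qed
  finally have "emeasure (unif I) {x \<in> space (unif I). x i = x j} = 0" by simp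
  then show ?thesis
    by (intro AE_I[where N="{x \<in> space (unif I). x i = x j}"]) auto
qed

section \<open>Scaling, maximum and normalised vector of independent uniform numbers\<close>

lemma emeasure_unif_PiE:
  assumes "finite J" "\<And>j. j \<in> J \<Longrightarrow> A j \<in> sets borel"
  shows "emeasure (unif J) (Pi\<^sub>E J A) = (\<Prod>j\<in>J. emeasure unit_uniform (A j))"
proof -
  interpret product_sigma_finite "\<lambda>_. unit_uniform"
    by (simp add: product_sigma_finite_def sigma_finite_unit_uniform)
  show ?thesis using assms by (intro emeasure_PiM) auto
qed

lemma emeasure_unit_uniform_scale:
  assumes t: "0 < t" "t \<le> 1" and [measurable]: "A \<in> sets borel"
  shows "emeasure unit_uniform ({..t} \<inter> A) = ennreal t * emeasure unit_uniform {x. t * x \<in> A}"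
proof -
  let ?B = "{0..1} \<inter> ({..t} \<inter> A)"
  have [measurable]: "{x. t * x \<in> A} \<in> sets borel"
    using measurable_sets_borel[of "\<lambda>x. t * x" borel A] by (simp add: vimage_def)
  have "emeasure lborel ?B = (\<integral>\<^sup>+x. indicator ?B x \<partial>lborel)" by simp
  also have "\<dots> = ennreal t * (\<integral>\<^sup>+x. indicator ?B (0 + t * x) \<partial>lborel)"
    using t by (subst nn_integral_real_affine[where c=t and t=0]) auto
  also have "(\<integral>\<^sup>+x. indicator ?B (0 + t * x) \<partial>lborel) = (\<integral>\<^sup>+x. indicator ({0..1} \<inter> {x. t * x \<in> A}) x \<partial>lborel)"
    using t by (intro nn_integral_cong) (auto simp: indicator_def zero_le_mult_iff mult_le_cancel_left1 intro: mult_le_one)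
  finally show ?thesis
    by (simp add: emeasure_unit_uniform)
qed

text \<open>Restricting the uniform law to the box of side \<open>t\<close> gives the same measure
  as shrinking a uniform vector by \<open>t\<close> and weighting with the volume of the box. Both
  are identified with one product measure by evaluating them on boxes.\<close>

lemma emeasure_unif_scale:
  assumes J: "finite J" and t: "0 < t" "t \<le> 1" and B: "B \<in> sets (unif J)"
  shows "emeasure (unif J) {x \<in> space (unif J). (\<forall>j\<in>J. x j \<le> t) \<and> x \<in> B} =
    ennreal (t ^ card J) * emeasure (unif J) {x \<in> space (unif J). (\<lambda>j\<in>J. t * x j) \<in> B}"
proof -
  let ?S = "{x \<in> space (unif J). \<forall>j\<in>J. x j \<le> t}"
  have [measurable]: "(\<lambda>x. x j) \<in> borel_measurable (unif J)" if "j \<in> J" for j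
    using that by (rule measurable_unif_component)
  have S[measurable]: "?S \<in> sets (unif J)" using J by measurable
  have sc[measurable]: "(\<lambda>x. \<lambda>j\<in>J. t * x j) \<in> unif J \<rightarrow>\<^sub>M unif J"
    by (intro measurable_unifI) auto
  let ?M = "\<lambda>_. density unit_uniform (indicator {..t})"
  have "finite_measure (density unit_uniform (indicator {..t}))"
  proof (intro finite_measureI)
    have "emeasure (density unit_uniform (indicator {..t})) (space (density unit_uniform (indicator {..t}))) = emeasure unit_uniform {..t}"
      by (subst emeasure_density) (auto intro!: borel_measurable_indicator)
    then show "emeasure (density unit_uniform (indicator {..t})) (space (density unit_uniform (indicator {..t}))) \<noteq> \<infinity>"
      by (simp add: emeasure_unit_uniform_atMost)
  qed
  then interpret product_sigma_finite ?M
    by (simp add: product_sigma_finite_def finite_measure.axioms(1))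
  have M: "emeasure (density unit_uniform (indicator {..t})) A = emeasure unit_uniform ({..t} \<inter> A)"
    if "A \<in> sets borel" for A
    using that by (subst emeasure_density) (auto intro!: borel_measurable_indicator simp flip: indicator_inter_arith)
  have s: "sets (PiM J ?M) = sets (unif J)" by (intro sets_PiM_cong) auto
  have 1: "density (unif J) (indicator ?S) = PiM J ?M"
  proof (rule PiM_eqI[OF J])
    fix A assume "\<And>i. i \<in> J \<Longrightarrow> A i \<in> sets (density unit_uniform (indicator {..t}))"
    then have A: "A i \<in> sets borel" if "i \<in> J" for i using that by auto
    have "Pi\<^sub>E J A \<in> sets (unif J)" using J A by (intro sets_PiM_I_finite) auto
    then have "emeasure (density (unif J) (indicator ?S)) (Pi\<^sub>E J A) = emeasure (unif J) (?S \<inter> Pi\<^sub>E J A)"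
      by (subst emeasure_density) (auto simp flip: indicator_inter_arith)
    also have "?S \<inter> Pi\<^sub>E J A = Pi\<^sub>E J (\<lambda>j. {..t} \<inter> A j)"
      by (auto simp: space_unif PiE_iff)
    also have "emeasure (unif J) \<dots> = (\<Prod>j\<in>J. emeasure unit_uniform ({..t} \<inter> A j))"
      using A J by (intro emeasure_unif_PiE) auto
    finally show "emeasure (density (unif J) (indicator ?S)) (Pi\<^sub>E J A) = (\<Prod>i\<in>J. emeasure (?M i) (A i))"
      using A by (simp add: M)
  qed (simp add: s)
  have 2: "scale_measure (ennreal (t ^ card J)) (distr (unif J) (unif J) (\<lambda>x. \<lambda>j\<in>J. t * x j)) = PiM J ?M"
  proof (rule PiM_eqI[OF J])
    fix A assume "\<And>i. i \<in> J \<Longrightarrow> A i \<in> sets (density unit_uniform (indicator {..t}))"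
    then have A: "A i \<in> sets borel" if "i \<in> J" for i using that by auto
    have A': "{x. t * x \<in> A i} \<in> sets borel" if "i \<in> J" for i
      using measurable_sets_borel[of "\<lambda>x. t * x" borel "A i"] A[OF that] by (simp add: vimage_def)
    have m: "Pi\<^sub>E J A \<in> sets (unif J)" using J A by (intro sets_PiM_I_finite) auto
    have "(\<lambda>x. \<lambda>j\<in>J. t * x j) -` Pi\<^sub>E J A \<inter> space (unif J) = Pi\<^sub>E J (\<lambda>j. {x. t * x \<in> A j})"
      by (auto simp: space_unif PiE_iff extensional_def)
    moreover have "emeasure (unif J) (Pi\<^sub>E J (\<lambda>j. {x. t * x \<in> A j})) = (\<Prod>j\<in>J. emeasure unit_uniform {x. t * x \<in> A j})"
      using A' J by (intro emeasure_unif_PiE) auto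
    moreover have "(\<Prod>j\<in>J. emeasure unit_uniform ({..t} \<inter> A j)) = (\<Prod>j\<in>J. ennreal t * emeasure unit_uniform {x. t * x \<in> A j})"
      using t A by (intro prod.cong) (auto simp: emeasure_unit_uniform_scale)
    ultimately show "emeasure (scale_measure (ennreal (t ^ card J)) (distr (unif J) (unif J) (\<lambda>x. \<lambda>j\<in>J. t * x j))) (Pi\<^sub>E J A) =
      (\<Prod>i\<in>J. emeasure (?M i) (A i))"
      using A t m by (simp add: M emeasure_distr prod.distrib ennreal_power)
  qed (simp add: s)
  have "emeasure (unif J) {x \<in> space (unif J). (\<forall>j\<in>J. x j \<le> t) \<and> x \<in> B} = emeasure (density (unif J) (indicator ?S)) B"
  proof -
    have "{x \<in> space (unif J). (\<forall>j\<in>J. x j \<le> t) \<and> x \<in> B} = ?S \<inter> B" by auto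
    then show ?thesis using B by (subst emeasure_density) (auto simp flip: indicator_inter_arith)
  qed
  also have "\<dots> = emeasure (scale_measure (ennreal (t ^ card J)) (distr (unif J) (unif J) (\<lambda>x. \<lambda>j\<in>J. t * x j))) B"
    by (simp add: 1 2)
  also have "\<dots> = ennreal (t ^ card J) * emeasure (unif J) {x \<in> space (unif J). (\<lambda>j\<in>J. t * x j) \<in> B}"
    using B by (subst emeasure_scale_measure, subst emeasure_distr) (auto simp: vimage_def Int_def conj_commute)
  finally show ?thesis .
qed

text \<open>The event \<open>mx x \<le> t\<close> confines all coordinates to a box. On it the
  vector is distributed as \<open>t\<close> times a uniform vector, and scaling leaves
  \<open>ratio\<close> unchanged. So the conditional law of \<open>ratio\<close> does not depend on
  \<open>t\<close>, and the volume of the box is the distribution function of the maximum.\<close>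

lemma unif_max_ratio:
  assumes J: "finite J" "J \<noteq> {}"
  defines "mx \<equiv> \<lambda>x. Max (x ` J)"
  defines "ratio \<equiv> \<lambda>x. \<lambda>j\<in>J. x j / mx x"
  shows "distr (unif J) (borel \<Otimes>\<^sub>M unif J) (\<lambda>x. (mx x, ratio x)) =
      distr (unif J) borel mx \<Otimes>\<^sub>M distr (unif J) (unif J) ratio"
    and "\<And>t. 0 \<le> t \<Longrightarrow> t \<le> 1 \<Longrightarrow> emeasure (unif J) {x \<in> space (unif J). mx x \<le> t} = ennreal (t ^ card J)"
    and "mx \<in> borel_measurable (unif J)" "ratio \<in> unif J \<rightarrow>\<^sub>M unif J"
proof -
  interpret prob_space "unif J" by (rule prob_space_unif)
  have comp[measurable]: "(\<lambda>x. x j) \<in> borel_measurable (unif J)" if "j \<in> J" for j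
    using that by (rule measurable_unif_component)
  show mx[measurable]: "mx \<in> borel_measurable (unif J)"
    unfolding mx_def by (rule borel_measurable_Max) (use J in auto)
  show ratio[measurable]: "ratio \<in> unif J \<rightarrow>\<^sub>M unif J"
    unfolding ratio_def by (intro measurable_unifI) auto
  have mx_le: "mx x \<le> t \<longleftrightarrow> (\<forall>j\<in>J. x j \<le> t)" for x t
    using J by (auto simp: mx_def)
  have ratio_scale: "ratio (\<lambda>j\<in>J. t * x j) = ratio x" if "0 < t" for t x
  proof -
    have "(\<lambda>j\<in>J. t * x j) ` J = (*) t ` (x ` J)" by (auto simp: image_image)
    moreover have "mono ((*) t)" using that by (intro monoI mult_left_mono) auto
    then have "t * Max (x ` J) = Max ((*) t ` (x ` J))"
      by (rule mono_Max_commute) (use J in auto)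
    ultimately have "mx (\<lambda>j\<in>J. t * x j) = t * mx x"
      unfolding mx_def by (simp only:)
    then show ?thesis using that by (auto simp: ratio_def fun_eq_iff)
  qed
  have AE01: "AE x in unif J. \<forall>j\<in>J. 0 < x j \<and> x j < 1"
    using J by (intro AE_unif countable_finite)
  have AEmx: "AE x in unif J. 0 < mx x \<and> mx x < 1"
    using AE01 by eventually_elim (use J in \<open>auto simp: mx_def Max_gr_iff\<close>)
  have key: "emeasure (unif J) {x \<in> space (unif J). mx x \<le> t \<and> ratio x \<in> B} =
      ennreal (t ^ card J) * emeasure (unif J) {x \<in> space (unif J). ratio x \<in> B}"
    if t: "0 < t" "t \<le> 1" and B[measurable]: "B \<in> sets (unif J)" for t B
  proof -
    have "emeasure (unif J) {x \<in> space (unif J). (\<forall>j\<in>J. x j \<le> t) \<and> x \<in> {x \<in> space (unif J). ratio x \<in> B}} =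
      ennreal (t ^ card J) * emeasure (unif J) {x \<in> space (unif J). (\<lambda>j\<in>J. t * x j) \<in> {x \<in> space (unif J). ratio x \<in> B}}"
      by (rule emeasure_unif_scale) (use J t in auto)
    also have "{x \<in> space (unif J). (\<lambda>j\<in>J. t * x j) \<in> {x \<in> space (unif J). ratio x \<in> B}} = {x \<in> space (unif J). ratio x \<in> B}"
      using t by (auto simp: ratio_scale space_unif)
    also have "{x \<in> space (unif J). (\<forall>j\<in>J. x j \<le> t) \<and> x \<in> {x \<in> space (unif J). ratio x \<in> B}} =
      {x \<in> space (unif J). mx x \<le> t \<and> ratio x \<in> B}"
      by (auto simp: mx_le)
    finally show ?thesis .
  qed
  show cdf: "emeasure (unif J) {x \<in> space (unif J). mx x \<le> t} = ennreal (t ^ card J)" if "0 \<le> t" "t \<le> 1" for t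
  proof (cases "t = 0")
    case True
    have "AE x in unif J. \<not> mx x \<le> t" using AEmx by eventually_elim (use True in auto)
    then have "emeasure (unif J) {x \<in> space (unif J). mx x \<le> t} = 0"
      by (intro emeasure_eq_0_AE) auto
    with True J show ?thesis by (simp add: card_gt_0_iff)
  next
    case False
    have "{x \<in> space (unif J). ratio x \<in> space (unif J)} = space (unif J)"
      using measurable_space[OF ratio] by auto
    with key[of t "space (unif J)"] False that show ?thesis
      using measurable_space[OF ratio] by (simp add: emeasure_space_1 cong: conj_cong)
  qed
  have indep: "prob {x \<in> space (unif J). mx x \<le> t \<and> ratio x \<in> B} =
      prob {x \<in> space (unif J). mx x \<le> t} * prob {x \<in> space (unif J). ratio x \<in> B}"
    if B[measurable]: "B \<in> sets (unif J)" for t B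
  proof -
    consider "t \<le> 0" | "0 < t" "t \<le> 1" | "1 < t" by linarith
    then show ?thesis
    proof cases
      case 1
      have "AE x in unif J. \<not> mx x \<le> t" using AEmx by eventually_elim (use 1 in auto)
      moreover from this have "AE x in unif J. \<not> (mx x \<le> t \<and> ratio x \<in> B)" by eventually_elim auto
      ultimately have "emeasure (unif J) {x \<in> space (unif J). mx x \<le> t} = 0"
          "emeasure (unif J) {x \<in> space (unif J). mx x \<le> t \<and> ratio x \<in> B} = 0"
        by (auto intro!: emeasure_eq_0_AE)
      then show ?thesis by (simp add: measure_def)
    next
      case 2
      with key[OF 2 B] cdf[of t] show ?thesis
        by (simp add: measure_def enn2real_mult)
    next
      case 3
      have *: "AE x in unif J. mx x \<le> t" using AEmx by eventually_elim (use 3 in auto)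
      then have "prob {x \<in> space (unif J). mx x \<le> t} = 1"
        by (subst prob_Collect_eq_1) auto
      moreover have "prob {x \<in> space (unif J). mx x \<le> t \<and> ratio x \<in> B} = prob {x \<in> space (unif J). ratio x \<in> B}"
      proof (rule finite_measure_eq_AE)
        show "AE x in unif J. (x \<in> {x \<in> space (unif J). mx x \<le> t \<and> ratio x \<in> B}) = (x \<in> {x \<in> space (unif J). ratio x \<in> B})"
          using * by eventually_elim auto
      qed auto
      ultimately show ?thesis by simp
    qed
  qed
  show "distr (unif J) (borel \<Otimes>\<^sub>M unif J) (\<lambda>x. (mx x, ratio x)) =
      distr (unif J) borel mx \<Otimes>\<^sub>M distr (unif J) (unif J) ratio"
  proof (rule pair_measure_eqI[symmetric])
    show "sigma_finite_measure (distr (unif J) borel mx)" "sigma_finite_measure (distr (unif J) (unif J) ratio)"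
      by (intro prob_space_imp_sigma_finite prob_space_distr mx ratio)+
    show "sets (distr (unif J) borel mx \<Otimes>\<^sub>M distr (unif J) (unif J) ratio) =
        sets (distr (unif J) (borel \<Otimes>\<^sub>M unif J) (\<lambda>x. (mx x, ratio x)))"
      by (simp cong: sets_pair_measure_cong)
    fix A B assume "A \<in> sets (distr (unif J) borel mx)" "B \<in> sets (distr (unif J) (unif J) ratio)"
    then have A[measurable]: "A \<in> sets borel" and B[measurable]: "B \<in> sets (unif J)" by auto
    let ?R = "{x \<in> space (unif J). ratio x \<in> B}"
    \<comment> \<open>For fixed \<open>B\<close> both sides are finite measures in \<open>A\<close>
      on the line, so it is enough to compare them on open upper half-lines, the complements of the
      events in \<open>indep\<close>.\<close>
    have "scale_measure (emeasure (unif J) ?R) (distr (unif J) borel mx) = distr (density (unif J) (indicator ?R)) borel mx"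
    proof (rule measure_eqI_lessThan)
      fix t :: real
      have ne: "{x \<in> space (unif J). t < mx x \<and> Q x} = {x \<in> space (unif J). Q x} - {x \<in> space (unif J). mx x \<le> t \<and> Q x}" for Q
        by auto
      have 1: "prob {x \<in> space (unif J). t < mx x \<and> ratio x \<in> B} = prob ?R - prob {x \<in> space (unif J). mx x \<le> t \<and> ratio x \<in> B}"
        unfolding ne by (rule finite_measure_Diff) auto
      have "{x \<in> space (unif J). t < mx x} = space (unif J) - {x \<in> space (unif J). mx x \<le> t}" by auto
      then have 2: "prob {x \<in> space (unif J). t < mx x} = 1 - prob {x \<in> space (unif J). mx x \<le> t}"
        by (simp only:) (subst prob_compl, auto)
      have 3: "emeasure (unif J) {x \<in> space (unif J). t < mx x \<and> ratio x \<in> B} = emeasure (unif J) ?R * emeasure (unif J) {x \<in> space (unif J). t < mx x}"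
      proof -
        have "prob {x \<in> space (unif J). t < mx x \<and> ratio x \<in> B} = prob ?R * prob {x \<in> space (unif J). t < mx x}"
          by (simp add: 1 2 indep[OF B] algebra_simps)
        then show ?thesis by (simp add: emeasure_eq_measure flip: ennreal_mult)
      qed
      have "emeasure (distr (density (unif J) (indicator ?R)) borel mx) {t<..} = emeasure (density (unif J) (indicator ?R)) {x \<in> space (unif J). t < mx x}"
        by (subst emeasure_distr) (auto intro!: arg_cong2[where f=emeasure])
      also have "\<dots> = emeasure (unif J) (?R \<inter> {x \<in> space (unif J). t < mx x})"
        by (subst emeasure_density) (auto simp flip: indicator_inter_arith)
      also have "?R \<inter> {x \<in> space (unif J). t < mx x} = {x \<in> space (unif J). t < mx x \<and> ratio x \<in> B}" by auto
      finally have 4: "emeasure (distr (density (unif J) (indicator ?R)) borel mx) {t<..} = emeasure (unif J) {x \<in> space (unif J). t < mx x \<and> ratio x \<in> B}" .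
      have 5: "emeasure (distr (unif J) borel mx) {t<..} = emeasure (unif J) {x \<in> space (unif J). t < mx x}"
        by (subst emeasure_distr) (auto intro!: arg_cong2[where f=emeasure])
      show "emeasure (scale_measure (emeasure (unif J) ?R) (distr (unif J) borel mx)) {t<..} =
          emeasure (distr (density (unif J) (indicator ?R)) borel mx) {t<..}"
        by (simp add: 3 4 5)
      show "emeasure (scale_measure (emeasure (unif J) ?R) (distr (unif J) borel mx)) {t<..} < \<infinity>"
        by (simp add: 5 emeasure_eq_measure ennreal_mult_less_top)
    qed auto
    then have "emeasure (scale_measure (emeasure (unif J) ?R) (distr (unif J) borel mx)) A =
        emeasure (distr (density (unif J) (indicator ?R)) borel mx) A" by simp
    also have "\<dots> = emeasure (density (unif J) (indicator ?R)) (mx -` A \<inter> space (unif J))"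
      by (subst emeasure_distr) auto
    also have "\<dots> = emeasure (unif J) (?R \<inter> (mx -` A \<inter> space (unif J)))"
      by (subst emeasure_density) (auto simp flip: indicator_inter_arith)
    also have "?R \<inter> (mx -` A \<inter> space (unif J)) = (\<lambda>x. (mx x, ratio x)) -` (A \<times> B) \<inter> space (unif J)" by auto
    also have "emeasure (unif J) \<dots> = emeasure (distr (unif J) (borel \<Otimes>\<^sub>M unif J) (\<lambda>x. (mx x, ratio x))) (A \<times> B)"
      by (subst emeasure_distr) auto
    finally show "emeasure (distr (unif J) borel mx) A * emeasure (distr (unif J) (unif J) ratio) B =
        emeasure (distr (unif J) (borel \<Otimes>\<^sub>M unif J) (\<lambda>x. (mx x, ratio x))) (A \<times> B)"
      using emeasure_distr[OF ratio B]
      by (simp add: mult.commute vimage_def Int_def conj_commute)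
  qed
qed

lemma measure_eqI_cdf_unit:
  fixes M N :: "real measure"
  assumes "prob_space M" "prob_space N" and sets: "sets M = sets borel" "sets N = sets borel"
    and AE: "AE x in M. 0 \<le> x \<and> x \<le> 1" "AE x in N. 0 \<le> x \<and> x \<le> 1"
    and eq: "\<And>t. 0 \<le> t \<Longrightarrow> t \<le> 1 \<Longrightarrow> emeasure M {..t} = emeasure N {..t}"
  shows "M = N"
proof (rule measure_eqI_lessThan[OF sets])
  interpret M: prob_space M by fact
  interpret N: prob_space N by fact
  have sp: "space M = UNIV" "space N = UNIV" using sets by (auto dest: sets_eq_imp_space_eq)
  fix t :: real
  show "emeasure M {t<..} < \<infinity>" by (simp add: M.emeasure_eq_measure)
  have le: "emeasure M {..t} = emeasure N {..t}"
  proof -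
    consider "t < 0" | "0 \<le> t" "t \<le> 1" | "1 < t" by linarith
    then show ?thesis
    proof cases
      case 1
      have "AE x in M. x \<notin> {..t}" using AE(1) by eventually_elim (use 1 in auto)
      moreover have "AE x in N. x \<notin> {..t}" using AE(2) by eventually_elim (use 1 in auto)
      ultimately have "emeasure M {..t} = 0" "emeasure N {..t} = 0"
        using emeasure_eq_0_AE[of "\<lambda>x. x \<in> {..t}" M] emeasure_eq_0_AE[of "\<lambda>x. x \<in> {..t}" N]
        by (auto simp: sp atMost_def)
      then show ?thesis by simp
    next
      case 2 then show ?thesis by (rule eq)
    next
      case 3
      have "AE x in M. x \<in> {..t}" using AE(1) by eventually_elim (use 3 in auto)
      moreover have "AE x in N. x \<in> {..t}" using AE(2) by eventually_elim (use 3 in auto)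
      ultimately have "emeasure M {..t} = 1" "emeasure N {..t} = 1"
        by (auto intro!: M.emeasure_eq_1_AE N.emeasure_eq_1_AE simp: sets)
      then show ?thesis by simp
    qed
  qed
  have "{t<..} = space M - {..t}" "{t<..} = space N - {..t}" by (auto simp: sp)
  moreover have "emeasure M (space M - {..t}) = 1 - emeasure M {..t}"
    by (subst emeasure_compl) (auto simp: sets M.emeasure_space_1)
  moreover have "emeasure N (space N - {..t}) = 1 - emeasure N {..t}"
    by (subst emeasure_compl) (auto simp: sets N.emeasure_space_1)
  ultimately show "emeasure M {t<..} = emeasure N {t<..}"
    using le by simp
qed

text \<open>The maximum and the normalised vector of independent uniform numbers are independent,
  so the maximum may be replaced by an independent copy of itself.\<close>

lemma distr_unif_replace_max:
  assumes J: "finite J" "J \<noteq> {}" and a: "a \<in> I" and f: "f ` J \<subseteq> I" "inj_on f J" "a \<notin> f ` J"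
  shows "distr (unif I) (unif J)
    (\<lambda>z. \<lambda>j\<in>J. root (card J) (1 - z a) * z (f j) / Max ((\<lambda>j. z (f j)) ` J)) = unif J"
proof -
  let ?d = "card J"
  have d: "0 < ?d" using J by (simp add: card_gt_0_iff)
  define mx where "mx \<equiv> \<lambda>x::_ \<Rightarrow> real. Max (x ` J)"
  define ratio where "ratio \<equiv> \<lambda>x. \<lambda>j\<in>J. x j / mx x"
  define X where "X z = root ?d (1 - z a)" for z :: "_ \<Rightarrow> real"
  define Y where "Y z = (\<lambda>j\<in>J. z (f j))" for z :: "_ \<Rightarrow> real"
  define psi where "psi w = (\<lambda>j\<in>J. fst w * snd w j)" for w :: "real \<times> (_ \<Rightarrow> real)"
  have [measurable]: "mx \<in> borel_measurable (unif J)" "ratio \<in> unif J \<rightarrow>\<^sub>M unif J"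
    unfolding mx_def ratio_def by (rule unif_max_ratio[OF J])+
  have joint: "distr (unif J) (borel \<Otimes>\<^sub>M unif J) (\<lambda>x. (mx x, ratio x)) =
      distr (unif J) borel mx \<Otimes>\<^sub>M distr (unif J) (unif J) ratio"
    unfolding mx_def ratio_def by (rule unif_max_ratio[OF J])
  have cdf_mx: "emeasure (unif J) {x \<in> space (unif J). mx x \<le> t} = ennreal (t ^ card J)" if "0 \<le> t" "t \<le> 1" for t
    unfolding mx_def using that by (rule unif_max_ratio[OF J])
  have [measurable]: "(\<lambda>z. z a) \<in> borel_measurable (unif I)" using a by (rule measurable_unif_component)
  have [measurable]: "(\<lambda>z. z (f j)) \<in> borel_measurable (unif I)" if "j \<in> J" for j
    using that f by (intro measurable_unif_component) auto
  have [measurable]: "(\<lambda>z. z j) \<in> borel_measurable (unif J)" if "j \<in> J" for j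
    using that by (intro measurable_unif_component) auto
  have X[measurable]: "X \<in> borel_measurable (unif I)" unfolding X_def by measurable
  have Y[measurable]: "Y \<in> unif I \<rightarrow>\<^sub>M unif J" unfolding Y_def by (intro measurable_unifI) auto
  have psi[measurable]: "psi \<in> borel \<Otimes>\<^sub>M unif J \<rightarrow>\<^sub>M unif J"
  proof (intro measurable_unifI)
    fix j assume j: "j \<in> J"
    have "(\<lambda>w. snd w j) \<in> borel_measurable (borel \<Otimes>\<^sub>M unif J)"
      by (rule measurable_compose[OF measurable_snd measurable_unif_component[OF j]])
    then show "(\<lambda>w. psi w j) \<in> borel_measurable (borel \<Otimes>\<^sub>M unif J)"
      using j by (simp add: psi_def)
  qed (auto simp: psi_def)
  interpret PI: prob_space "unif I" by (rule prob_space_unif)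
  interpret PJ: prob_space "unif J" by (rule prob_space_unif)
  have AEJ: "AE x in unif J. \<forall>j\<in>J. 0 < x j \<and> x j < 1"
    using J by (intro AE_unif countable_finite)
  have AEI: "AE z in unif I. 0 < z a \<and> z a < 1"
    using AE_PiM_component[of I "\<lambda>_. unit_uniform" a "\<lambda>x. 0 < x \<and> x < 1"] a
          prob_space_unit_uniform AE_unit_uniform by auto
  \<comment> \<open>Both have distribution function \<open>t ^ ?d\<close>. The reflection
    \<open>1 - z a\<close> makes the new maximum decrease in \<open>z a\<close>, which will be a
    hash value: vertices with large slot values must come early in lists ordered by increasing
    hash.\<close>
  have law_mx: "distr (unif I) borel X = distr (unif J) borel mx"
  proof (rule measure_eqI_cdf_unit)
    show "prob_space (distr (unif I) borel X)" "prob_space (distr (unif J) borel mx)"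
      by (auto intro!: PI.prob_space_distr PJ.prob_space_distr)
    have "AE z in unif I. 0 \<le> X z \<and> X z \<le> 1"
      using AEI by eventually_elim (use d in \<open>auto simp: X_def\<close>)
    then show "AE x in distr (unif I) borel X. 0 \<le> x \<and> x \<le> 1"
      by (subst AE_distr_iff) auto
    have "AE x in unif J. 0 \<le> mx x \<and> mx x \<le> 1"
      using AEJ by eventually_elim (use J in \<open>auto simp: mx_def Max_ge_iff less_imp_le\<close>)
    then show "AE x in distr (unif J) borel mx. 0 \<le> x \<and> x \<le> 1"
      by (subst AE_distr_iff) auto
    fix t :: real assume t: "0 \<le> t" "t \<le> 1"
    have "X z \<le> t \<longleftrightarrow> z a \<in> {1 - t ^ ?d..}" for z
    proof -
      have "X z \<le> t \<longleftrightarrow> root ?d (1 - z a) \<le> root ?d (t ^ ?d)"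
        using t d by (simp add: X_def real_root_power_cancel)
      also have "\<dots> \<longleftrightarrow> 1 - z a \<le> t ^ ?d" using d by simp
      finally show ?thesis by auto
    qed
    then have "X -` {..t} \<inter> space (unif I) = {z \<in> space (unif I). z a \<in> {1 - t ^ ?d..}}" by auto
    then have "emeasure (distr (unif I) borel X) {..t} = emeasure unit_uniform {1 - t ^ ?d..}"
      using a by (simp add: emeasure_distr emeasure_unif_component del: atLeast_iff)
    also have "\<dots> = ennreal (t ^ ?d)"
      using t by (subst emeasure_unit_uniform_atLeast) (auto intro: power_le_one)
    also have "\<dots> = emeasure (distr (unif J) borel mx) {..t}"
      using t by (simp add: emeasure_distr cdf_mx[symmetric] vimage_def Int_def conj_commute)
    finally show "emeasure (distr (unif I) borel X) {..t} = emeasure (distr (unif J) borel mx) {..t}" .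
  qed auto
  have law_Y: "distr (unif I) (unif J) Y = unif J"
    unfolding Y_def using f by (intro distr_unif_reindex) auto
  have law_R: "distr (unif I) (unif J) (\<lambda>z. ratio (Y z)) = distr (unif J) (unif J) ratio"
    using distr_distr[of ratio "unif J" "unif J" Y "unif I"] by (simp add: law_Y comp_def)
  have "distr (unif I) (unif J) (\<lambda>z. psi (X z, ratio (Y z))) = distr (distr (unif I) (borel \<Otimes>\<^sub>M unif J) (\<lambda>z. (X z, ratio (Y z)))) (unif J) psi"
    by (subst distr_distr) (auto simp: comp_def)
  also have "distr (unif I) (borel \<Otimes>\<^sub>M unif J) (\<lambda>z. (X z, ratio (Y z))) = distr (unif I) borel X \<Otimes>\<^sub>M distr (unif I) (unif J) (\<lambda>z. ratio (Y z))"
  proof (rule distr_pair_disjoint_coords)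
    show "{a} \<subseteq> I" "f ` J \<subseteq> I" "{a} \<inter> f ` J = {}" using a f by auto
    fix x y :: "_ \<Rightarrow> real"
    show "(\<And>i. i \<in> {a} \<Longrightarrow> x i = y i) \<Longrightarrow> X x = X y" by (simp add: X_def)
    assume "\<And>i. i \<in> f ` J \<Longrightarrow> x i = y i"
    then have "Y x = Y y" by (auto simp: Y_def fun_eq_iff)
    then show "ratio (Y x) = ratio (Y y)" by simp
  qed auto
  also have "\<dots> = distr (unif J) (borel \<Otimes>\<^sub>M unif J) (\<lambda>x. (mx x, ratio x))"
    by (simp add: law_mx law_R joint)
  also have "distr \<dots> (unif J) psi = distr (unif J) (unif J) (\<lambda>x. psi (mx x, ratio x))"
    by (subst distr_distr) (auto simp: comp_def)
  \<comment> \<open>Multiplying the ratios by the maximum they were divided by restores the vector;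
    that maximum vanishes only on a null set.\<close>
  also have "\<dots> = distr (unif J) (unif J) (\<lambda>x. x)"
  proof (rule distr_cong_AE)
    show "AE x in unif J. psi (mx x, ratio x) = x"
      using AEJ AE_space
    proof eventually_elim
      case (elim x)
      then have "0 < mx x" using J by (auto simp: mx_def Max_gr_iff)
      then show ?case using elim by (auto simp: psi_def ratio_def fun_eq_iff space_unif extensional_def)
    qed
  qed auto
  also have "\<dots> = unif J" by (rule distr_id)
  also have "(\<lambda>z. psi (X z, ratio (Y z))) = (\<lambda>z. \<lambda>j\<in>J. root ?d (1 - z a) * z (f j) / Max ((\<lambda>j. z (f j)) ` J))"
    by (auto simp: psi_def X_def ratio_def Y_def mx_def fun_eq_iff cong: image_cong)
  finally show ?thesis .
qed

text \<open>The preimage of any set is a union of some of the finitely many atoms generated by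
  \<open>Q\<close>. Query counts and sampled sets depend on finitely many comparisons, so this
  replaces any measurability argument about decision trees.\<close>

lemma measurable_count_space_determined:
  assumes Q: "finite Q" "\<And>q. q \<in> Q \<Longrightarrow> Measurable.pred M q"
    and f: "\<And>x y. x \<in> space M \<Longrightarrow> y \<in> space M \<Longrightarrow> (\<And>q. q \<in> Q \<Longrightarrow> q x = q y) \<Longrightarrow> f x = f y"
  shows "f \<in> M \<rightarrow>\<^sub>M count_space UNIV"
proof (rule measurableI)
  fix A
  define D where "D x = {q \<in> Q. q x}" for x
  have D[measurable]: "{x \<in> space M. D x = X} \<in> sets M" if "X \<subseteq> Q" for X
  proof -
    have "D x = X \<longleftrightarrow> (\<forall>q\<in>Q. q x = (q \<in> X))" for x
      using that unfolding D_def by blast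
    then have "{x \<in> space M. D x = X} = {x \<in> space M. \<forall>q\<in>Q. q x = (q \<in> X)}"
      by simp
    also have "\<dots> \<in> sets M"
    proof (rule sets.sets_Collect_finite_All)
      fix q assume "q \<in> Q"
      then have [measurable]: "Measurable.pred M q" by (rule Q)
      show "{x \<in> space M. q x = (q \<in> X)} \<in> sets M" by measurable
    qed (rule Q)
    finally show ?thesis .
  qed
  have "f -` A \<inter> space M = (\<Union>X\<in>{X \<in> Pow Q. \<exists>y\<in>space M. D y = X \<and> f y \<in> A}. {x \<in> space M. D x = X})"
  proof (intro equalityI subsetI)
    fix x assume "x \<in> f -` A \<inter> space M"
    then show "x \<in> (\<Union>X\<in>{X \<in> Pow Q. \<exists>y\<in>space M. D y = X \<and> f y \<in> A}. {x \<in> space M. D x = X})"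
      by (intro UN_I[of "D x"]) (auto simp: D_def)
  next
    fix x assume "x \<in> (\<Union>X\<in>{X \<in> Pow Q. \<exists>y\<in>space M. D y = X \<and> f y \<in> A}. {x \<in> space M. D x = X})"
    then obtain y where y: "y \<in> space M" "D y = D x" "f y \<in> A" "x \<in> space M" by auto
    then have "f x = f y" by (intro f) (auto simp: D_def)
    with y show "x \<in> f -` A \<inter> space M" by auto
  qed
  also have "\<dots> \<in> sets M"
    using Q(1) D by (intro sets.finite_UN) auto
  finally show "f -` A \<inter> space M \<in> sets M" .
qed auto

lemma pred_card_less:
  assumes "finite R" "\<And>e. e \<in> R \<Longrightarrow> Measurable.pred M (Q e)"
  shows "Measurable.pred M (\<lambda>x. card {e \<in> R. Q e x} < k)"
proof (rule measurable_count_space_determined)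
  show "finite (Q ` R)" using assms by simp
  show "Measurable.pred M q" if "q \<in> Q ` R" for q using that assms by auto
  fix x y assume *: "\<And>q. q \<in> Q ` R \<Longrightarrow> q x = q y"
  have "{e \<in> R. Q e x} = {e \<in> R. Q e y}" using *[of "Q _"] by auto
  then show "(card {e \<in> R. Q e x} < k) = (card {e \<in> R. Q e y} < k)" by simp
qed

section \<open>The largest entries of an exchangeable vector\<close>

text \<open>Selection by rank instead of by a sorted list depends on comparisons alone, which makes
  measurability and equivariance under permutations easy. With ties it may contain fewer than
  \<open>s\<close> elements, an event of probability 0 for independent uniform entries.\<close>

definition top_entries :: "nat \<Rightarrow> 'i set \<Rightarrow> ('i \<Rightarrow> real) \<Rightarrow> 'i set" where
  "top_entries s E x = {e \<in> E. card {e' \<in> E. x e \<le> x e'} \<le> s}"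

text \<open>Distinct entries have distinct ranks, so the ranks are exactly 1 to
  \<open>card E\<close>, and \<open>s\<close> of them are at most \<open>s\<close>.\<close>

lemma card_top:
  assumes E: "finite E" "s \<le> card E" and inj: "inj_on x E"
  shows "card (top_entries s E x) = s"
proof -
  define r where "r e = card {e' \<in> E. x e \<le> x e'}" for e
  have less: "r j < r i" if "i \<in> E" "j \<in> E" "x i < x j" for i j
    unfolding r_def using that E by (intro psubset_card_mono) (auto simp: not_le[symmetric] intro: order_trans[OF less_imp_le])
  have injr: "inj_on r E"
  proof (rule inj_onI, rule ccontr)
    fix i j assume ij: "i \<in> E" "j \<in> E" "r i = r j" "i \<noteq> j"
    then have "x i \<noteq> x j" using inj by (auto dest: inj_onD)
    then show False using less[of i j] less[of j i] ij by (cases "x i < x j") auto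
  qed
  have "r ` E \<subseteq> {1..card E}"
    using E by (auto simp: r_def intro!: card_mono Suc_leI card_gt_0_iff[THEN iffD2])
  moreover have "card (r ` E) = card {1..card E}" using injr by (simp add: card_image)
  ultimately have img: "r ` E = {1..card E}" by (intro card_subset_eq) auto
  have "r ` top_entries s E x = {1..s}"
  proof (intro equalityI subsetI)
    fix k assume "k \<in> r ` top_entries s E x"
    then obtain e where "e \<in> E" "r e \<le> s" "k = r e" by (auto simp: top_entries_def r_def)
    then show "k \<in> {1..s}" using img by (metis atLeastAtMost_iff imageI)
  next
    fix k assume k: "k \<in> {1..s}"
    then have "k \<in> r ` E" using E img by auto
    then obtain e where "e \<in> E" "k = r e" by auto
    with k show "k \<in> r ` top_entries s E x" by (auto simp: top_entries_def r_def)
  qed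
  moreover have "inj_on r (top_entries s E x)" using injr by (rule inj_on_subset) (auto simp: top_entries_def)
  ultimately show ?thesis by (metis card_image card_atLeastAtMost diff_Suc_1)
qed

lemma measurable_top:
  assumes "finite E"
  shows "top_entries s E \<in> unif E \<rightarrow>\<^sub>M count_space UNIV"
proof (rule measurable_count_space_determined)
  show "finite ((\<lambda>(e, e') x. x e \<le> (x e' :: real)) ` (E \<times> E))" using assms by auto
  show "Measurable.pred (unif E) q" if "q \<in> (\<lambda>(e, e') x. x e \<le> (x e' :: real)) ` (E \<times> E)" for q
  proof -
    from that obtain e e' where e: "e \<in> E" "e' \<in> E" and q: "q = (\<lambda>x. x e \<le> x e')" by auto
    show ?thesis unfolding q pred_def by (intro borel_measurable_le measurable_unif_component e)
  qed
  fix x y :: "'a \<Rightarrow> real" assume *: "\<And>q. q \<in> (\<lambda>(e, e') x. x e \<le> (x e' :: real)) ` (E \<times> E) \<Longrightarrow> q x = q y"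
  have "(x e \<le> x e') = (y e \<le> y e')" if "e \<in> E" "e' \<in> E" for e e'
    using *[of "\<lambda>x. x e \<le> x e'"] that by auto
  then have "{e' \<in> E. x e \<le> x e'} = {e' \<in> E. y e \<le> y e'}" if "e \<in> E" for e using that by auto
  then show "top_entries s E x = top_entries s E y" unfolding top_entries_def by (intro Collect_cong conj_cong refl) auto
qed

lemma top_permute:
  assumes p: "bij_betw p E E"
  shows "top_entries s E (\<lambda>e\<in>E. x (p e)) = {e \<in> E. p e \<in> top_entries s E x}"
proof -
  have "card {e' \<in> E. x (p e) \<le> x (p e')} = card {f \<in> E. x (p e) \<le> x f}" for e
  proof (rule bij_betw_same_card)
    show "bij_betw p {e' \<in> E. x (p e) \<le> x (p e')} {f \<in> E. x (p e) \<le> x f}"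
      using p unfolding bij_betw_def by (auto intro: inj_on_subset)
  qed
  moreover have "p e \<in> E" if "e \<in> E" for e using p that by (auto simp: bij_betw_def)
  ultimately show ?thesis
    by (auto simp: top_entries_def cong: conj_cong)
qed

text \<open>Exchangeability: any two \<open>s\<close>-subsets of \<open>E\<close> are carried to
  each other by a permutation of \<open>E\<close>, glued from bijections of the sets and of their
  complements, and permuting coordinates preserves the product measure. So all
  \<open>s\<close>-subsets are equally likely, and their probabilities add up to 1 because ties are
  null.\<close>

lemma distr_top_unif:
  assumes E: "finite E" "s \<le> card E"
  shows "distr (unif E) (count_space UNIV) (top_entries s E) = measure_pmf (pmf_of_set {Y. Y \<subseteq> E \<and> card Y = s})"
    (is "_ = measure_pmf (pmf_of_set ?S)")
proof -
  interpret prob_space "unif E" by (rule prob_space_unif)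
  note [measurable] = measurable_top[OF E(1), of s]
  have fin: "finite ?S" using E by auto
  have ne: "?S \<noteq> {}" using obtain_subset_with_card_n[OF E(2)] by blast
  define q where "q Y = emeasure (unif E) {x \<in> space (unif E). top_entries s E x = Y}" for Y
  have q_eq: "q Y' = q Y" if YS: "Y \<in> ?S" "Y' \<in> ?S" for Y Y'
  proof -
    have fY: "finite Y" "finite Y'" using YS E by (auto intro: finite_subset)
    have "card Y' = card Y" using YS by simp
    then obtain f where f: "bij_betw f Y' Y" using fY by (metis finite_same_card_bij)
    have "card (E - Y') = card (E - Y)" using YS fY E by (auto simp: card_Diff_subset)
    then obtain g where g: "bij_betw g (E - Y') (E - Y)" using E by (metis finite_same_card_bij finite_Diff)
    define p where "p e = (if e \<in> Y' then f e else g e)" for e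
    have pY: "bij_betw p Y' Y" using f by (rule bij_betw_cong[THEN iffD1, rotated]) (simp add: p_def)
    moreover have "bij_betw p (E - Y') (E - Y)" using g by (rule bij_betw_cong[THEN iffD1, rotated]) (simp add: p_def)
    ultimately have "bij_betw p (Y' \<union> (E - Y')) (Y \<union> (E - Y))" by (rule bij_betw_combine) auto
    moreover have "Y' \<union> (E - Y') = E" "Y \<union> (E - Y) = E" using YS by auto
    ultimately have p: "bij_betw p E E" by simp
    then have inj: "inj_on p E" and pE: "p \<in> E \<rightarrow> E" by (auto simp: bij_betw_def)
    have iff: "top_entries s E (\<lambda>e\<in>E. x (p e)) = Y' \<longleftrightarrow> top_entries s E x = Y" for x
    proof -
      have sub: "top_entries s E x \<subseteq> E" by (auto simp: top_entries_def)
      have "{e \<in> E. p e \<in> top_entries s E x} = Y' \<longleftrightarrow> top_entries s E x = Y"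
      proof
        assume *: "{e \<in> E. p e \<in> top_entries s E x} = Y'"
        have "top_entries s E x = p ` {e \<in> E. p e \<in> top_entries s E x}" using p sub by (auto simp: bij_betw_def)
        then show "top_entries s E x = Y" using * pY by (simp add: bij_betw_def)
      next
        assume *: "top_entries s E x = Y"
        have "p e \<in> Y \<longleftrightarrow> e \<in> Y'" if "e \<in> E" for e
          using pY inj that \<open>Y' \<in> ?S\<close> unfolding bij_betw_def by (auto dest: inj_onD)
        then show "{e \<in> E. p e \<in> top_entries s E x} = Y'" using * \<open>Y' \<in> ?S\<close> by auto
      qed
      then show ?thesis by (simp add: top_permute[OF p])
    qed
    have pm: "(\<lambda>x. \<lambda>e\<in>E. x (p e)) \<in> unif E \<rightarrow>\<^sub>M unif E"
      using pE by (intro measurable_unifI) (auto intro!: measurable_unif_component)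
    have "q Y' = emeasure (distr (unif E) (unif E) (\<lambda>x. \<lambda>e\<in>E. x (p e))) {x \<in> space (unif E). top_entries s E x = Y'}"
      unfolding q_def distr_unif_reindex[OF inj pE] ..
    also have "\<dots> = emeasure (unif E) {x \<in> space (unif E). top_entries s E (\<lambda>e\<in>E. x (p e)) = Y'}"
      using pm by (subst emeasure_distr) (auto intro!: arg_cong2[where f=emeasure] dest: measurable_space)
    finally show ?thesis by (simp add: iff q_def)
  qed
  have AE_top: "AE x in unif E. top_entries s E x \<in> ?S"
  proof -
    have "AE x in unif E. \<forall>e\<in>E. \<forall>e'\<in>E. e \<noteq> e' \<longrightarrow> x e \<noteq> x e'"
      using E by (intro AE_finite_allI) (auto intro!: AE_unif_distinct)
    then show ?thesis
    proof eventually_elim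
      case (elim x)
      then have "inj_on x E" by (meson inj_onI)
      then show ?case using card_top[OF E] by (auto simp: top_entries_def)
    qed
  qed
  have sum: "emeasure (unif E) {x \<in> space (unif E). top_entries s E x \<in> A} = (\<Sum>Y\<in>?S \<inter> A. q Y)" for A
  proof -
    have "emeasure (unif E) {x \<in> space (unif E). top_entries s E x \<in> A} = emeasure (unif E) (\<Union>Y\<in>?S \<inter> A. {x \<in> space (unif E). top_entries s E x = Y})"
    proof (rule emeasure_eq_AE)
      show "AE x in unif E. (x \<in> {x \<in> space (unif E). top_entries s E x \<in> A}) = (x \<in> (\<Union>Y\<in>?S \<inter> A. {x \<in> space (unif E). top_entries s E x = Y}))"
        using AE_top by eventually_elim auto
      show "(\<Union>Y\<in>?S \<inter> A. {x \<in> space (unif E). top_entries s E x = Y}) \<in> sets (unif E)"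
        using fin by (intro sets.finite_UN) auto
      show "{x \<in> space (unif E). top_entries s E x \<in> A} \<in> sets (unif E)"
        using measurable_sets[OF measurable_top[OF E(1), of s], of A] by (simp add: vimage_def Int_def conj_commute)
    qed
    also have "\<dots> = (\<Sum>Y\<in>?S \<inter> A. q Y)"
      unfolding q_def
    proof (rule sum_emeasure[symmetric])
      have "{x \<in> space (unif E). top_entries s E x = Y} \<in> sets (unif E)" for Y by measurable
      then show "(\<lambda>Y. {x \<in> space (unif E). top_entries s E x = Y}) ` (?S \<inter> A) \<subseteq> sets (unif E)" by blast
    qed (use fin in \<open>auto simp: disjoint_family_on_def\<close>)
    finally show ?thesis .
  qed
  obtain Y0 where Y0: "Y0 \<in> ?S" using ne by auto
  have "1 = (\<Sum>Y\<in>?S. q Y)" using sum[of UNIV] by (simp add: emeasure_space_1)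
  also have "\<dots> = of_nat (card ?S) * q Y0"
    using q_eq[OF Y0] by simp
  finally have "of_nat (card ?S) * q Y0 = 1" ..
  moreover have "0 < card ?S" using fin ne by (simp add: card_gt_0_iff)
  ultimately have q0: "q Y0 = ennreal (1 / real (card ?S))"
  proof -
    have "ennreal (1 / real (card ?S)) = ennreal (1 / real (card ?S)) * (of_nat (card ?S) * q Y0)"
      using \<open>of_nat (card ?S) * q Y0 = 1\<close> by simp
    also have "\<dots> = ennreal (1 / real (card ?S) * real (card ?S)) * q Y0"
      unfolding ennreal_of_nat_eq_real_of_nat by (subst ennreal_mult) (auto simp: mult.assoc)
    also have "\<dots> = q Y0" using \<open>0 < card ?S\<close> by simp
    finally show ?thesis ..
  qed
  show ?thesis
  proof (rule measure_eqI)
    fix A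
    have "emeasure (distr (unif E) (count_space UNIV) (top_entries s E)) A = emeasure (unif E) {x \<in> space (unif E). top_entries s E x \<in> A}"
      by (subst emeasure_distr) (auto intro!: arg_cong2[where f=emeasure])
    also have "\<dots> = of_nat (card (?S \<inter> A)) * q Y0"
      unfolding sum using q_eq[OF Y0] by simp
    also have "\<dots> = ennreal (real (card (?S \<inter> A)) / real (card ?S))"
      unfolding q0 by (simp add: ennreal_of_nat_eq_real_of_nat flip: ennreal_mult)
    also have "\<dots> = emeasure (measure_pmf (pmf_of_set ?S)) A"
      using fin ne by (simp add: emeasure_pmf_of_set)
    finally show "emeasure (distr (unif E) (count_space UNIV) (top_entries s E)) A = emeasure (measure_pmf (pmf_of_set ?S)) A" .
  qed simp
qed

text \<open>Summing over \<open>i \<in> Q\<close> the events that the \<open>i\<close>-th entry is large while fewer than \<open>s\<close>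
  of the others are counts at most \<open>s\<close> indices.\<close>

lemma few_large_coords:
  assumes Q: "finite Q" "Q \<subseteq> E" and p: "0 \<le> p" "p \<le> 1"
  shows "of_nat (card Q) * (ennreal p * emeasure (unif E) {x \<in> space (unif E). card {e \<in> Q. 1 - p \<le> x e} < s}) \<le> of_nat s"
proof -
  interpret prob_space "unif E" by (rule prob_space_unif)
  have comp[measurable]: "(\<lambda>x. x e) \<in> borel_measurable (unif E)" if "e \<in> Q" for e
    using that Q by (intro measurable_unif_component) auto
  have meas: "Measurable.pred (unif E) (\<lambda>x. card {e \<in> R. 1 - p \<le> x e} < s)" if "R \<subseteq> Q" for R
    using that Q by (intro pred_card_less) (auto intro: finite_subset)
  have "of_nat (card Q) * (ennreal p * emeasure (unif E) {x \<in> space (unif E). card {e \<in> Q. 1 - p \<le> x e} < s}) =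
    (\<Sum>i\<in>Q. ennreal p * emeasure (unif E) {x \<in> space (unif E). card {e \<in> Q. 1 - p \<le> x e} < s})" by simp
  also have "\<dots> \<le> (\<Sum>i\<in>Q. emeasure (unif E) {x \<in> space (unif E). 1 - p \<le> x i \<and> card {e \<in> Q - {i}. 1 - p \<le> x e} < s})"
  proof (rule sum_mono)
    fix i assume i: "i \<in> Q"
    have "emeasure (unif E) {x \<in> space (unif E). 1 - p \<le> x i} = emeasure unit_uniform {1 - p..}"
      using emeasure_unif_component[of i E "{1 - p..}"] i Q by auto
    then have pi: "emeasure (unif E) {x \<in> space (unif E). 1 - p \<le> x i} = ennreal p"
      using p by (simp add: emeasure_unit_uniform_atLeast)
    \<comment> \<open>Leaving \<open>i\<close> out of the count enlarges the event and makes it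
      independent of the \<open>i\<close>-th entry.\<close>
    have "emeasure (unif E) {x \<in> space (unif E). card {e \<in> Q. 1 - p \<le> x e} < s} \<le>
      emeasure (unif E) {x \<in> space (unif E). card {e \<in> Q - {i}. 1 - p \<le> x e} < s}"
    proof (rule emeasure_mono)
      have "card {e \<in> Q - {i}. 1 - p \<le> x e} \<le> card {e \<in> Q. 1 - p \<le> x e}" for x
        using Q by (intro card_mono) auto
      then show "{x \<in> space (unif E). card {e \<in> Q. 1 - p \<le> x e} < s} \<subseteq> {x \<in> space (unif E). card {e \<in> Q - {i}. 1 - p \<le> x e} < s}"
        by (auto intro: le_less_trans)
      show "{x \<in> space (unif E). card {e \<in> Q - {i}. 1 - p \<le> x e} < s} \<in> sets (unif E)"
        using meas[of "Q - {i}"] unfolding pred_def by blast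
    qed
    then have "ennreal p * emeasure (unif E) {x \<in> space (unif E). card {e \<in> Q. 1 - p \<le> x e} < s} \<le>
      emeasure (unif E) {x \<in> space (unif E). 1 - p \<le> x i} * emeasure (unif E) {x \<in> space (unif E). card {e \<in> Q - {i}. 1 - p \<le> x e} < s}"
      unfolding pi by (rule mult_left_mono) simp
    also have "\<dots> = emeasure (unif E) {x \<in> space (unif E). 1 - p \<le> x i \<and> card {e \<in> Q - {i}. 1 - p \<le> x e} < s}"
    proof (rule emeasure_Int_disjoint_coords[symmetric])
      show "{i} \<subseteq> E" "Q - {i} \<subseteq> E" "{i} \<inter> (Q - {i}) = {}" using i Q by auto
      show "Measurable.pred (unif E) (\<lambda>x. 1 - p \<le> x i)" using comp[OF i] by measurable
      show "Measurable.pred (unif E) (\<lambda>x. card {e \<in> Q - {i}. 1 - p \<le> x e} < s)" by (rule meas) auto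
      fix x y :: "'a \<Rightarrow> real"
      show "(\<And>j. j \<in> {i} \<Longrightarrow> x j = y j) \<Longrightarrow> (1 - p \<le> x i) = (1 - p \<le> y i)" by simp
      assume *: "\<And>j. j \<in> Q - {i} \<Longrightarrow> x j = y j"
      have "{e \<in> Q - {i}. 1 - p \<le> x e} = {e \<in> Q - {i}. 1 - p \<le> y e}" using * by auto
      then show "(card {e \<in> Q - {i}. 1 - p \<le> x e} < s) = (card {e \<in> Q - {i}. 1 - p \<le> y e} < s)" by simp
    qed
    finally show "ennreal p * emeasure (unif E) {x \<in> space (unif E). card {e \<in> Q. 1 - p \<le> x e} < s} \<le>
      emeasure (unif E) {x \<in> space (unif E). 1 - p \<le> x i \<and> card {e \<in> Q - {i}. 1 - p \<le> x e} < s}" .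
  qed
  also have "\<dots> = (\<Sum>i\<in>Q. \<integral>\<^sup>+x. indicator {x \<in> space (unif E). 1 - p \<le> x i \<and> card {e \<in> Q - {i}. 1 - p \<le> x e} < s} x \<partial>unif E)"
    using meas[of "Q - {_}"] by (intro sum.cong refl nn_integral_indicator[symmetric]) (auto intro!: predE pred_intros_logic)
  also have "\<dots> = (\<integral>\<^sup>+x. (\<Sum>i\<in>Q. indicator {x \<in> space (unif E). 1 - p \<le> x i \<and> card {e \<in> Q - {i}. 1 - p \<le> x e} < s} x) \<partial>unif E)"
    using meas[of "Q - {_}"] by (intro nn_integral_sum[symmetric] borel_measurable_indicator) (auto intro!: predE pred_intros_logic)
  also have "\<dots> \<le> (\<integral>\<^sup>+x. of_nat s \<partial>unif E)"
  proof (rule nn_integral_mono)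
    fix x assume "x \<in> space (unif E)"
    let ?T = "{i \<in> Q. 1 - p \<le> x i \<and> card {e \<in> Q - {i}. 1 - p \<le> x e} < s}"
    have "(\<Sum>i\<in>Q. indicator {x \<in> space (unif E). 1 - p \<le> x i \<and> card {e \<in> Q - {i}. 1 - p \<le> x e} < s} x) =
        (\<Sum>i\<in>Q. if 1 - p \<le> x i \<and> card {e \<in> Q - {i}. 1 - p \<le> x e} < s then 1 else (0::ennreal))"
      using \<open>x \<in> space (unif E)\<close> by (intro sum.cong) (auto simp: indicator_def)
    also have "\<dots> = of_nat (card ?T)"
      using Q by (simp add: sum.If_cases Int_def)
    also have "card ?T \<le> s"
    proof (cases "?T = {}")
      case False
      then obtain i where i: "i \<in> ?T" by auto
      \<comment> \<open>Membership of a single \<open>i\<close> says that fewer than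
        \<open>s\<close> entries other than \<open>i\<close> are large, while all members of
        \<open>?T\<close> are large.\<close>
      have "?T \<subseteq> insert i {e \<in> Q - {i}. 1 - p \<le> x e}" by auto
      then have "card ?T \<le> card (insert i {e \<in> Q - {i}. 1 - p \<le> x e})" using Q by (intro card_mono) auto
      also have "\<dots> \<le> s" using i Q by (auto simp: card_insert_if)
      finally show ?thesis .
    qed (simp only: card.empty)
    finally show "(\<Sum>i\<in>Q. indicator {x \<in> space (unif E). 1 - p \<le> x i \<and> card {e \<in> Q - {i}. 1 - p \<le> x e} < s} x) \<le> (of_nat s :: ennreal)"
      by simp
  qed
  also have "\<dots> = of_nat s" by (simp add: emeasure_space_1)
  finally show ?thesis .
qed

section \<open>The algorithm\<close>

primrec bind :: "'a dtree \<Rightarrow> ('a \<Rightarrow> 'b dtree) \<Rightarrow> 'b dtree" where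
  "bind (Return x) f = f x"
| "bind (Ask q k) f = Ask q (\<lambda>a. bind (k a) f)"

primrec map_tree :: "('a \<Rightarrow> 'b dtree) \<Rightarrow> 'a list \<Rightarrow> 'b list dtree" where
  "map_tree f [] = Return []"
| "map_tree f (x # xs) = bind (f x) (\<lambda>y. bind (map_tree f xs) (\<lambda>ys. Return (y # ys)))"

text \<open>An answer of the wrong kind is read as 0, so that the tree is total. On the graphs
  considered, all queries are well posed and this default is never taken.\<close>

definition ask_vertex :: "query \<Rightarrow> (nat \<Rightarrow> 'a dtree) \<Rightarrow> 'a dtree" where
  "ask_vertex q f = Ask q (\<lambda>a. case a of IsVertex v \<Rightarrow> f v | _ \<Rightarrow> f 0)"

definition ask_nat :: "query \<Rightarrow> (nat \<Rightarrow> 'a dtree) \<Rightarrow> 'a dtree" where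
  "ask_nat q f = Ask q (\<lambda>a. case a of IsNat d \<Rightarrow> f d | _ \<Rightarrow> f 0)"

definition ask_hash :: "query \<Rightarrow> (real \<Rightarrow> 'a dtree) \<Rightarrow> 'a dtree" where
  "ask_hash q f = Ask q (\<lambda>a. case a of IsHash x \<Rightarrow> f x | _ \<Rightarrow> f 0)"

text \<open>The coins: vertex indices and thresholds for the estimation of the number of edges,
  marks deciding which vertices are scanned, and the slot values of light and heavy vertices.
  A light slot is addressed by the index of its vertex and a heavy one by the name, since these
  are what the algorithm knows when it needs the coin.\<close>

datatype coin = Idx nat | Thr nat | Mark nat | Light nat nat | Heavy nat nat

instance coin :: countable by countable_datatype

text \<open>The chance of stopping at attempt \<open>t\<close> is \<open>2 * m * t / n^2\<close>
  while no degree exceeds \<open>n / t\<close>. The accumulated chance grows like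
  \<open>m * t^2 / n^2\<close> and reaches order 1 at \<open>t\<close> about
  \<open>n / sqrt m\<close>, without knowledge of \<open>m\<close>. The clamping of the vertex index
  by \<open>max\<close> and \<open>min\<close> acts only on a null set.\<close>

primrec estimate :: "nat \<Rightarrow> (coin \<Rightarrow> real) \<Rightarrow> nat list \<Rightarrow> nat dtree" where
  "estimate n C [] = Return n"
| "estimate n C (t # ts) =
    ask_vertex (Vertex (max 1 (min n (nat \<lceil>real n * C (Idx t)\<rceil>)))) (\<lambda>v.
    ask_nat (Degree v) (\<lambda>d.
    if C (Thr t) \<le> real d * real t / real n then Return t else estimate n C ts))"

text \<open>The coin of a cell is known before any query, so only cells with a large coin cost
  anything. Whether the slot exists and its vertex is light is seen only after the degree query, so
  some probes are wasted.\<close>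

definition light_items :: "nat \<Rightarrow> real \<Rightarrow> real \<Rightarrow> (coin \<Rightarrow> real) \<Rightarrow> ((nat \<times> nat) \<times> real) list dtree" where
  "light_items n \<tau> p C = bind
    (map_tree (\<lambda>(i, j).
      ask_vertex (Vertex i) (\<lambda>v.
      ask_nat (Degree v) (\<lambda>d.
      if j \<le> d \<and> real d \<le> \<tau>
      then ask_vertex (Neighbor v j) (\<lambda>w. Return [((v, w), C (Light i j))])
      else Return [])))
      (filter (\<lambda>(i, j). 1 - p \<le> C (Light i j)) (List.product [1..<Suc n] [1..<Suc (nat \<lfloor>\<tau>\<rfloor>)])))
    (\<lambda>xs. Return (concat xs))"

text \<open>In hash order everything at most \<open>\<theta>\<close> forms an initial segment, so
  stopping at the first larger hash value misses nothing.\<close>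

primrec scan :: "real \<Rightarrow> nat \<Rightarrow> nat list \<Rightarrow> (nat \<times> real) list dtree" where
  "scan \<theta> u [] = Return []"
| "scan \<theta> u (j # js) =
    ask_vertex (Neighbor u j) (\<lambda>w.
    ask_hash (Hash w) (\<lambda>x.
    if x \<le> \<theta> then bind (scan \<theta> u js) (\<lambda>ws. Return ((w, x) # ws)) else Return []))"

text \<open>Without the cap, \<open>1 / y\<close> would have infinite mean for a uniform mark
  \<open>y\<close>. Capping it at \<open>n\<close> makes the mean logarithmic and loses no vertex as
  long as \<open>1 \<le> L\<close>, because degrees are below \<open>n\<close>.\<close>

definition scan_bound :: "nat \<Rightarrow> real \<Rightarrow> real \<Rightarrow> real \<Rightarrow> real" where
  "scan_bound n L p y = p * L * min (real n) (1 / y)"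

text \<open>A vertex can be met from several of its neighbors; \<open>remdups\<close> lets the heavy
  phase pay for it once, so that its cost is a sum over vertices.\<close>

definition discover :: "nat \<Rightarrow> real \<Rightarrow> real \<Rightarrow> real \<Rightarrow> (coin \<Rightarrow> real) \<Rightarrow> (nat \<times> real) list dtree" where
  "discover n \<tau> L p C = bind
    (map_tree (\<lambda>i.
      ask_vertex (Vertex i) (\<lambda>u.
      ask_nat (Degree u) (\<lambda>d.
      scan (scan_bound n L p (C (Mark i))) u [1..<Suc d])))
      (filter (\<lambda>i. C (Mark i) \<le> L / \<tau>) [1..<Suc n]))
    (\<lambda>xs. Return (remdups (concat xs)))"

text \<open>If \<open>x\<close> and the entries of \<open>W\<close> are independent and uniform, then so are these \<open>d\<close> numbers,
  and by Bernoulli's inequality none of them exceeds \<open>1 - x / d\<close>.\<close>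

definition rescaled :: "nat \<Rightarrow> real \<Rightarrow> (nat \<Rightarrow> real) \<Rightarrow> nat \<Rightarrow> real" where
  "rescaled d x W j = root d (1 - x) * W j / Max (W ` {1..d})"

definition heavy_items :: "real \<Rightarrow> real \<Rightarrow> (coin \<Rightarrow> real) \<Rightarrow> (nat \<times> real) list \<Rightarrow> ((nat \<times> nat) \<times> real) list dtree" where
  "heavy_items \<tau> p C ws = bind
    (map_tree (\<lambda>(v, x).
      ask_nat (Degree v) (\<lambda>d.
      if \<tau> < real d
      then map_tree
        (\<lambda>j. ask_vertex (Neighbor v j) (\<lambda>w. Return ((v, w), rescaled d x (\<lambda>j. C (Heavy v j)) j)))
        (filter (\<lambda>j. 1 - p \<le> rescaled d x (\<lambda>j. C (Heavy v j)) j) [1..<Suc d])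
      else Return [])) ws)
    (\<lambda>xs. Return (concat xs))"

definition search :: "nat \<Rightarrow> real \<Rightarrow> real \<Rightarrow> (coin \<Rightarrow> real) \<Rightarrow> real \<Rightarrow> ((nat \<times> nat) \<times> real) set dtree" where
  "search n \<tau> L C p =
    bind (light_items n \<tau> p C) (\<lambda>xs.
    bind (discover n \<tau> L p C) (\<lambda>ws.
    bind (heavy_items \<tau> p C ws) (\<lambda>ys.
    Return (set xs \<union> set ys))))"

definition select :: "nat \<Rightarrow> ((nat \<times> nat) \<times> real) set \<Rightarrow> (nat \<times> nat) set" where
  "select s D = fst ` {a \<in> D. card {b \<in> D. snd a \<le> snd b} \<le> s}"

text \<open>The counter runs down, so that \<open>p = 1 / 2 ^ g\<close> doubles. At
  \<open>p = 1\<close> the level \<open>1 - p\<close> is 0 and every nonnegative value qualifies, so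
  the last search needs no stopping test.\<close>

primrec rounds :: "nat \<Rightarrow> nat \<Rightarrow> real \<Rightarrow> real \<Rightarrow> (coin \<Rightarrow> real) \<Rightarrow> nat \<Rightarrow> (nat \<times> nat) set dtree" where
  "rounds n s \<tau> L C 0 = bind (search n \<tau> L C 1) (\<lambda>D. Return (select s D))"
| "rounds n s \<tau> L C (Suc g) = bind (search n \<tau> L C (1 / 2 ^ Suc g))
    (\<lambda>D. if s \<le> card D then Return (select s D) else rounds n s \<tau> L C g)"

definition light_bound :: "nat \<Rightarrow> nat \<Rightarrow> nat \<Rightarrow> real" where
  "light_bound n s t = real n / (real t * sqrt (real s))"

text \<open>The first \<open>p\<close> is at most \<open>1 / n^2\<close>, hence at most
  \<open>s / m\<close>, so the first round is cheap although no earlier round had to fail before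
  it.\<close>

definition num_rounds :: "nat \<Rightarrow> nat" where
  "num_rounds n = nat \<lceil>2 * log 2 (real n)\<rceil>"

text \<open>A given vertex then lacks a marked neighbor with probability at most
  \<open>exp (- L) = (\<delta> / n) ^ 4\<close>. After the union bound over vertices a factor
  \<open>1 / n^3\<close> remains, which pays for the worst-case cost of order \<open>n^2\<close> of
  a round in the case of failure.\<close>

definition mark_rate :: "nat \<Rightarrow> real \<Rightarrow> real" where
  "mark_rate n \<delta> = 4 * ln (real n / \<delta>)"

definition edge_sampler :: "nat \<Rightarrow> nat \<Rightarrow> real \<Rightarrow> (coin \<Rightarrow> real) \<Rightarrow> (nat \<times> nat) set dtree" where
  "edge_sampler n s \<delta> C = bind (estimate n C [1..<n])
    (\<lambda>t. rounds n s (light_bound n s t) (mark_rate n \<delta>) C (num_rounds n))"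

definition edge_sampler_alg :: "nat \<Rightarrow> nat \<Rightarrow> real \<Rightarrow> (nat \<times> nat) set rand_alg" where
  "edge_sampler_alg n s \<delta> c = edge_sampler n s \<delta> (\<lambda>k. c (to_nat k))"

lemma result_bind [simp]: "result (bind t f) orc = result (f (result t orc)) orc"
  by (induction t) auto

lemma num_queries_bind [simp]:
  "num_queries (bind t f) orc = num_queries t orc + num_queries (f (result t orc)) orc"
  by (induction t) auto

lemma result_map_tree [simp]: "result (map_tree f xs) orc = map (\<lambda>x. result (f x) orc) xs"
  by (induction xs) auto

lemma num_queries_map_tree [simp]: "num_queries (map_tree f xs) orc = (\<Sum>x\<leftarrow>xs. num_queries (f x) orc)"
  by (induction xs) auto

section \<open>Behaviour on a fixed graph\<close>

lemma takeWhile_sorted_key: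
  "sorted (map h xs) \<Longrightarrow> takeWhile (\<lambda>w. h w \<le> \<theta>) xs = filter (\<lambda>w. h w \<le> \<theta>) xs"
  for h :: "'a \<Rightarrow> real"
proof (induction xs)
  case (Cons x xs)
  show ?case
  proof (cases "h x \<le> \<theta>")
    case True
    with Cons show ?thesis by simp
  next
    case False
    with Cons.prems have "filter (\<lambda>w. h w \<le> \<theta>) xs = []"
      by (fastforce simp: filter_empty_conv)
    with False show ?thesis by simp
  qed
qed simp

declare upt_Suc [simp del]

section \<open>Vertices and neighbor lists of a fixed graph\<close>

locale graph_run =
  fixes G :: access_graph and n m s :: nat
  assumes wf: "wf_access_graph G"
    and card_verts: "card (verts G) = n" and card_edges: "card (edges G) = m"
    and s_pos: "0 < s" and s_le: "s \<le> card (oriented_edges G)"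
begin

abbreviation "d \<equiv> deg G"
abbreviation "va \<equiv> vertex_at G"

lemma finite_verts [simp]: "finite (verts G)"
  using wf by (simp add: wf_access_graph_def)

lemma edgeD: "{u, v} \<in> edges G \<Longrightarrow> u \<in> verts G \<and> v \<in> verts G \<and> u \<noteq> v"
  using wf unfolding wf_access_graph_def by (auto simp: doubleton_eq_iff dest!: subsetD)

lemma va_bij: "bij_betw va {1..n} (verts G)"
  using wf by (simp add: wf_access_graph_def card_verts)

lemma va_in [simp]: "1 \<le> i \<Longrightarrow> i \<le> n \<Longrightarrow> va i \<in> verts G"
  using va_bij by (auto simp: bij_betw_def)

text \<open>For the analysis only: the algorithm meets light vertices through their indices and
  never inverts \<open>vertex_at\<close>.\<close>

definition ix :: "nat \<Rightarrow> nat" where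
  "ix = the_inv_into {1..n} va"

lemma ix_va [simp]: "1 \<le> i \<Longrightarrow> i \<le> n \<Longrightarrow> ix (va i) = i"
  using va_bij unfolding ix_def bij_betw_def by (intro the_inv_into_f_f) auto

lemma va_ix [simp]: "v \<in> verts G \<Longrightarrow> va (ix v) = v"
  using va_bij unfolding ix_def bij_betw_def by (intro f_the_inv_into_f) auto

lemma ix_in: "v \<in> verts G \<Longrightarrow> 1 \<le> ix v \<and> ix v \<le> n"
  using the_inv_into_into[of va "{1..n}" v "{1..n}"] va_bij by (auto simp: ix_def bij_betw_def)

lemma neighbors_verts: "w \<in> neighbors G v \<Longrightarrow> w \<in> verts G \<and> v \<in> verts G \<and> w \<noteq> v"
  by (auto simp: neighbors_def dest: edgeD)

lemma neighbors_sym: "w \<in> neighbors G v \<longleftrightarrow> v \<in> neighbors G w"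
  by (simp add: neighbors_def insert_commute)

lemma finite_neighbors [simp]: "finite (neighbors G v)"
  by (rule finite_subset[OF _ finite_verts]) (auto dest: neighbors_verts)

lemma neighbor_list:
  "set (neighbor_list G h v) = neighbors G v" "distinct (neighbor_list G h v)"
  "length (neighbor_list G h v) = d v" "sorted (map h (neighbor_list G h v))"
  by (simp_all add: neighbor_list_def deg_def)

lemma deg_le: "v \<in> verts G \<Longrightarrow> Suc (d v) \<le> n"
proof -
  assume "v \<in> verts G"
  then have "insert v (neighbors G v) \<subseteq> verts G" "v \<notin> neighbors G v" by (auto dest: neighbors_verts)
  then have "card (insert v (neighbors G v)) \<le> n" unfolding card_verts[symmetric] by (intro card_mono) auto
  with \<open>v \<notin> neighbors G v\<close> show ?thesis by (simp add: deg_def)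
qed

lemma nth_neighbor_list: "1 \<le> j \<Longrightarrow> j \<le> d v \<Longrightarrow> neighbor_list G h v ! (j - 1) \<in> neighbors G v"
  using neighbor_list(1,3)[of h v] by (metis One_nat_def Suc_pred' Suc_le_lessD nth_mem order_less_le_trans diff_less zero_less_one not_less)

section \<open>Slots, their edges and their values\<close>

definition slots :: "(nat \<times> nat) set" where
  "slots = Sigma (verts G) (\<lambda>v. {1..d v})"

lemma finite_slots [simp]: "finite slots"
  by (simp add: slots_def)

text \<open>Values are attached to ranks in a neighbor list because the rank is what the algorithm
  knows before it asks for the neighbor. The edge behind a slot therefore varies with the hash
  order.\<close>

definition edge_at :: "(nat \<Rightarrow> real) \<Rightarrow> nat \<times> nat \<Rightarrow> nat \<times> nat" where
  "edge_at h = (\<lambda>(v, j). (v, neighbor_list G h v ! (j - 1)))"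

lemma edge_at_bij: "bij_betw (edge_at h) slots (oriented_edges G)"
proof (rule bij_betw_imageI)
  show "inj_on (edge_at h) slots"
  proof (rule inj_onI)
    fix x y assume x: "x \<in> slots" and y: "y \<in> slots" and eq: "edge_at h x = edge_at h y"
    obtain v j k where [simp]: "x = (v, j)" "y = (v, k)"
      using eq by (cases x; cases y) (auto simp: edge_at_def)
    have "neighbor_list G h v ! (j - 1) = neighbor_list G h v ! (k - 1)"
      using eq by (simp add: edge_at_def)
    moreover have "j - 1 < length (neighbor_list G h v)" "k - 1 < length (neighbor_list G h v)"
      using x y by (auto simp: slots_def neighbor_list)
    ultimately have "j - 1 = k - 1"
      using neighbor_list(2) by (simp add: nth_eq_iff_index_eq)
    then show "x = y" using x y by (auto simp: slots_def)
  qed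
  show "edge_at h ` slots = oriented_edges G"
  proof (intro equalityI subsetI)
    fix e assume "e \<in> edge_at h ` slots"
    then obtain v j where "e = (v, neighbor_list G h v ! (j - 1))" "1 \<le> j" "j \<le> d v"
      by (auto simp: edge_at_def slots_def)
    then show "e \<in> oriented_edges G"
      using nth_neighbor_list[of j v h] by (simp add: oriented_edges_def neighbors_def)
  next
    fix e assume "e \<in> oriented_edges G"
    then obtain v w where e: "e = (v, w)" "w \<in> neighbors G v" by (auto simp: oriented_edges_def neighbors_def)
    then obtain k where "k < d v" "w = neighbor_list G h v ! k"
      using neighbor_list(1,3)[of h v] by (metis in_set_conv_nth)
    then have "e = edge_at h (v, Suc k)" "(v, Suc k) \<in> slots"
      using e neighbors_verts by (auto simp: edge_at_def slots_def)
    then show "e \<in> edge_at h ` slots" by blast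
  qed
qed

lemma card_slots: "card slots = card (oriented_edges G)"
  using edge_at_bij by (rule bij_betw_same_card)

text \<open>\<open>z\<close> collects the randomness of a run: coins under \<open>Inl\<close>, hash
  values under \<open>Inr\<close>. Changing \<open>\<tau>\<close> changes which coins are read but
  not the joint law of the values.\<close>

definition val :: "real \<Rightarrow> (coin + nat \<Rightarrow> real) \<Rightarrow> nat \<times> nat \<Rightarrow> real" where
  "val \<tau> z = (\<lambda>(v, j). if real (d v) \<le> \<tau> then z (Inl (Light (ix v) j))
     else rescaled (d v) (z (Inr v)) (\<lambda>j. z (Inl (Heavy v j))) j)"

definition found :: "real \<Rightarrow> real \<Rightarrow> real \<Rightarrow> (coin + nat \<Rightarrow> real) \<Rightarrow> nat \<Rightarrow> bool" where
  "found \<tau> L p z w \<longleftrightarrow> (\<exists>i\<in>{1..n}. z (Inl (Mark i)) \<le> L / \<tau> \<and> w \<in> neighbors G (va i) \<and>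
     z (Inr w) \<le> scan_bound n L p (z (Inl (Mark i))))"

definition active :: "real \<Rightarrow> real \<Rightarrow> real \<Rightarrow> (coin + nat \<Rightarrow> real) \<Rightarrow> (nat \<times> nat) set" where
  "active \<tau> L p z = {x \<in> slots. 1 - p \<le> val \<tau> z x \<and> (real (d (fst x)) \<le> \<tau> \<or> found \<tau> L p z (fst x))}"

abbreviation orc :: "(coin + nat \<Rightarrow> real) \<Rightarrow> query \<Rightarrow> answer" where
  "orc z \<equiv> respond G (\<lambda>v. z (Inr v))"

abbreviation coins :: "(coin + nat \<Rightarrow> real) \<Rightarrow> coin \<Rightarrow> real" where
  "coins z \<equiv> \<lambda>k. z (Inl k)"

abbreviation nl :: "(coin + nat \<Rightarrow> real) \<Rightarrow> nat \<Rightarrow> nat list" where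
  "nl z \<equiv> neighbor_list G (\<lambda>v. z (Inr v))"

section \<open>Results and query counts of the subroutines\<close>

lemma ask_Vertex [simp]:
  assumes "1 \<le> i" "i \<le> n"
  shows "result (ask_vertex (Vertex i) f) (orc z) = result (f (va i)) (orc z)"
    "num_queries (ask_vertex (Vertex i) f) (orc z) = Suc (num_queries (f (va i)) (orc z))"
  using assms by (simp_all add: ask_vertex_def card_verts)

lemma ask_Degree [simp]:
  assumes "v \<in> verts G"
  shows "result (ask_nat (Degree v) f) (orc z) = result (f (d v)) (orc z)"
    "num_queries (ask_nat (Degree v) f) (orc z) = Suc (num_queries (f (d v)) (orc z))"
  using assms by (simp_all add: ask_nat_def)

lemma ask_Neighbor [simp]:
  assumes "v \<in> verts G" "1 \<le> j" "j \<le> d v"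
  shows "result (ask_vertex (Neighbor v j) f) (orc z) = result (f (nl z v ! (j - 1))) (orc z)"
    "num_queries (ask_vertex (Neighbor v j) f) (orc z) = Suc (num_queries (f (nl z v ! (j - 1))) (orc z))"
  using assms by (simp_all add: ask_vertex_def)

lemma ask_Hash [simp]:
  assumes "v \<in> verts G"
  shows "result (ask_hash (Hash v) f) (orc z) = result (f (z (Inr v))) (orc z)"
    "num_queries (ask_hash (Hash v) f) (orc z) = Suc (num_queries (f (z (Inr v))) (orc z))"
  using assms by (simp_all add: ask_hash_def)

text \<open>Each inspected neighbor costs a neighbor query and a hash query. \<open>Suc\<close>
  accounts for the neighbor that exceeds the threshold and ends the scan; the minimum covers the
  case that the list is exhausted first.\<close>

lemma scan_aux:
  fixes z :: "coin + nat \<Rightarrow> real" and \<theta> :: real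
  assumes "u \<in> verts G" "set js \<subseteq> {1..d u}"
  defines "ws \<equiv> takeWhile (\<lambda>w. z (Inr w) \<le> \<theta>) (map (\<lambda>j. nl z u ! (j - 1)) js)"
  shows "result (scan \<theta> u js) (orc z) = map (\<lambda>w. (w, z (Inr w))) ws"
    and "num_queries (scan \<theta> u js) (orc z) = 2 * min (length js) (Suc (length ws))"
proof -
  have "result (scan \<theta> u js) (orc z) = map (\<lambda>w. (w, z (Inr w))) (takeWhile (\<lambda>w. z (Inr w) \<le> \<theta>) (map (\<lambda>j. nl z u ! (j - 1)) js)) \<and>
    num_queries (scan \<theta> u js) (orc z) = 2 * min (length js) (Suc (length (takeWhile (\<lambda>w. z (Inr w) \<le> \<theta>) (map (\<lambda>j. nl z u ! (j - 1)) js))))"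
    using assms(2)
  proof (induction js)
    case (Cons j js)
    then have "1 \<le> j" "j \<le> d u" by auto
    moreover from this have "nl z u ! (j - 1) \<in> verts G" using nth_neighbor_list[of j u] neighbors_verts by blast
    ultimately show ?case using Cons assms(1) by simp
  qed simp
  then show "result (scan \<theta> u js) (orc z) = map (\<lambda>w. (w, z (Inr w))) ws"
    "num_queries (scan \<theta> u js) (orc z) = 2 * min (length js) (Suc (length ws))"
    by (auto simp: ws_def)
qed

lemma scan:
  assumes "u \<in> verts G"
  shows "set (result (scan \<theta> u [1..<Suc (d u)]) (orc z)) = (\<lambda>w. (w, z (Inr w))) ` {w \<in> neighbors G u. z (Inr w) \<le> \<theta>}"
    and "num_queries (scan \<theta> u [1..<Suc (d u)]) (orc z) = 2 * min (d u) (Suc (card {w \<in> neighbors G u. z (Inr w) \<le> \<theta>}))"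
proof -
  have eq: "map (\<lambda>j. nl z u ! (j - 1)) [1..<Suc (d u)] = nl z u"
    by (intro nth_equalityI) (auto simp: neighbor_list)
  have f: "takeWhile (\<lambda>w. z (Inr w) \<le> \<theta>) (nl z u) = filter (\<lambda>w. z (Inr w) \<le> \<theta>) (nl z u)"
    by (rule takeWhile_sorted_key) (rule neighbor_list)
  have "length (filter (\<lambda>w. z (Inr w) \<le> \<theta>) (nl z u)) = card (set (filter (\<lambda>w. z (Inr w) \<le> \<theta>) (nl z u)))"
    by (rule distinct_card[symmetric]) (simp add: neighbor_list)
  then have c: "length (filter (\<lambda>w. z (Inr w) \<le> \<theta>) (nl z u)) = card {w \<in> neighbors G u. z (Inr w) \<le> \<theta>}"
    by (simp add: neighbor_list)
  note aux = scan_aux[OF assms, of "[1..<Suc (d u)]" \<theta> z, unfolded eq f]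
  show "set (result (scan \<theta> u [1..<Suc (d u)]) (orc z)) = (\<lambda>w. (w, z (Inr w))) ` {w \<in> neighbors G u. z (Inr w) \<le> \<theta>}"
    by (subst aux) (auto simp: neighbor_list)
  show "num_queries (scan \<theta> u [1..<Suc (d u)]) (orc z) = 2 * min (d u) (Suc (card {w \<in> neighbors G u. z (Inr w) \<le> \<theta>}))"
    by (subst aux) (auto simp: c)
qed

lemma sum_list_filter_upt: "(\<Sum>i\<leftarrow>filter P [1..<Suc k]. f i) = (\<Sum>i\<in>{1..k}. if P i then f i else (0::nat))"
proof -
  have "(\<Sum>i\<leftarrow>filter P [1..<Suc k]. f i) = (\<Sum>i\<in>{i \<in> {1..k}. P i}. f i)"
    by (subst sum_list_distinct_conv_sum_set) (auto intro!: sum.cong)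
  also have "\<dots> = (\<Sum>i\<in>{1..k}. if P i then f i else 0)"
    by (rule sum.inter_filter) simp
  finally show ?thesis .
qed

definition light_cost :: "real \<Rightarrow> real \<Rightarrow> (coin + nat \<Rightarrow> real) \<Rightarrow> nat" where
  "light_cost \<tau> p z = (\<Sum>(i, j)\<in>{1..n} \<times> {1..nat \<lfloor>\<tau>\<rfloor>}. if 1 - p \<le> z (Inl (Light i j))
     then 2 + (if j \<le> d (va i) \<and> real (d (va i)) \<le> \<tau> then 1 else 0) else 0)"

definition scan_cost :: "real \<Rightarrow> real \<Rightarrow> real \<Rightarrow> (coin + nat \<Rightarrow> real) \<Rightarrow> nat" where
  "scan_cost \<tau> L p z = (\<Sum>i\<in>{1..n}. if z (Inl (Mark i)) \<le> L / \<tau>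
     then 2 + 2 * min (d (va i)) (Suc (card {w \<in> neighbors G (va i). z (Inr w) \<le> scan_bound n L p (z (Inl (Mark i)))})) else 0)"

definition heavy_cost :: "real \<Rightarrow> real \<Rightarrow> real \<Rightarrow> (coin + nat \<Rightarrow> real) \<Rightarrow> nat" where
  "heavy_cost \<tau> L p z = (\<Sum>v\<in>{v \<in> verts G. found \<tau> L p z v}.
     1 + (if \<tau> < real (d v) then card {j \<in> {1..d v}. 1 - p \<le> val \<tau> z (v, j)} else 0))"

lemma light_items:
  shows "set (result (light_items n \<tau> p (coins z)) (orc z)) =
      (\<lambda>x. (edge_at (\<lambda>v. z (Inr v)) x, val \<tau> z x)) ` {x \<in> slots. 1 - p \<le> val \<tau> z x \<and> real (d (fst x)) \<le> \<tau>}" (is "?A = ?B")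
    and "num_queries (light_items n \<tau> p (coins z)) (orc z) = light_cost \<tau> p z"
proof -
  let ?f = "\<lambda>(i, j). ask_vertex (Vertex i) (\<lambda>v. ask_nat (Degree v) (\<lambda>d. if j \<le> d \<and> real d \<le> \<tau>
      then ask_vertex (Neighbor v j) (\<lambda>w. Return [((v, w), z (Inl (Light i j)))]) else Return []))"
  let ?cells = "filter (\<lambda>(i, j). 1 - p \<le> z (Inl (Light i j))) (List.product [1..<Suc n] [1..<Suc (nat \<lfloor>\<tau>\<rfloor>)])"
  have r: "result (?f (i, j)) (orc z) = (if j \<le> d (va i) \<and> real (d (va i)) \<le> \<tau>
      then [((va i, nl z (va i) ! (j - 1)), z (Inl (Light i j)))] else [])"
    and q: "num_queries (?f (i, j)) (orc z) = 2 + (if j \<le> d (va i) \<and> real (d (va i)) \<le> \<tau> then 1 else 0)"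
    if "(i, j) \<in> set ?cells" for i j
    using that by auto
  show "?A = ?B"
  proof (intro equalityI subsetI)
    fix a assume "a \<in> ?A"
    then obtain i j where ij: "(i, j) \<in> set ?cells" and a: "a \<in> set (result (?f (i, j)) (orc z))"
      by (auto simp: light_items_def)
    from a r[OF ij] have "j \<le> d (va i)" "real (d (va i)) \<le> \<tau>" "a = ((va i, nl z (va i) ! (j - 1)), z (Inl (Light i j)))"
      by (auto split: if_splits)
    with ij show "a \<in> ?B"
      by (intro image_eqI[of _ _ "(va i, j)"]) (auto simp: edge_at_def val_def slots_def)
  next
    fix a assume "a \<in> ?B"
    then obtain v j where vj: "v \<in> verts G" "1 \<le> j" "j \<le> d v" "1 - p \<le> val \<tau> z (v, j)" "real (d v) \<le> \<tau>"
      and a: "a = (edge_at (\<lambda>v. z (Inr v)) (v, j), val \<tau> z (v, j))" by (auto simp: slots_def)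
    have "j \<le> nat \<lfloor>\<tau>\<rfloor>" using vj by linarith
    then have ij: "(ix v, j) \<in> set ?cells" using vj ix_in[of v] by (auto simp: val_def)
    have "a \<in> set (result (?f (ix v, j)) (orc z))"
      unfolding r[OF ij] using vj a by (auto simp: val_def edge_at_def)
    moreover have "?A = (\<Union>x\<in>set ?cells. set (result (?f x) (orc z)))" by (simp add: light_items_def)
    ultimately show "a \<in> ?A" using ij by blast
  qed
  have "num_queries (light_items n \<tau> p (coins z)) (orc z) = (\<Sum>x\<leftarrow>?cells. num_queries (?f x) (orc z))"
    by (simp add: light_items_def)
  also have "\<dots> = (\<Sum>x\<in>set ?cells. num_queries (?f x) (orc z))"
    by (intro sum_list_distinct_conv_sum_set) (auto simp: distinct_product)
  also have "\<dots> = (\<Sum>(i, j)\<in>set ?cells. 2 + (if j \<le> d (va i) \<and> real (d (va i)) \<le> \<tau> then 1 else 0))"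
    using q by (intro sum.cong) auto
  also have "set ?cells = {x \<in> {1..n} \<times> {1..nat \<lfloor>\<tau>\<rfloor>}. (\<lambda>(i, j). 1 - p \<le> z (Inl (Light i j))) x}" by auto
  also have "(\<Sum>(i, j)\<in>\<dots>. 2 + (if j \<le> d (va i) \<and> real (d (va i)) \<le> \<tau> then 1 else 0)) = light_cost \<tau> p z"
    unfolding light_cost_def by (subst sum.inter_filter) (auto intro!: sum.cong)
  finally show "num_queries (light_items n \<tau> p (coins z)) (orc z) = light_cost \<tau> p z" .
qed

lemma discover:
  shows "set (result (discover n \<tau> L p (coins z)) (orc z)) = (\<lambda>w. (w, z (Inr w))) ` {w \<in> verts G. found \<tau> L p z w}"
    and "distinct (result (discover n \<tau> L p (coins z)) (orc z))"
    and "num_queries (discover n \<tau> L p (coins z)) (orc z) = scan_cost \<tau> L p z"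
proof -
  show "set (result (discover n \<tau> L p (coins z)) (orc z)) = (\<lambda>w. (w, z (Inr w))) ` {w \<in> verts G. found \<tau> L p z w}"
  proof -
    let ?I = "{i \<in> {1..n}. z (Inl (Mark i)) \<le> L / \<tau>}"
    let ?g = "\<lambda>i. ask_vertex (Vertex i) (\<lambda>u. ask_nat (Degree u) (\<lambda>d. scan (scan_bound n L p (z (Inl (Mark i)))) u [1..<Suc d]))"
    have I: "set (filter (\<lambda>i. z (Inl (Mark i)) \<le> L / \<tau>) [1..<Suc n]) = ?I" by auto
    have "set (result (discover n \<tau> L p (coins z)) (orc z)) = (\<Union>i\<in>?I. set (result (?g i) (orc z)))"
      unfolding I[symmetric] by (simp add: discover_def)
    also have "\<dots> = (\<Union>i\<in>?I. (\<lambda>w. (w, z (Inr w))) ` {w \<in> neighbors G (va i). z (Inr w) \<le> scan_bound n L p (z (Inl (Mark i)))})"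
      by (intro SUP_cong refl) (simp add: scan[unfolded One_nat_def])
    also have "\<dots> = (\<lambda>w. (w, z (Inr w))) ` (\<Union>i\<in>?I. {w \<in> neighbors G (va i). z (Inr w) \<le> scan_bound n L p (z (Inl (Mark i)))})"
      by (simp only: image_UN)
    also have "(\<Union>i\<in>?I. {w \<in> neighbors G (va i). z (Inr w) \<le> scan_bound n L p (z (Inl (Mark i)))}) = {w \<in> verts G. found \<tau> L p z w}"
      using neighbors_verts by (auto simp: found_def)
    finally show ?thesis .
  qed
  show "distinct (result (discover n \<tau> L p (coins z)) (orc z))" by (simp add: discover_def)
  show "num_queries (discover n \<tau> L p (coins z)) (orc z) = scan_cost \<tau> L p z"
    unfolding discover_def scan_cost_def
    by (simp add: sum_list_filter_upt[unfolded One_nat_def]) (intro sum.cong refl, auto simp: scan[unfolded One_nat_def])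
qed

text \<open>Only the set and the distinctness of the discovered list are assumed: its order is an
  artefact of the vertex enumeration and affects neither the items found nor the number of
  queries.\<close>

lemma heavy_items:
  assumes ws: "set ws = (\<lambda>w. (w, z (Inr w))) ` {w \<in> verts G. found \<tau> L p z w}" "distinct ws"
  shows "set (result (heavy_items \<tau> p (coins z) ws) (orc z)) =
      (\<lambda>x. (edge_at (\<lambda>v. z (Inr v)) x, val \<tau> z x)) ` {x \<in> slots. 1 - p \<le> val \<tau> z x \<and> \<tau> < real (d (fst x)) \<and> found \<tau> L p z (fst x)}" (is "?A = ?B")
    and "num_queries (heavy_items \<tau> p (coins z) ws) (orc z) = heavy_cost \<tau> L p z"
proof -
  let ?f = "\<lambda>(v, x). ask_nat (Degree v) (\<lambda>d. if \<tau> < real d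
      then map_tree (\<lambda>j. ask_vertex (Neighbor v j) (\<lambda>w. Return ((v, w), rescaled d x (\<lambda>j. z (Inl (Heavy v j))) j)))
        (filter (\<lambda>j. 1 - p \<le> rescaled d x (\<lambda>j. z (Inl (Heavy v j))) j) [1..<Suc d])
      else Return [])"
  have r: "set (result (?f (v, z (Inr v))) (orc z)) = (if \<tau> < real (d v)
      then (\<lambda>j. (edge_at (\<lambda>v. z (Inr v)) (v, j), val \<tau> z (v, j))) ` {j \<in> {1..d v}. 1 - p \<le> val \<tau> z (v, j)} else {})"
    and q: "num_queries (?f (v, z (Inr v))) (orc z) = 1 + (if \<tau> < real (d v) then card {j \<in> {1..d v}. 1 - p \<le> val \<tau> z (v, j)} else 0)"
    if v: "v \<in> verts G" for v
  proof -
    show "set (result (?f (v, z (Inr v))) (orc z)) = (if \<tau> < real (d v)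
      then (\<lambda>j. (edge_at (\<lambda>v. z (Inr v)) (v, j), val \<tau> z (v, j))) ` {j \<in> {1..d v}. 1 - p \<le> val \<tau> z (v, j)} else {})"
    proof -
      have "result (?f (v, z (Inr v))) (orc z) = (if \<tau> < real (d v)
        then map (\<lambda>j. (edge_at (\<lambda>v. z (Inr v)) (v, j), val \<tau> z (v, j))) (filter (\<lambda>j. 1 - p \<le> val \<tau> z (v, j)) [1..<Suc (d v)]) else [])"
        using v by (auto simp: val_def edge_at_def)
      then show ?thesis by auto
    qed
    have "(\<Sum>j\<leftarrow>filter (\<lambda>j. 1 - p \<le> rescaled (d v) (z (Inr v)) (\<lambda>j. z (Inl (Heavy v j))) j) [1..<Suc (d v)].
        num_queries (ask_vertex (Neighbor v j) (\<lambda>w. Return ((v, w), rescaled (d v) (z (Inr v)) (\<lambda>j. z (Inl (Heavy v j))) j))) (orc z)) =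
      (\<Sum>j\<in>{1..d v}. if 1 - p \<le> rescaled (d v) (z (Inr v)) (\<lambda>j. z (Inl (Heavy v j))) j then 1 else 0)"
      unfolding sum_list_filter_upt using v by (intro sum.cong) auto
    also have "\<dots> = card {j \<in> {1..d v}. 1 - p \<le> rescaled (d v) (z (Inr v)) (\<lambda>j. z (Inl (Heavy v j))) j}"
      by (simp add: sum.If_cases Int_def)
    finally show "num_queries (?f (v, z (Inr v))) (orc z) = 1 + (if \<tau> < real (d v) then card {j \<in> {1..d v}. 1 - p \<le> val \<tau> z (v, j)} else 0)"
      using v by (simp add: val_def del: upt_Suc)
  qed
  have "?A = (\<Union>v\<in>{w \<in> verts G. found \<tau> L p z w}. set (result (?f (v, z (Inr v))) (orc z)))"
    by (simp add: heavy_items_def ws)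
  also have "\<dots> = (\<Union>v\<in>{w \<in> verts G. found \<tau> L p z w}. (if \<tau> < real (d v)
      then (\<lambda>j. (edge_at (\<lambda>v. z (Inr v)) (v, j), val \<tau> z (v, j))) ` {j \<in> {1..d v}. 1 - p \<le> val \<tau> z (v, j)} else {}))"
    using r by (intro SUP_cong) auto
  also have "\<dots> = ?B"
  proof (intro equalityI subsetI)
    fix a assume "a \<in> ?B"
    then obtain v j where "v \<in> verts G" "j \<in> {1..d v}" "1 - p \<le> val \<tau> z (v, j)" "\<tau> < real (d v)" "found \<tau> L p z v"
      "a = (edge_at (\<lambda>v. z (Inr v)) (v, j), val \<tau> z (v, j))" by (auto simp: slots_def)
    then show "a \<in> (\<Union>v\<in>{w \<in> verts G. found \<tau> L p z w}. (if \<tau> < real (d v)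
      then (\<lambda>j. (edge_at (\<lambda>v. z (Inr v)) (v, j), val \<tau> z (v, j))) ` {j \<in> {1..d v}. 1 - p \<le> val \<tau> z (v, j)} else {}))"
      by (intro UN_I[of v]) auto
  qed (auto simp: slots_def split: if_splits)
  finally show "?A = ?B" .
  have "num_queries (heavy_items \<tau> p (coins z) ws) (orc z) = (\<Sum>x\<leftarrow>ws. num_queries (?f x) (orc z))"
    by (simp add: heavy_items_def)
  also have "\<dots> = (\<Sum>x\<in>(\<lambda>w. (w, z (Inr w))) ` {w \<in> verts G. found \<tau> L p z w}. num_queries (?f x) (orc z))"
    unfolding ws(1)[symmetric] using ws(2) by (rule sum_list_distinct_conv_sum_set)
  also have "\<dots> = (\<Sum>v\<in>{w \<in> verts G. found \<tau> L p z w}. num_queries (?f (v, z (Inr v))) (orc z))"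
    by (subst sum.reindex) (auto simp: inj_on_def)
  also have "\<dots> = heavy_cost \<tau> L p z"
    unfolding heavy_cost_def using q by (intro sum.cong) auto
  finally show "num_queries (heavy_items \<tau> p (coins z) ws) (orc z) = heavy_cost \<tau> L p z" .
qed

definition search_cost :: "real \<Rightarrow> real \<Rightarrow> real \<Rightarrow> (coin + nat \<Rightarrow> real) \<Rightarrow> nat" where
  "search_cost \<tau> L p z = light_cost \<tau> p z + scan_cost \<tau> L p z + heavy_cost \<tau> L p z"

lemma search:
  shows "result (search n \<tau> L (coins z) p) (orc z) = (\<lambda>x. (edge_at (\<lambda>v. z (Inr v)) x, val \<tau> z x)) ` active \<tau> L p z"
    and "num_queries (search n \<tau> L (coins z) p) (orc z) = search_cost \<tau> L p z"
proof -
  have "active \<tau> L p z = {x \<in> slots. 1 - p \<le> val \<tau> z x \<and> real (d (fst x)) \<le> \<tau>} \<union>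
     {x \<in> slots. 1 - p \<le> val \<tau> z x \<and> \<tau> < real (d (fst x)) \<and> found \<tau> L p z (fst x)}"
    by (auto simp: active_def)
  then show "result (search n \<tau> L (coins z) p) (orc z) = (\<lambda>x. (edge_at (\<lambda>v. z (Inr v)) x, val \<tau> z x)) ` active \<tau> L p z"
    by (simp add: search_def light_items heavy_items[OF discover(1,2)] image_Un)
  show "num_queries (search n \<tau> L (coins z) p) (orc z) = search_cost \<tau> L p z"
    by (simp add: search_def light_items heavy_items[OF discover(1,2)] discover search_cost_def)
qed

text \<open>The algorithm ranks pairs of an edge and a value, the analysis ranks slots. Labelling
  slots by edges is injective, so the ranks agree.\<close>

lemma select_items:
  assumes A: "A \<subseteq> slots"
  shows "select s ((\<lambda>x. (edge_at h x, f x)) ` A) = edge_at h ` top_entries s A f"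
    and "card ((\<lambda>x. (edge_at h x, f x)) ` A) = card A"
proof -
  have inj: "inj_on (edge_at h) A" using edge_at_bij A by (auto simp: bij_betw_def intro: inj_on_subset)
  then have inj': "inj_on (\<lambda>x. (edge_at h x, f x)) B" if "B \<subseteq> A" for B
    using that by (auto simp: inj_on_def)
  then show "card ((\<lambda>x. (edge_at h x, f x)) ` A) = card A" by (simp add: card_image)
  have "{b \<in> (\<lambda>x. (edge_at h x, f x)) ` A. y \<le> snd b} = (\<lambda>x. (edge_at h x, f x)) ` {x \<in> A. y \<le> f x}" for y
    by auto
  then have "card {b \<in> (\<lambda>x. (edge_at h x, f x)) ` A. y \<le> snd b} = card {x \<in> A. y \<le> f x}" for y
    using inj'[of "{x \<in> A. y \<le> f x}"] by (simp add: card_image)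
  then have "{a \<in> (\<lambda>x. (edge_at h x, f x)) ` A. card {b \<in> (\<lambda>x. (edge_at h x, f x)) ` A. snd a \<le> snd b} \<le> s} =
      (\<lambda>x. (edge_at h x, f x)) ` {x \<in> A. card {x' \<in> A. f x \<le> f x'} \<le> s}"
    by auto
  then show "select s ((\<lambda>x. (edge_at h x, f x)) ` A) = edge_at h ` top_entries s A f"
    by (simp add: select_def top_entries_def image_image)
qed

end

lemma insort_key_agree:
  "(\<And>y. y \<in> set ys \<Longrightarrow> (f x \<le> f y) = (g x \<le> g y)) \<Longrightarrow> insort_key f x ys = insort_key g x ys"
  by (induction ys) auto

text \<open>Sorting uses comparisons only; hence finitely many comparisons of hash values determine
  every neighbor list, which is how measurability and locality of the lists are obtained.\<close>

lemma sort_key_agree: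
  "(\<And>x y. x \<in> set xs \<Longrightarrow> y \<in> set xs \<Longrightarrow> (f x \<le> f y) = (g x \<le> g y)) \<Longrightarrow> sort_key f xs = sort_key g xs"
proof (induction xs)
  case (Cons x xs)
  then have "sort_key f xs = sort_key g xs" by auto
  then show ?case using Cons.prems by (auto intro!: insort_key_agree)
qed simp

context graph_run
begin

subsection \<open>Counting edges\<close>

lemma finite_edges: "finite (edges G)"
proof (rule finite_subset)
  show "edges G \<subseteq> Pow (verts G)" using wf by (auto simp: wf_access_graph_def)
qed simp

lemma finite_oriented [simp]: "finite (oriented_edges G)"
  using edge_at_bij[of "\<lambda>_. 0"] by (metis bij_betw_finite finite_slots)

lemma card_oriented: "card (oriented_edges G) = 2 * m"
proof -
  have un: "oriented_edges G = (\<Union>e\<in>edges G. {(u, v). {u, v} = e})"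
    by (auto simp: oriented_edges_def)
  have fin: "finite {(u, v). {u, v} = e} \<and> card {(u, v). {u, v} = e} = 2" if e: "e \<in> edges G" for e
  proof -
    obtain a b where ab: "e = {a, b}" "a \<noteq> b" using wf e by (auto simp: wf_access_graph_def)
    then have "{(u, v). {u, v} = e} = {(a, b), (b, a)}" by (auto simp: doubleton_eq_iff)
    then show ?thesis using ab by simp
  qed
  have "card (\<Union>e\<in>edges G. {(u, v). {u, v} = e}) = (\<Sum>e\<in>edges G. card {(u, v). {u, v} = e})"
    using fin by (intro card_UN_disjoint finite_edges) auto
  also have "\<dots> = (\<Sum>e\<in>edges G. 2)" using fin by (intro sum.cong) auto
  finally show ?thesis unfolding un by (simp add: card_edges)
qed

lemma m_pos: "0 < m"
  using s_pos s_le card_oriented by simp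

lemma sum_deg: "(\<Sum>v\<in>verts G. d v) = 2 * m"
  using card_slots card_oriented by (simp add: slots_def card_SigmaI)

lemma deg_le_m: "d v \<le> m"
  unfolding deg_def card_edges[symmetric]
  by (rule card_inj_on_le[of "\<lambda>w. {v, w}"]) (auto simp: inj_on_def neighbors_def doubleton_eq_iff finite_edges)

lemma m_le: "m \<le> n\<^sup>2"
proof -
  have "2 * m \<le> (\<Sum>v\<in>verts G. n)"
    unfolding sum_deg[symmetric] using deg_le by (intro sum_mono) (auto dest: Suc_leD)
  then show ?thesis by (simp add: card_verts power2_eq_square)
qed

lemma n_ge_2: "2 \<le> n"
proof -
  obtain v where v: "v \<in> verts G" "d v \<noteq> 0" using sum_deg m_pos by (metis sum.neutral mult_eq_0_iff zero_neq_numeral less_irrefl)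
  then show ?thesis using deg_le[of v] by simp
qed

subsection \<open>Stopping and output\<close>

primrec rounds_output :: "real \<Rightarrow> real \<Rightarrow> (coin + nat \<Rightarrow> real) \<Rightarrow> nat \<Rightarrow> (nat \<times> nat) set" where
  "rounds_output \<tau> L z 0 = edge_at (\<lambda>v. z (Inr v)) ` top_entries s (active \<tau> L 1 z) (val \<tau> z)"
| "rounds_output \<tau> L z (Suc g) = (if s \<le> card (active \<tau> L (1 / 2 ^ Suc g) z)
     then edge_at (\<lambda>v. z (Inr v)) ` top_entries s (active \<tau> L (1 / 2 ^ Suc g) z) (val \<tau> z)
     else rounds_output \<tau> L z g)"

primrec rounds_cost :: "real \<Rightarrow> real \<Rightarrow> (coin + nat \<Rightarrow> real) \<Rightarrow> nat \<Rightarrow> nat" where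
  "rounds_cost \<tau> L z 0 = search_cost \<tau> L 1 z"
| "rounds_cost \<tau> L z (Suc g) = search_cost \<tau> L (1 / 2 ^ Suc g) z +
     (if s \<le> card (active \<tau> L (1 / 2 ^ Suc g) z) then 0 else rounds_cost \<tau> L z g)"

lemma active_slots: "active \<tau> L p z \<subseteq> slots"
  by (auto simp: active_def)

lemma rounds:
  "result (rounds n s \<tau> L (coins z) g) (orc z) = rounds_output \<tau> L z g"
  "num_queries (rounds n s \<tau> L (coins z) g) (orc z) = rounds_cost \<tau> L z g"
  by (induction g) (simp_all add: search select_items[OF active_slots] del: power_Suc)

definition sampled_vertex :: "(coin + nat \<Rightarrow> real) \<Rightarrow> nat \<Rightarrow> nat" where
  "sampled_vertex z t = max 1 (min n (nat \<lceil>real n * z (Inl (Idx t))\<rceil>))"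

definition stop :: "(coin + nat \<Rightarrow> real) \<Rightarrow> nat \<Rightarrow> bool" where
  "stop z t \<longleftrightarrow> z (Inl (Thr t)) \<le> real (d (va (sampled_vertex z t))) * real t / real n"

definition stop_time :: "(coin + nat \<Rightarrow> real) \<Rightarrow> nat" where
  "stop_time z = result (estimate n (coins z) [1..<n]) (orc z)"

lemma estimate_Cons:
  "result (estimate n (coins z) (t # ts)) (orc z) = (if stop z t then t else result (estimate n (coins z) ts) (orc z))"
  "num_queries (estimate n (coins z) (t # ts)) (orc z) = 2 + (if stop z t then 0 else num_queries (estimate n (coins z) ts) (orc z))"
  using n_ge_2 by (auto simp: stop_def sampled_vertex_def)

lemma estimate_cong:
  assumes "\<And>t. t \<in> set ts \<Longrightarrow> stop z t = stop z' t"
  shows "result (estimate n (coins z) ts) (orc z) = result (estimate n (coins z') ts) (orc z') \<and>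
    num_queries (estimate n (coins z) ts) (orc z) = num_queries (estimate n (coins z') ts) (orc z')"
  using assms by (induction ts) (auto simp: estimate_Cons simp del: estimate.simps(2))

text \<open>Two queries per attempt, the last one included. The result \<open>n\<close> is also the
  default of an exhausted list, so a successful attempt is asserted only for results below
  \<open>n\<close>.\<close>

lemma estimate_upt:
  assumes "k \<le> n"
  shows "k \<le> result (estimate n (coins z) [k..<n]) (orc z) \<and> result (estimate n (coins z) [k..<n]) (orc z) \<le> n \<and>
    num_queries (estimate n (coins z) [k..<n]) (orc z) + 2 * k \<le> 2 * result (estimate n (coins z) [k..<n]) (orc z) + 2 \<and>
    (\<forall>t\<in>{k..<result (estimate n (coins z) [k..<n]) (orc z)}. \<not> stop z t) \<and>
    (result (estimate n (coins z) [k..<n]) (orc z) < n \<longrightarrow> stop z (result (estimate n (coins z) [k..<n]) (orc z)))"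
  using assms
proof (induction k rule: inc_induct)
  case base
  then show ?case by simp
next
  case (step k)
  have "[k..<n] = k # [Suc k..<n]" using step by (simp add: upt_conv_Cons)
  then show ?case using step by (auto simp: estimate_Cons Suc_le_eq less_eq_Suc_le[symmetric] simp del: estimate.simps(2))
qed

lemma stop_time:
  "1 \<le> stop_time z" "stop_time z \<le> n" "t < stop_time z \<Longrightarrow> 1 \<le> t \<Longrightarrow> \<not> stop z t"
  "stop_time z < n \<Longrightarrow> stop z (stop_time z)"
  using estimate_upt[of 1 z] n_ge_2 by (auto simp: stop_time_def)

definition sample :: "real \<Rightarrow> (coin + nat \<Rightarrow> real) \<Rightarrow> (nat \<times> nat) set" where
  "sample \<delta> z = rounds_output (light_bound n s (stop_time z)) (mark_rate n \<delta>) z (num_rounds n)"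

definition cost :: "real \<Rightarrow> (coin + nat \<Rightarrow> real) \<Rightarrow> nat" where
  "cost \<delta> z = num_queries (estimate n (coins z) [1..<n]) (orc z) +
     rounds_cost (light_bound n s (stop_time z)) (mark_rate n \<delta>) z (num_rounds n)"

lemma edge_sampler:
  "result (edge_sampler n s \<delta> (coins z)) (orc z) = sample \<delta> z"
  "num_queries (edge_sampler n s \<delta> (coins z)) (orc z) = cost \<delta> z"
  by (simp_all add: edge_sampler_def rounds sample_def cost_def stop_time_def)

lemma cost_le:
  "cost \<delta> z \<le> 2 * stop_time z + rounds_cost (light_bound n s (stop_time z)) (mark_rate n \<delta>) z (num_rounds n)"
  using estimate_upt[of 1 z] n_ge_2 by (auto simp: cost_def stop_time_def)

subsection \<open>Measurability\<close>

definition K :: "(coin + nat) set" where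
  "K = UNIV <+> verts G"

abbreviation P :: "(coin + nat \<Rightarrow> real) measure" where
  "P \<equiv> unif K"

lemma in_K [simp]: "Inl k \<in> K" "Inr v \<in> K \<longleftrightarrow> v \<in> verts G"
  by (auto simp: K_def)

lemma measurable_coin [measurable]: "(\<lambda>z. z (Inl k)) \<in> borel_measurable P"
  by (rule measurable_unif_component) simp

lemma measurable_hash: "v \<in> verts G \<Longrightarrow> (\<lambda>z. z (Inr v)) \<in> borel_measurable P"
  by (rule measurable_unif_component) simp

lemma measurable_val:
  assumes "x \<in> slots"
  shows "(\<lambda>z. val \<tau> z x) \<in> borel_measurable P"
proof -
  obtain v j where x: "x = (v, j)" "v \<in> verts G" using assms by (auto simp: slots_def)
  note [measurable] = measurable_hash[OF x(2)]
  have [measurable]: "(\<lambda>z. Max ((\<lambda>j. z (Inl (Heavy v j))) ` {1..d v})) \<in> borel_measurable P"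
    by (rule borel_measurable_Max) auto
  show ?thesis
    unfolding x(1) val_def rescaled_def by simp
qed

text \<open>A finite stock of comparisons sufficient for one search: the order of the hash values
  fixes the neighbor lists, the order of the slot values fixes the top entries, and the rest fixes
  which items are found and at what cost.\<close>

definition tests :: "real \<Rightarrow> real \<Rightarrow> real \<Rightarrow> ((coin + nat \<Rightarrow> real) \<Rightarrow> bool) set" where
  "tests \<tau> L p =
     (\<lambda>(i, j) z. 1 - p \<le> z (Inl (Light i j))) ` ({1..n} \<times> {1..nat \<lfloor>\<tau>\<rfloor>}) \<union>
     (\<lambda>i z. z (Inl (Mark i)) \<le> L / \<tau>) ` {1..n} \<union>
     (\<lambda>(i, w) z. z (Inr w) \<le> scan_bound n L p (z (Inl (Mark i)))) ` ({1..n} \<times> verts G) \<union>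
     (\<lambda>x z. 1 - p \<le> val \<tau> z x) ` slots \<union>
     (\<lambda>(x, y) z. val \<tau> z x \<le> val \<tau> z y) ` (slots \<times> slots) \<union>
     (\<lambda>(v, w) z. z (Inr v) \<le> z (Inr w)) ` (verts G \<times> verts G)"

lemma finite_tests: "finite (tests \<tau> L p)"
  by (auto simp: tests_def)

lemma measurable_tests:
  assumes "q \<in> tests \<tau> L p"
  shows "Measurable.pred P q"
proof -
  have "(\<lambda>z. scan_bound n L p (z (Inl (Mark i)))) \<in> borel_measurable P" for i
    unfolding scan_bound_def by measurable
  then show ?thesis
    using assms unfolding tests_def
    by (elim UnE) (auto simp: pred_def intro!: borel_measurable_le measurable_val measurable_hash)
qed

lemma tests_agree:
  assumes q: "\<And>q. q \<in> tests \<tau> L p \<Longrightarrow> q z = q z'"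
  shows "active \<tau> L p z = active \<tau> L p z'" and "search_cost \<tau> L p z = search_cost \<tau> L p z'"
    and "edge_at (\<lambda>v. z (Inr v)) = edge_at (\<lambda>v. z' (Inr v))"
    and "A \<subseteq> slots \<Longrightarrow> top_entries s A (val \<tau> z) = top_entries s A (val \<tau> z')"
proof -
  have light: "1 - p \<le> z (Inl (Light i j)) \<longleftrightarrow> 1 - p \<le> z' (Inl (Light i j))" if "(i, j) \<in> {1..n} \<times> {1..nat \<lfloor>\<tau>\<rfloor>}" for i j
    by (rule q[of "\<lambda>z. 1 - p \<le> z (Inl (Light i j))"]) (use that in \<open>force simp: tests_def\<close>)
  have mark: "z (Inl (Mark i)) \<le> L / \<tau> \<longleftrightarrow> z' (Inl (Mark i)) \<le> L / \<tau>" if "i \<in> {1..n}" for i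
    by (rule q[of "\<lambda>z. z (Inl (Mark i)) \<le> L / \<tau>"]) (use that in \<open>force simp: tests_def\<close>)
  have hash: "z (Inr w) \<le> scan_bound n L p (z (Inl (Mark i))) \<longleftrightarrow> z' (Inr w) \<le> scan_bound n L p (z' (Inl (Mark i)))"
    if "i \<in> {1..n}" "w \<in> verts G" for i w
    by (rule q[of "\<lambda>z. z (Inr w) \<le> scan_bound n L p (z (Inl (Mark i)))"]) (use that in \<open>force simp: tests_def\<close>)
  have val: "1 - p \<le> val \<tau> z x \<longleftrightarrow> 1 - p \<le> val \<tau> z' x" if "x \<in> slots" for x
    by (rule q[of "\<lambda>z. 1 - p \<le> val \<tau> z x"]) (use that in \<open>force simp: tests_def\<close>)
  have le: "val \<tau> z x \<le> val \<tau> z y \<longleftrightarrow> val \<tau> z' x \<le> val \<tau> z' y" if "x \<in> slots" "y \<in> slots" for x y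
    by (rule q[of "\<lambda>z. val \<tau> z x \<le> val \<tau> z y"]) (use that in \<open>force simp: tests_def\<close>)
  have ord: "z (Inr v) \<le> z (Inr w) \<longleftrightarrow> z' (Inr v) \<le> z' (Inr w)" if "v \<in> verts G" "w \<in> verts G" for v w
    by (rule q[of "\<lambda>z. z (Inr v) \<le> z (Inr w)"]) (use that in \<open>force simp: tests_def\<close>)
  have found: "found \<tau> L p z w \<longleftrightarrow> found \<tau> L p z' w" for w
    unfolding found_def using mark hash neighbors_verts by blast
  show "active \<tau> L p z = active \<tau> L p z'"
    unfolding active_def using val found by auto
  have "light_cost \<tau> p z = light_cost \<tau> p z'"
    unfolding light_cost_def using light by (intro sum.cong) auto
  moreover have "scan_cost \<tau> L p z = scan_cost \<tau> L p z'"
  proof -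
    have "{w \<in> neighbors G (va i). z (Inr w) \<le> scan_bound n L p (z (Inl (Mark i)))} =
      {w \<in> neighbors G (va i). z' (Inr w) \<le> scan_bound n L p (z' (Inl (Mark i)))}" if "i \<in> {1..n}" for i
      using hash[OF that] neighbors_verts by blast
    then show ?thesis unfolding scan_cost_def using mark by (intro sum.cong) auto
  qed
  moreover have "heavy_cost \<tau> L p z = heavy_cost \<tau> L p z'"
  proof -
    have "{j \<in> {1..d v}. 1 - p \<le> val \<tau> z (v, j)} = {j \<in> {1..d v}. 1 - p \<le> val \<tau> z' (v, j)}" if "v \<in> verts G" for v
      using val[of "(v, _)"] that by (auto simp: slots_def)
    then show ?thesis unfolding heavy_cost_def found by (intro sum.cong) auto
  qed
  ultimately show "search_cost \<tau> L p z = search_cost \<tau> L p z'" by (simp add: search_cost_def)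
  have "nl z v = nl z' v" for v
    unfolding neighbor_list_def using ord neighbors_verts by (intro sort_key_agree) auto
  then show "edge_at (\<lambda>v. z (Inr v)) = edge_at (\<lambda>v. z' (Inr v))" by (simp add: edge_at_def)
  show "top_entries s A (val \<tau> z) = top_entries s A (val \<tau> z')" if "A \<subseteq> slots"
  proof -
    have "{e' \<in> A. val \<tau> z e \<le> val \<tau> z e'} = {e' \<in> A. val \<tau> z' e \<le> val \<tau> z' e'}" if "e \<in> A" for e
      using le[OF subsetD[OF \<open>A \<subseteq> slots\<close>] subsetD[OF \<open>A \<subseteq> slots\<close>]] that by blast
    then show ?thesis unfolding top_entries_def by (intro Collect_cong conj_cong refl) auto
  qed
qed

lemma measurable_rounds:
  "(\<lambda>z. rounds_output \<tau> L z g) \<in> P \<rightarrow>\<^sub>M count_space UNIV"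
  "(\<lambda>z. rounds_cost \<tau> L z g) \<in> P \<rightarrow>\<^sub>M count_space UNIV"
proof -
  let ?Q = "\<Union>k\<in>{0..g}. tests \<tau> L (1 / 2 ^ k)"
  have agree: "rounds_output \<tau> L z k = rounds_output \<tau> L z' k \<and> rounds_cost \<tau> L z k = rounds_cost \<tau> L z' k"
    if q: "\<And>q. q \<in> ?Q \<Longrightarrow> q z = q z'" and "k \<le> g" for z z' k
    using \<open>k \<le> g\<close>
  proof (induction k)
    case 0
    have "q z = q z'" if "q \<in> tests \<tau> L 1" for q by (rule q) (use that in \<open>auto intro!: bexI[of _ 0]\<close>)
    from tests_agree[of \<tau> L 1 z z', OF this] show ?case by (simp add: active_slots)
  next
    case (Suc k)
    have "q z = q z'" if "q \<in> tests \<tau> L (1 / 2 ^ Suc k)" for q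
      by (rule q) (use that Suc in \<open>auto intro!: bexI[of _ "Suc k"]\<close>)
    from tests_agree[of \<tau> L "1 / 2 ^ Suc k" z z', OF this] Suc show ?case
      by (simp add: active_slots del: power_Suc)
  qed
  have 1: "finite ?Q" by (simp add: finite_tests)
  have 2: "Measurable.pred P q" if "q \<in> ?Q" for q
    using that by (auto intro: measurable_tests)
  show "(\<lambda>z. rounds_output \<tau> L z g) \<in> P \<rightarrow>\<^sub>M count_space UNIV"
  proof (rule measurable_count_space_determined[OF 1 2])
    fix z z' assume "\<And>q. q \<in> ?Q \<Longrightarrow> q z = q z'"
    from agree[OF this order.refl] show "rounds_output \<tau> L z g = rounds_output \<tau> L z' g" by (rule conjunct1)
  qed
  show "(\<lambda>z. rounds_cost \<tau> L z g) \<in> P \<rightarrow>\<^sub>M count_space UNIV"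
  proof (rule measurable_count_space_determined[OF 1 2])
    fix z z' assume "\<And>q. q \<in> ?Q \<Longrightarrow> q z = q z'"
    from agree[OF this order.refl] show "rounds_cost \<tau> L z g = rounds_cost \<tau> L z' g" by (rule conjunct2)
  qed
qed

lemma measurable_stop [measurable]: "Measurable.pred P (\<lambda>z. stop z t)"
proof -
  have [measurable]: "(\<lambda>z. sampled_vertex z t) \<in> P \<rightarrow>\<^sub>M count_space UNIV"
    unfolding sampled_vertex_def by measurable
  have "Measurable.pred P (\<lambda>z. z (Inl (Thr t)) \<le> real (d (va i)) * real t / real n)" for i
    by measurable
  from measurable_compose_countable[of "\<lambda>i z. z (Inl (Thr t)) \<le> real (d (va i)) * real t / real n", OF this, of "\<lambda>z. sampled_vertex z t"]
  show ?thesis unfolding stop_def by simp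
qed

lemma measurable_estimate:
  "stop_time \<in> P \<rightarrow>\<^sub>M count_space UNIV"
  "(\<lambda>z. num_queries (estimate n (coins z) [1..<n]) (orc z)) \<in> P \<rightarrow>\<^sub>M count_space UNIV"
proof -
  have 1: "finite ((\<lambda>t z. stop z t) ` {1..<n})" by simp
  have 2: "Measurable.pred P q" if "q \<in> (\<lambda>t z. stop z t) ` {1..<n}" for q using that by auto
  have 3: "stop z t = stop z' t" if "\<And>q. q \<in> (\<lambda>t z. stop z t) ` {1..<n} \<Longrightarrow> q z = q z'" "t \<in> set [1..<n]" for z z' t
    by (rule that(1)) (use that(2) in auto)
  show "stop_time \<in> P \<rightarrow>\<^sub>M count_space UNIV"
  proof (rule measurable_count_space_determined[OF 1 2])
    fix z z' assume "\<And>q. q \<in> (\<lambda>t z. stop z t) ` {1..<n} \<Longrightarrow> q z = q z'"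
    from estimate_cong[OF 3, OF this] show "stop_time z = stop_time z'" unfolding stop_time_def by (rule conjunct1)
  qed
  show "(\<lambda>z. num_queries (estimate n (coins z) [1..<n]) (orc z)) \<in> P \<rightarrow>\<^sub>M count_space UNIV"
  proof (rule measurable_count_space_determined[OF 1 2])
    fix z z' assume "\<And>q. q \<in> (\<lambda>t z. stop z t) ` {1..<n} \<Longrightarrow> q z = q z'"
    from estimate_cong[OF 3, OF this]
    show "num_queries (estimate n (coins z) [1..<n]) (orc z) = num_queries (estimate n (coins z') [1..<n]) (orc z')" by (rule conjunct2)
  qed
qed

lemma measurable_sample: "sample \<delta> \<in> P \<rightarrow>\<^sub>M count_space UNIV"
  unfolding sample_def[abs_def]
  by (rule measurable_compose_countable[OF measurable_rounds(1) measurable_estimate(1)])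

lemma measurable_cost: "cost \<delta> \<in> P \<rightarrow>\<^sub>M count_space UNIV"
proof -
  have [measurable]: "(\<lambda>z. rounds_cost (light_bound n s (stop_time z)) (mark_rate n \<delta>) z (num_rounds n)) \<in> P \<rightarrow>\<^sub>M count_space UNIV"
    by (rule measurable_compose_countable[OF measurable_rounds(2) measurable_estimate(1)])
  note [measurable] = measurable_estimate(2)
  show ?thesis unfolding cost_def[abs_def] by measurable
qed

end

lemma top_entries_cong: "(\<And>e. e \<in> E \<Longrightarrow> x e = y e) \<Longrightarrow> top_entries s E x = top_entries s E y"
proof -
  assume *: "\<And>e. e \<in> E \<Longrightarrow> x e = y e"
  then have "{e' \<in> E. x e \<le> x e'} = {e' \<in> E. y e \<le> y e'}" if "e \<in> E" for e using that by auto
  then show ?thesis unfolding top_entries_def by (intro Collect_cong conj_cong refl) auto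
qed

text \<open>An entry below \<open>b\<close> has at least \<open>s\<close> entries above it, so its
  rank exceeds \<open>s\<close>; for entries that reach \<open>b\<close>, the ranks in the part and
  in the whole coincide. A round that finds \<open>s\<close> slots can therefore stop with the final
  answer.\<close>

lemma top_entries_upper:
  assumes E: "finite E" and s: "s \<le> card {e \<in> E. b \<le> x e}"
  shows "top_entries s {e \<in> E. b \<le> x e} x = top_entries s E x"
proof (intro equalityI subsetI)
  fix e assume "e \<in> top_entries s {e \<in> E. b \<le> x e} x"
  then have e: "e \<in> E" "b \<le> x e" "card {e' \<in> {e \<in> E. b \<le> x e}. x e \<le> x e'} \<le> s" by (auto simp: top_entries_def)
  moreover have "{e' \<in> {e \<in> E. b \<le> x e}. x e \<le> x e'} = {e' \<in> E. x e \<le> x e'}" using e by auto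
  ultimately show "e \<in> top_entries s E x" by (auto simp: top_entries_def)
next
  fix e assume "e \<in> top_entries s E x"
  then have e: "e \<in> E" "card {e' \<in> E. x e \<le> x e'} \<le> s" by (auto simp: top_entries_def)
  have b: "b \<le> x e"
  proof (rule ccontr)
    assume nb: "\<not> b \<le> x e"
    then have "insert e {e \<in> E. b \<le> x e} \<subseteq> {e' \<in> E. x e \<le> x e'}" using e by auto
    then have "card (insert e {e \<in> E. b \<le> x e}) \<le> card {e' \<in> E. x e \<le> x e'}" using E by (intro card_mono) auto
    then show False using e s nb E by simp
  qed
  moreover have "{e' \<in> {e \<in> E. b \<le> x e}. x e \<le> x e'} = {e' \<in> E. x e \<le> x e'}" using b by auto
  ultimately show "e \<in> top_entries s {e \<in> E. b \<le> x e} x" using e by (auto simp: top_entries_def)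
qed

lemma pred_count_space:
  assumes "f \<in> M \<rightarrow>\<^sub>M count_space UNIV"
  shows "Measurable.pred M (\<lambda>x. Q (f x))"
  using measurable_compose[OF assms, of Q "count_space UNIV"] by simp

context graph_run
begin

subsection \<open>The slot values are independent and uniform\<close>

text \<open>All that the values at \<open>v\<close> can depend on, for any threshold. Light and
  heavy coins are both included, so the independence of different vertices requires no distinction
  by degree.\<close>

definition block :: "nat \<Rightarrow> (coin + nat) set" where
  "block v = insert (Inr v) (range (\<lambda>j. Inl (Light (ix v) j)) \<union> range (\<lambda>j. Inl (Heavy v j)))"

lemma block_sub: "v \<in> verts G \<Longrightarrow> block v \<subseteq> K"
  by (auto simp: block_def)

lemma block_disjoint: "v \<in> verts G \<Longrightarrow> w \<in> verts G \<Longrightarrow> v \<noteq> w \<Longrightarrow> block v \<inter> block w = {}"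
  by (auto simp: block_def) (metis va_ix)+

lemma val_cong:
  assumes "\<And>k. k \<in> block v \<Longrightarrow> z k = z' k"
  shows "val \<tau> z (v, j) = val \<tau> z' (v, j)"
proof -
  have "z (Inr v) = z' (Inr v)" "z (Inl (Light (ix v) j)) = z' (Inl (Light (ix v) j))"
    "(\<lambda>j. z (Inl (Heavy v j))) = (\<lambda>j. z' (Inl (Heavy v j)))"
    using assms by (auto simp: block_def fun_eq_iff)
  then show ?thesis by (simp add: val_def)
qed

lemma measurable_val' [measurable]: "v \<in> verts G \<Longrightarrow> j \<in> {1..d v} \<Longrightarrow> (\<lambda>z. val \<tau> z (v, j)) \<in> borel_measurable P"
  by (rule measurable_val) (auto simp: slots_def)

text \<open>Light slots read distinct coins. At a heavy vertex the coins contribute only their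
  ratios, and their maximum is replaced by a function of the hash value with the same law,
  independent of them.\<close>

lemma emeasure_val_vertex:
  assumes v: "v \<in> verts G" and A: "\<And>j. j \<in> {1..d v} \<Longrightarrow> A j \<in> sets borel"
  shows "emeasure P {z \<in> space P. \<forall>j\<in>{1..d v}. val \<tau> z (v, j) \<in> A j} = (\<Prod>j\<in>{1..d v}. emeasure unit_uniform (A j))"
proof (cases "d v = 0")
  case True
  then show ?thesis by (simp add: prob_space.emeasure_space_1[OF prob_space_unif])
next
  case False
  let ?J = "{1..d v}"
  let ?V = "\<lambda>z. \<lambda>j\<in>?J. val \<tau> z (v, j)"
  have V: "?V \<in> P \<rightarrow>\<^sub>M unif ?J"
    using v by (intro measurable_unifI) auto
  have law: "distr P (unif ?J) ?V = unif ?J"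
  proof (cases "real (d v) \<le> \<tau>")
    case True
    then have "?V = (\<lambda>z. \<lambda>j\<in>?J. z (Inl (Light (ix v) j)))" by (auto simp: val_def fun_eq_iff)
    then show ?thesis
      using distr_unif_reindex[of "\<lambda>j. Inl (Light (ix v) j)" ?J K] by (simp add: inj_on_def)
  next
    case hv: False
    have "?V = (\<lambda>z. \<lambda>j\<in>?J. root (card ?J) (1 - z (Inr v)) * z (Inl (Heavy v j)) / Max ((\<lambda>j. z (Inl (Heavy v j))) ` ?J))"
      using hv by (auto simp: val_def rescaled_def fun_eq_iff)
    then show ?thesis
      using distr_unif_replace_max[of ?J "Inr v" K "\<lambda>j. Inl (Heavy v j)"] v False by (auto simp: inj_on_def image_subset_iff)
  qed
  have "emeasure P {z \<in> space P. \<forall>j\<in>?J. val \<tau> z (v, j) \<in> A j} = emeasure (distr P (unif ?J) ?V) (Pi\<^sub>E ?J A)"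
    using A V by (subst emeasure_distr) (auto intro!: arg_cong2[where f=emeasure] sets_PiM_I_finite simp: PiE_iff)
  then show ?thesis unfolding law using emeasure_unif_PiE[of ?J A] A by simp
qed

text \<open>Vertices are adjoined one at a time; each uses a block disjoint from those of the
  vertices before it, so the probability of a box multiplies.\<close>

lemma distr_val: "distr P (unif slots) (\<lambda>z. \<lambda>x\<in>slots. val \<tau> z x) = unif slots"
proof -
  interpret product_sigma_finite "\<lambda>_. unit_uniform"
    by (simp add: product_sigma_finite_def sigma_finite_unit_uniform)
  have meas: "(\<lambda>z. \<lambda>x\<in>slots. val \<tau> z x) \<in> P \<rightarrow>\<^sub>M unif slots"
    by (intro measurable_unifI) (auto intro: measurable_val)
  show ?thesis
  proof (rule PiM_eqI)
    fix A assume "\<And>i. i \<in> slots \<Longrightarrow> A i \<in> sets unit_uniform"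
    then have A: "A (v, j) \<in> sets borel" if "v \<in> verts G" "j \<in> {1..d v}" for v j
      using that by (auto simp: slots_def)
    have pred: "Measurable.pred P (\<lambda>z. \<forall>j\<in>{1..d v}. val \<tau> z (v, j) \<in> A (v, j))" if "v \<in> verts G" for v
    proof -
      note [measurable] = A[OF that] measurable_val'[OF that]
      show ?thesis by (intro pred_intros_finite) auto
    qed
    have main: "emeasure P {z \<in> space P. \<forall>v\<in>V. \<forall>j\<in>{1..d v}. val \<tau> z (v, j) \<in> A (v, j)} =
        (\<Prod>v\<in>V. \<Prod>j\<in>{1..d v}. emeasure unit_uniform (A (v, j)))" if "finite V" "V \<subseteq> verts G" for V
      using that
    proof (induction V rule: finite_induct)
      case empty
      then show ?case by (simp add: prob_space.emeasure_space_1[OF prob_space_unif])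
    next
      case (insert v V)
      have "emeasure P {z \<in> space P. (\<forall>j\<in>{1..d v}. val \<tau> z (v, j) \<in> A (v, j)) \<and> (\<forall>v\<in>V. \<forall>j\<in>{1..d v}. val \<tau> z (v, j) \<in> A (v, j))} =
        emeasure P {z \<in> space P. \<forall>j\<in>{1..d v}. val \<tau> z (v, j) \<in> A (v, j)} *
        emeasure P {z \<in> space P. \<forall>v\<in>V. \<forall>j\<in>{1..d v}. val \<tau> z (v, j) \<in> A (v, j)}"
      proof (rule emeasure_Int_disjoint_coords)
        show "Measurable.pred P (\<lambda>z. \<forall>j\<in>{1..d v}. val \<tau> z (v, j) \<in> A (v, j))" using insert pred by auto
        show "Measurable.pred P (\<lambda>z. \<forall>v\<in>V. \<forall>j\<in>{1..d v}. val \<tau> z (v, j) \<in> A (v, j))"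
          unfolding pred_def by (rule sets.sets_Collect_finite_All) (use insert pred in \<open>auto simp: pred_def\<close>)
        show "block v \<subseteq> K" "(\<Union>w\<in>V. block w) \<subseteq> K" using insert block_sub by auto
        have "block v \<inter> block w = {}" if "w \<in> V" for w
          using that insert by (intro block_disjoint) auto
        then show "block v \<inter> (\<Union>w\<in>V. block w) = {}" by blast
      next
        fix x y :: "coin + nat \<Rightarrow> real" assume "\<And>i. i \<in> block v \<Longrightarrow> x i = y i"
        from val_cong[of v x y \<tau>, OF this]
        show "(\<forall>j\<in>{1..d v}. val \<tau> x (v, j) \<in> A (v, j)) = (\<forall>j\<in>{1..d v}. val \<tau> y (v, j) \<in> A (v, j))" by simp
      next
        fix x y :: "coin + nat \<Rightarrow> real" assume *: "\<And>i. i \<in> (\<Union>w\<in>V. block w) \<Longrightarrow> x i = y i"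
        have "val \<tau> x (w, j) = val \<tau> y (w, j)" if "w \<in> V" for w j
          by (rule val_cong) (use * that in blast)
        then show "(\<forall>v\<in>V. \<forall>j\<in>{1..d v}. val \<tau> x (v, j) \<in> A (v, j)) = (\<forall>v\<in>V. \<forall>j\<in>{1..d v}. val \<tau> y (v, j) \<in> A (v, j))" by simp
      qed
      then show ?case using insert A emeasure_val_vertex[of v "\<lambda>j. A (v, j)" \<tau>] by simp
    qed
    have "Pi\<^sub>E slots A \<in> sets (unif slots)"
      using A by (intro sets_PiM_I_finite) (auto simp: slots_def)
    then have "emeasure (distr P (unif slots) (\<lambda>z. \<lambda>x\<in>slots. val \<tau> z x)) (Pi\<^sub>E slots A) =
        emeasure P ((\<lambda>z. \<lambda>x\<in>slots. val \<tau> z x) -` Pi\<^sub>E slots A \<inter> space P)"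
      using meas by (subst emeasure_distr) auto
    also have "(\<lambda>z. \<lambda>x\<in>slots. val \<tau> z x) -` Pi\<^sub>E slots A \<inter> space P =
        {z \<in> space P. \<forall>v\<in>verts G. \<forall>j\<in>{1..d v}. val \<tau> z (v, j) \<in> A (v, j)}"
      by (auto simp: slots_def PiE_iff)
    also have "emeasure P \<dots> = (\<Prod>v\<in>verts G. \<Prod>j\<in>{1..d v}. emeasure unit_uniform (A (v, j)))"
      by (rule main) auto
    also have "\<dots> = (\<Prod>i\<in>slots. emeasure unit_uniform (A i))"
      unfolding slots_def by (subst prod.Sigma) auto
    finally show "emeasure (distr P (unif slots) (\<lambda>z. \<lambda>x\<in>slots. val \<tau> z x)) (Pi\<^sub>E slots A) = (\<Prod>i\<in>slots. emeasure unit_uniform (A i))" .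
  qed auto
qed

lemma emeasure_val:
  assumes B: "B \<in> sets (unif slots)"
  shows "emeasure P {z \<in> space P. (\<lambda>x\<in>slots. val \<tau> z x) \<in> B} = emeasure (unif slots) B"
proof -
  have meas: "(\<lambda>z. \<lambda>x\<in>slots. val \<tau> z x) \<in> P \<rightarrow>\<^sub>M unif slots"
    by (intro measurable_unifI) (auto intro: measurable_val)
  have "emeasure (unif slots) B = emeasure (distr P (unif slots) (\<lambda>z. \<lambda>x\<in>slots. val \<tau> z x)) B" by (simp add: distr_val)
  also have "\<dots> = emeasure P {z \<in> space P. (\<lambda>x\<in>slots. val \<tau> z x) \<in> B}"
    using B meas by (subst emeasure_distr) (auto intro!: arg_cong2[where f=emeasure])
  finally show ?thesis ..
qed

subsection \<open>The largest slots give a uniform sample\<close>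

text \<open>The order of the neighbor lists depends on the hash values and hence on the slot values.
  This is harmless, because permuting the coins of the slots of each vertex according to a fixed
  order preserves the joint distribution of the coins and the hash values.\<close>

definition slot_perm :: "(nat \<Rightarrow> real) \<Rightarrow> nat \<times> nat \<Rightarrow> nat \<times> nat" where
  "slot_perm h x = inv_into slots (edge_at (\<lambda>_. 0)) (edge_at h x)"

lemma slot_perm_bij: "bij_betw (slot_perm h) slots slots"
  using bij_betw_trans[OF edge_at_bij[of h] bij_betw_inv_into[OF edge_at_bij[of "\<lambda>_. 0"]]]
  by (simp add: slot_perm_def[abs_def] comp_def)

lemma edge_at_slot_perm: "x \<in> slots \<Longrightarrow> edge_at (\<lambda>_. 0) (slot_perm h x) = edge_at h x"
  using edge_at_bij[of h] edge_at_bij[of "\<lambda>_. 0"] unfolding slot_perm_def bij_betw_def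
  by (intro f_inv_into_f) auto

lemma fst_slot_perm: "x \<in> slots \<Longrightarrow> fst (slot_perm h x) = fst x"
  using edge_at_slot_perm[of x h] by (auto simp: edge_at_def split: prod.splits)

lemma slot_perm_pair: "(v, j) \<in> slots \<Longrightarrow> slot_perm h (v, j) = (v, snd (slot_perm h (v, j)))"
  using fst_slot_perm[of "(v, j)" h] by (metis fst_conv prod.collapse)

lemma slot_perm_in: "(v, j) \<in> slots \<Longrightarrow> (v, snd (slot_perm h (v, j))) \<in> slots"
  using slot_perm_bij[of h] slot_perm_pair[of v j h] by (metis bij_betw_apply)

lemma slot_perm_inj: "(v, j) \<in> slots \<Longrightarrow> (v, k) \<in> slots \<Longrightarrow> snd (slot_perm h (v, j)) = snd (slot_perm h (v, k)) \<Longrightarrow> j = k"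
  using slot_perm_bij[of h] slot_perm_pair[of v j h] slot_perm_pair[of v k h]
  by (metis bij_betw_def inj_onD Pair_inject)

text \<open>Extended by the identity outside the slots, so that the induced map of coins is
  injective on the whole index set and preserves the product measure.\<close>

definition slot_move :: "(nat \<Rightarrow> real) \<Rightarrow> nat \<Rightarrow> nat \<Rightarrow> nat" where
  "slot_move h v j = (if (v, j) \<in> slots then snd (slot_perm h (v, j)) else j)"

lemma slot_move_inj: "slot_move h v j = slot_move h v k \<Longrightarrow> j = k"
  using slot_perm_in[of v j h] slot_perm_in[of v k h] slot_perm_inj[of v j k h]
  by (cases "(v, j) \<in> slots"; cases "(v, k) \<in> slots") (auto simp: slot_move_def)

definition coin_perm :: "(nat \<Rightarrow> real) \<Rightarrow> coin + nat \<Rightarrow> coin + nat" where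
  "coin_perm h k = (case k of
     Inl (Light i j) \<Rightarrow> Inl (Light i (slot_move h (va i) j))
   | Inl (Heavy v j) \<Rightarrow> Inl (Heavy v (slot_move h v j))
   | _ \<Rightarrow> k)"

lemma coin_perm_simps [simp]:
  "coin_perm h (Inr v) = Inr v" "coin_perm h (Inl (Idx t)) = Inl (Idx t)"
  "coin_perm h (Inl (Thr t)) = Inl (Thr t)" "coin_perm h (Inl (Mark t)) = Inl (Mark t)"
  "coin_perm h (Inl (Light i j)) = Inl (Light i (slot_move h (va i) j))"
  "coin_perm h (Inl (Heavy v j)) = Inl (Heavy v (slot_move h v j))"
  by (simp_all add: coin_perm_def)

lemma coin_perm_inj: "inj_on (coin_perm h) K"
proof (rule inj_onI)
  fix k k' assume eq: "coin_perm h k = coin_perm h k'"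
  show "k = k'"
  proof (cases k)
    case (Inl c)
    show ?thesis
    proof (cases k')
      case (Inl c')
      with eq \<open>k = Inl c\<close> show ?thesis
        by (cases c; cases c') (auto dest: slot_move_inj)
    next
      case (Inr v)
      with eq \<open>k = Inl c\<close> show ?thesis by (cases c) auto
    qed
  next
    case (Inr v)
    with eq show ?thesis by (cases k'; cases "projl k'") auto
  qed
qed

lemma coin_perm_K: "coin_perm h \<in> K \<rightarrow> K"
proof
  fix k assume "k \<in> K"
  then show "coin_perm h k \<in> K" by (cases k; cases "projl k") auto
qed

text \<open>The permutation stays within each vertex, so the maximum of the heavy coins of a vertex,
  which normalises \<open>rescaled\<close>, is unchanged.\<close>

lemma val_coin_perm:
  assumes "x \<in> slots"
  shows "val \<tau> (\<lambda>k\<in>K. z (coin_perm h k)) x = val \<tau> z (slot_perm h x)"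
proof -
  obtain v j where x: "x = (v, j)" and v: "v \<in> verts G" and vj: "(v, j) \<in> slots" using assms by (auto simp: slots_def)
  have "(\<lambda>k. snd (slot_perm h (v, k))) ` {1..d v} = {1..d v}"
  proof (rule endo_inj_surj)
    show "(\<lambda>k. snd (slot_perm h (v, k))) ` {1..d v} \<subseteq> {1..d v}"
      using slot_perm_in[of v _ h] v by (fastforce simp: slots_def)
    show "inj_on (\<lambda>k. snd (slot_perm h (v, k))) {1..d v}"
      using slot_perm_inj[of v _ _ h] v by (intro inj_onI) (auto simp: slots_def)
  qed simp
  then have "(\<lambda>k. z (Inl (Heavy v k))) ` {1..d v} = (\<lambda>k. z (Inl (Heavy v (snd (slot_perm h (v, k)))))) ` {1..d v}"
    by (metis (no_types, lifting) image_cong image_image)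
  also have "\<dots> = (\<lambda>k. z (coin_perm h (Inl (Heavy v k)))) ` {1..d v}"
    using v by (intro image_cong) (auto simp: slot_move_def slots_def)
  finally have img: "(\<lambda>k. z (Inl (Heavy v k))) ` {1..d v} = (\<lambda>k. z (coin_perm h (Inl (Heavy v k)))) ` {1..d v}" .
  define k where "k = snd (slot_perm h (v, j))"
  have sp: "slot_perm h x = (v, k)" using slot_perm_pair[OF vj, of h] by (simp only: x k_def)
  have "coin_perm h (Inl (Light (ix v) j)) = Inl (Light (ix v) k)"
    "coin_perm h (Inl (Heavy v j)) = Inl (Heavy v k)" "coin_perm h (Inr v) = Inr v"
    using v vj by (auto simp: slot_move_def k_def)
  then show ?thesis
    unfolding sp unfolding x using v by (simp add: val_def rescaled_def img[symmetric, unfolded One_nat_def] del: coin_perm_simps)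
qed

definition hash_order :: "(coin + nat \<Rightarrow> real) \<Rightarrow> nat \<times> nat \<Rightarrow> nat \<times> nat" where
  "hash_order z = restrict (edge_at (\<lambda>v. z (Inr v))) slots"

definition chosen :: "real \<Rightarrow> (coin + nat \<Rightarrow> real) \<Rightarrow> (nat \<times> nat) set" where
  "chosen \<tau> z = edge_at (\<lambda>v. z (Inr v)) ` top_entries s slots (val \<tau> z)"

lemma measurable_hash_order: "hash_order \<in> P \<rightarrow>\<^sub>M count_space UNIV"
proof (rule measurable_count_space_determined[OF finite_tests])
  fix z z' assume q: "\<And>q. q \<in> tests 0 0 0 \<Longrightarrow> q z = q z'"
  show "hash_order z = hash_order z'"
    using tests_agree(3)[of 0 0 0 z z', OF q] by (simp add: hash_order_def)
qed (rule measurable_tests)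

lemma measurable_chosen: "chosen \<tau> \<in> P \<rightarrow>\<^sub>M count_space UNIV"
proof (rule measurable_count_space_determined[OF finite_tests])
  fix z z' assume q: "\<And>q. q \<in> tests \<tau> 0 0 \<Longrightarrow> q z = q z'"
  show "chosen \<tau> z = chosen \<tau> z'"
    using tests_agree(3)[of \<tau> 0 0 z z', OF q] tests_agree(4)[of \<tau> 0 0 z z', OF q order.refl] by (simp add: chosen_def)
qed (rule measurable_tests)

lemma measurable_top_slots: "(\<lambda>z. top_entries s slots (val \<tau> z)) \<in> P \<rightarrow>\<^sub>M count_space UNIV"
proof (rule measurable_count_space_determined[OF finite_tests])
  fix z z' assume q: "\<And>q. q \<in> tests \<tau> 0 0 \<Longrightarrow> q z = q z'"
  show "top_entries s slots (val \<tau> z) = top_entries s slots (val \<tau> z')"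
    by (rule tests_agree(4)[of \<tau> 0 0 z z', OF q order.refl])
qed (rule measurable_tests)

lemma distr_chosen:
  "distr P (count_space UNIV) (chosen \<tau>) = measure_pmf (pmf_of_set {Y. Y \<subseteq> oriented_edges G \<and> card Y = s})"
proof (rule measure_eqI)
  fix A
  let ?e0 = "edge_at (\<lambda>_. 0)"
  note [measurable] = measurable_hash_order measurable_chosen[of \<tau>] measurable_top_slots[of \<tau>]
  let ?top = "\<lambda>z. top_entries s slots (val \<tau> z)"
  have chosen_A [measurable]: "Measurable.pred P (\<lambda>z. chosen \<tau> z \<in> A)" by (rule pred_count_space) measurable
  have top_A [measurable]: "Measurable.pred P (\<lambda>z. ?e0 ` ?top z \<in> A)"
    by (rule pred_count_space[of ?top P "\<lambda>Y. ?e0 ` Y \<in> A"]) measurable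
  have order_l [measurable]: "Measurable.pred P (\<lambda>z. hash_order z = l)" for l by (rule pred_count_space) measurable
  have top_sub: "top_entries s slots x \<subseteq> slots" for x by (auto simp: top_entries_def)
  \<comment> \<open>The permutation depends on the hash order, so no single map does for all runs
    and the space is split by the order \<open>l\<close>. On each piece the permutation of a
    representative \<open>z0\<close> moves coins but no hash values, and it turns the labels
    belonging to \<open>l\<close> into the fixed labels \<open>?e0\<close>.\<close>
  have step: "emeasure P {z \<in> space P. hash_order z = l \<and> chosen \<tau> z \<in> A} = emeasure P {z \<in> space P. hash_order z = l \<and> ?e0 ` ?top z \<in> A}" for l
  proof (cases "\<exists>z0. l = hash_order z0")
    case False
    then have "hash_order z \<noteq> l" for z by auto
    then show ?thesis by simp
  next
    case True
    then obtain z0 where l: "l = hash_order z0" by auto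
    let ?h = "\<lambda>v. z0 (Inr v)"
    let ?F = "\<lambda>z. \<lambda>k\<in>K. z (coin_perm ?h k)"
    have F: "?F \<in> P \<rightarrow>\<^sub>M P"
      using coin_perm_K[of ?h] by (intro measurable_unifI) (auto intro!: measurable_unif_component)
    have ho: "hash_order (?F z) = hash_order z" for z
    proof -
      have "nl (?F z) v = nl z v" for v
        unfolding neighbor_list_def using neighbors_verts by (intro sort_key_agree) auto
      then show ?thesis by (simp add: hash_order_def edge_at_def)
    qed
    have top: "edge_at ?h ` ?top (?F z) = ?e0 ` ?top z" for z
    proof -
      have "?top (?F z) = top_entries s slots (\<lambda>x\<in>slots. val \<tau> z (slot_perm ?h x))"
        by (intro top_entries_cong) (simp add: val_coin_perm)
      also have "\<dots> = {x \<in> slots. slot_perm ?h x \<in> ?top z}" by (rule top_permute[OF slot_perm_bij])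
      finally have "edge_at ?h ` ?top (?F z) = edge_at ?h ` {x \<in> slots. slot_perm ?h x \<in> ?top z}" by simp
      also have "\<dots> = (\<lambda>x. ?e0 (slot_perm ?h x)) ` {x \<in> slots. slot_perm ?h x \<in> ?top z}"
        by (intro image_cong) (auto simp: edge_at_slot_perm)
      also have "\<dots> = ?e0 ` (slot_perm ?h ` {x \<in> slots. slot_perm ?h x \<in> ?top z})" by (simp add: image_image)
      also have "slot_perm ?h ` {x \<in> slots. slot_perm ?h x \<in> ?top z} = ?top z"
      proof (intro equalityI subsetI)
        fix y assume y: "y \<in> ?top z"
        then have "y \<in> slot_perm ?h ` slots" using slot_perm_bij[of ?h] top_sub by (auto simp: bij_betw_def)
        then obtain x where "x \<in> slots" "y = slot_perm ?h x" by auto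
        with y show "y \<in> slot_perm ?h ` {x \<in> slots. slot_perm ?h x \<in> ?top z}" by blast
      qed auto
      finally show ?thesis .
    qed
    have eq: "chosen \<tau> z = edge_at ?h ` ?top z" if "hash_order z = l" for z
    proof -
      have "edge_at (\<lambda>v. z (Inr v)) x = edge_at ?h x" if "x \<in> slots" for x
        using fun_cong[OF \<open>hash_order z = l\<close>[unfolded l hash_order_def], of x] that by simp
      then show ?thesis unfolding chosen_def using top_sub by (intro image_cong) auto
    qed
    have "emeasure P {z \<in> space P. hash_order z = l \<and> chosen \<tau> z \<in> A} =
        emeasure (distr P P ?F) {z \<in> space P. hash_order z = l \<and> chosen \<tau> z \<in> A}"
      by (simp add: distr_unif_reindex[OF coin_perm_inj coin_perm_K])
    also have "\<dots> = emeasure P {z \<in> space P. hash_order (?F z) = l \<and> chosen \<tau> (?F z) \<in> A}"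
      using F by (subst emeasure_distr) (auto intro!: arg_cong2[where f=emeasure] dest: measurable_space)
    also have "{z \<in> space P. hash_order (?F z) = l \<and> chosen \<tau> (?F z) \<in> A} = {z \<in> space P. hash_order z = l \<and> ?e0 ` ?top z \<in> A}"
      using eq[of "?F _"] ho top by auto
    finally show ?thesis .
  qed
  let ?LL = "Pi\<^sub>E slots (\<lambda>_. oriented_edges G)"
  have LL: "finite ?LL" "hash_order z \<in> ?LL" for z
    using edge_at_bij by (auto simp: finite_PiE hash_order_def bij_betw_def)
  have split: "emeasure P {z \<in> space P. Q z} = (\<Sum>l\<in>?LL. emeasure P {z \<in> space P. hash_order z = l \<and> Q z})"
    if [measurable]: "Measurable.pred P Q" for Q
  proof -
    have "{z \<in> space P. Q z} = (\<Union>l\<in>?LL. {z \<in> space P. hash_order z = l \<and> Q z})" using LL by auto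
    then show ?thesis using LL by (simp only:) (subst sum_emeasure, auto simp: disjoint_family_on_def)
  qed
  have "emeasure (distr P (count_space UNIV) (chosen \<tau>)) A = emeasure P {z \<in> space P. chosen \<tau> z \<in> A}"
    by (subst emeasure_distr) (auto intro!: arg_cong2[where f=emeasure])
  also have "\<dots> = emeasure P {z \<in> space P. ?e0 ` ?top z \<in> A}"
    by (simp only: split[OF chosen_A] split[OF top_A] step)
  also have "\<dots> = emeasure P {z \<in> space P. (\<lambda>x\<in>slots. val \<tau> z x) \<in> {x \<in> space (unif slots). ?e0 ` top_entries s slots x \<in> A}}"
    by (intro arg_cong2[where f=emeasure] refl Collect_cong) (auto simp: space_unif cong: top_entries_cong)
  also have "\<dots> = emeasure (unif slots) {x \<in> space (unif slots). ?e0 ` top_entries s slots x \<in> A}"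
    using measurable_sets[OF measurable_top[OF finite_slots, of s], of "(`) ?e0 -` A"]
    by (intro emeasure_val) (simp add: vimage_def Int_def conj_commute)
  also have "\<dots> = emeasure (distr (unif slots) (count_space UNIV) (top_entries s slots)) ((`) ?e0 -` A)"
    using measurable_top[OF finite_slots, of s] by (subst emeasure_distr) (auto intro!: arg_cong2[where f=emeasure])
  also have "\<dots> = emeasure (measure_pmf (map_pmf ((`) ?e0) (pmf_of_set {Y. Y \<subseteq> slots \<and> card Y = s}))) A"
    using s_le card_slots by (simp add: distr_top_unif)
  also have "map_pmf ((`) ?e0) (pmf_of_set {Y. Y \<subseteq> slots \<and> card Y = s}) = pmf_of_set ((`) ?e0 ` {Y. Y \<subseteq> slots \<and> card Y = s})"
  proof (rule map_pmf_of_set_inj)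
    show "inj_on ((`) ?e0) {Y. Y \<subseteq> slots \<and> card Y = s}"
      using edge_at_bij[of "\<lambda>_. 0"] by (auto simp: bij_betw_def intro!: inj_onI dest: inj_on_image_eq_iff[THEN iffD1, rotated -1])
    show "{Y. Y \<subseteq> slots \<and> card Y = s} \<noteq> {}"
      using obtain_subset_with_card_n[of s slots] s_le card_slots by auto
    show "finite {Y. Y \<subseteq> slots \<and> card Y = s}" by simp
  qed
  also have "(`) ?e0 ` {Y. Y \<subseteq> slots \<and> card Y = s} = {Y. Y \<subseteq> oriented_edges G \<and> card Y = s}"
  proof (intro equalityI subsetI)
    fix Y assume "Y \<in> (`) ?e0 ` {Y. Y \<subseteq> slots \<and> card Y = s}"
    then obtain X where "X \<subseteq> slots" "card X = s" "Y = ?e0 ` X" by auto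
    with edge_at_bij[of "\<lambda>_. 0"] show "Y \<in> {Y. Y \<subseteq> oriented_edges G \<and> card Y = s}"
      by (auto simp: bij_betw_def card_image inj_on_subset)
  next
    fix Y assume Y: "Y \<in> {Y. Y \<subseteq> oriented_edges G \<and> card Y = s}"
    then have "Y \<subseteq> ?e0 ` slots" using edge_at_bij[of "\<lambda>_. 0"] by (auto simp: bij_betw_def)
    then obtain X where X: "X \<subseteq> slots" "Y = ?e0 ` X" by (meson subset_imageE)
    with Y edge_at_bij[of "\<lambda>_. 0"] have "card X = s" by (auto simp: bij_betw_def card_image inj_on_subset)
    with X show "Y \<in> (`) ?e0 ` {Y. Y \<subseteq> slots \<and> card Y = s}" by blast
  qed
  finally show "emeasure (distr P (count_space UNIV) (chosen \<tau>)) A =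
    emeasure (measure_pmf (pmf_of_set {Y. Y \<subseteq> oriented_edges G \<and> card Y = s})) A" .
qed simp

end

subsection \<open>Runs as points of a single product space\<close>

definition enc :: "(nat \<Rightarrow> real) \<times> (nat \<Rightarrow> real) \<Rightarrow> coin + nat \<Rightarrow> real" where
  "enc x k = (case k of Inl c \<Rightarrow> fst x (to_nat c) | Inr v \<Rightarrow> snd x v)"

lemma product_prob_space_unit_uniform: "product_prob_space (\<lambda>_. unit_uniform)"
  by (simp add: product_prob_space_def product_prob_space_axioms_def product_sigma_finite_def
    prob_space_unit_uniform sigma_finite_unit_uniform)

lemma sets_unif_Collect:
  assumes "J \<subseteq> I" "finite J" "\<And>i. i \<in> J \<Longrightarrow> A i \<in> sets borel"
  shows "{x \<in> space (unif I). \<forall>i\<in>J. x i \<in> A i} \<in> sets (unif I)"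
proof (rule sets.sets_Collect_finite_All)
  fix i assume "i \<in> J"
  then have "(\<lambda>x. x i) -` A i \<inter> space (unif I) \<in> sets (unif I)"
    using assms by (intro measurable_sets[OF measurable_unif_component]) auto
  then show "{x \<in> space (unif I). x i \<in> A i} \<in> sets (unif I)"
    by (simp add: vimage_def Int_def conj_commute)
qed fact

lemma emeasure_unif_Collect:
  assumes "J \<subseteq> I" "finite J" "\<And>i. i \<in> J \<Longrightarrow> A i \<in> sets borel"
  shows "emeasure (unif I) {x \<in> space (unif I). \<forall>i\<in>J. x i \<in> A i} = (\<Prod>i\<in>J. emeasure unit_uniform (A i))"
  using product_prob_space.emeasure_PiM_Collect[OF product_prob_space_unit_uniform, of J I A] assms by simp

context graph_run
begin

lemma measurable_enc: "enc \<in> run_space G \<rightarrow>\<^sub>M P"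
proof (rule measurable_unifI)
  fix k assume k: "k \<in> K"
  show "(\<lambda>x. enc x k) \<in> borel_measurable (run_space G)"
  proof (cases k)
    case (Inl c)
    have "(\<lambda>x. fst x (to_nat c)) \<in> borel_measurable (run_space G)"
      unfolding run_space_def coin_space_def hash_space_def
      by (rule measurable_compose[OF measurable_fst measurable_unif_component]) simp
    then show ?thesis using Inl by (simp add: enc_def)
  next
    case (Inr v)
    then have "(\<lambda>x. snd x v) \<in> borel_measurable (run_space G)"
      unfolding run_space_def coin_space_def hash_space_def using k
      by (intro measurable_compose[OF measurable_snd measurable_unif_component]) simp
    then show ?thesis using Inr by (simp add: enc_def)
  qed
next
  fix x assume "x \<in> space (run_space G)"
  then show "enc x \<in> extensional K"
    by (auto simp: run_space_def hash_space_def space_pair_measure space_PiM enc_def extensional_def PiE_iff split: sum.splits)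
qed

text \<open>Distinct coins are distinct entries of the coin sequence because \<open>to_nat\<close>
  is injective; finite-dimensional boxes do not see the other entries, and they determine the
  product measure.\<close>

lemma distr_run_space: "distr (run_space G) P enc = P"
proof (rule product_prob_space.PiM_eq[OF product_prob_space_unit_uniform])
  fix J F assume J: "finite J" "J \<subseteq> K" and F': "\<And>j. j \<in> J \<Longrightarrow> F j \<in> sets unit_uniform"
  then have F: "F j \<in> sets borel" if "j \<in> J" for j using that by auto
  define J1 where "J1 = {c. Inl c \<in> J}"
  define J2 where "J2 = {v. Inr v \<in> J}"
  have fin: "finite J1" "finite J2"
    using finite_vimageI[OF J(1), of Inl] finite_vimageI[OF J(1), of Inr]
    by (simp_all add: J1_def J2_def vimage_def)
  have JJ: "J = Inl ` J1 \<union> Inr ` J2" unfolding J1_def J2_def by (rule set_eqI) (case_tac x, auto)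
  have J2: "J2 \<subseteq> verts G" using J by (auto simp: J2_def)
  let ?B1 = "{c \<in> space coin_space. \<forall>i\<in>to_nat ` J1. c i \<in> F (Inl (from_nat i))}"
  let ?B2 = "{h \<in> space (hash_space G). \<forall>v\<in>J2. h v \<in> F (Inr v)}"
  have e1: "emeasure coin_space ?B1 = (\<Prod>c\<in>J1. emeasure unit_uniform (F (Inl c)))"
  proof -
    have "emeasure coin_space ?B1 = (\<Prod>i\<in>to_nat ` J1. emeasure unit_uniform (F (Inl (from_nat i))))"
      unfolding coin_space_def using fin F by (intro emeasure_unif_Collect) (auto simp: J1_def)
    also have "\<dots> = (\<Prod>c\<in>J1. emeasure unit_uniform (F (Inl c)))"
      by (subst prod.reindex) (auto simp: inj_on_def)
    finally show ?thesis .
  qed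
  have e2: "emeasure (hash_space G) ?B2 = (\<Prod>v\<in>J2. emeasure unit_uniform (F (Inr v)))"
    unfolding hash_space_def using fin F J2 by (intro emeasure_unif_Collect) (auto simp: J2_def)
  have m: "?B1 \<in> sets coin_space" "?B2 \<in> sets (hash_space G)"
    unfolding coin_space_def hash_space_def using fin F J2
    by (intro sets_unif_Collect; auto simp: J1_def J2_def)+
  have sp: "space (run_space G) = space coin_space \<times> space (hash_space G)"
    by (simp add: run_space_def space_pair_measure)
  have pre: "enc -` prod_emb K (\<lambda>_. unit_uniform) J (Pi\<^sub>E J F) \<inter> space (run_space G) = ?B1 \<times> ?B2"
  proof -
    have "enc x \<in> prod_emb K (\<lambda>_. unit_uniform) J (Pi\<^sub>E J F) \<longleftrightarrow> (\<forall>j\<in>J. enc x j \<in> F j)" if "x \<in> space (run_space G)" for x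
      using measurable_space[OF measurable_enc that] by (auto simp: prod_emb_def space_PiM PiE_iff)
    then have "enc -` prod_emb K (\<lambda>_. unit_uniform) J (Pi\<^sub>E J F) \<inter> space (run_space G) = {x \<in> space (run_space G). \<forall>j\<in>J. enc x j \<in> F j}" by auto
    also have "\<dots> = ?B1 \<times> ?B2" unfolding sp JJ by (auto simp: enc_def ball_Un)
    finally show ?thesis .
  qed
  have "prod_emb K (\<lambda>_. unit_uniform) J (Pi\<^sub>E J F) \<in> sets P"
    using J F by (intro sets_PiM_I) auto
  then have "emeasure (distr (run_space G) P enc) (prod_emb K (\<lambda>_. unit_uniform) J (Pi\<^sub>E J F)) = emeasure (run_space G) (?B1 \<times> ?B2)"
    by (subst emeasure_distr[OF measurable_enc]) (simp_all add: pre)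
  also have "\<dots> = emeasure coin_space ?B1 * emeasure (hash_space G) ?B2"
    unfolding run_space_def
  proof (rule sigma_finite_measure.emeasure_pair_measure_Times[OF _ m])
    show "sigma_finite_measure (hash_space G)"
      unfolding hash_space_def by (rule prob_space_imp_sigma_finite[OF prob_space_unif])
  qed
  also have "\<dots> = (\<Prod>j\<in>J. emeasure unit_uniform (F j))"
    unfolding e1 e2 JJ using fin by (subst prod.union_disjoint) (auto simp: prod.reindex)
  finally show "emeasure (distr (run_space G) P enc) (prod_emb K (\<lambda>_. unit_uniform) J (Pi\<^sub>E J F)) = (\<Prod>j\<in>J. emeasure unit_uniform (F j))" .
qed simp

lemma enc_Inl: "coins (enc x) = (\<lambda>k. fst x (to_nat k))" and enc_Inr: "(\<lambda>v. enc x (Inr v)) = snd x"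
  by (simp_all add: enc_def)

lemma alg_output_enc: "alg_output (edge_sampler_alg n s \<delta>) G x = sample \<delta> (enc x)"
  unfolding edge_sampler(1)[symmetric] enc_Inl enc_Inr alg_output_def edge_sampler_alg_def case_prod_beta ..

lemma alg_cost_enc: "alg_cost (edge_sampler_alg n s \<delta>) G x = cost \<delta> (enc x)"
  unfolding edge_sampler(2)[symmetric] enc_Inl enc_Inr alg_cost_def edge_sampler_alg_def case_prod_beta ..

lemma alg_measurable_edge_sampler: "alg_measurable (edge_sampler_alg n s \<delta>) G"
  unfolding alg_measurable_def alg_output_enc[abs_def] alg_cost_enc[abs_def]
  using measurable_compose[OF measurable_enc measurable_sample[of \<delta>]] measurable_compose[OF measurable_enc measurable_cost[of \<delta>]] by simp

subsection \<open>Every heavy vertex has a marked neighbor\<close>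

text \<open>Demanded of every vertex of positive degree and not only of heavy ones, so that the
  event does not involve \<open>\<tau>\<close>. It concerns marks only, and conditioning on it
  leaves slot values and stopping time untouched.\<close>

definition hit :: "real \<Rightarrow> (coin + nat \<Rightarrow> real) \<Rightarrow> bool" where
  "hit L z \<longleftrightarrow> (\<forall>w\<in>verts G. 1 \<le> d w \<longrightarrow> (\<exists>i\<in>{1..n}. w \<in> neighbors G (va i) \<and> z (Inl (Mark i)) \<le> L / real (d w)))"

lemma measurable_hit [measurable]: "Measurable.pred P (hit L)"
  unfolding hit_def[abs_def] by measurable

lemma hit_cong: "(\<And>i. z (Inl (Mark i)) = z' (Inl (Mark i))) \<Longrightarrow> hit L z = hit L z'"
  by (simp add: hit_def)

text \<open>The marks of the \<open>d w\<close> neighbors of \<open>w\<close> are independent, so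
  all of them exceed \<open>L / d w\<close> with probability at most
  \<open>(1 - L / d w) ^ d w \<le> exp (- L)\<close>, or 0 if \<open>L / d w\<close> is above 1. A
  union bound over the vertices finishes the estimate.\<close>

lemma emeasure_not_hit:
  assumes L: "0 \<le> L"
  shows "emeasure P {z \<in> space P. \<not> hit L z} \<le> ennreal (real n * exp (- L))"
proof -
  let ?W = "{w \<in> verts G. 1 \<le> d w}"
  let ?I = "\<lambda>w. {i \<in> {1..n}. w \<in> neighbors G (va i)}"
  let ?B = "\<lambda>w. {z \<in> space P. \<forall>k\<in>(\<lambda>i. Inl (Mark i)) ` ?I w. z k \<in> {L / real (d w)<..}}"
  have B: "emeasure P (?B w) \<le> ennreal (exp (- L))" if w: "w \<in> ?W" for w
  proof -
    have dw: "0 < d w" using w by simp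
    have "va ` ?I w = neighbors G w"
    proof (intro equalityI subsetI)
      fix u assume u: "u \<in> neighbors G w"
      then have "u = va (ix u)" "ix u \<in> ?I w" using neighbors_verts[of u w] neighbors_sym[of u w] ix_in by auto
      then show "u \<in> va ` ?I w" by blast
    qed (auto simp: neighbors_sym[of w])
    moreover have "inj_on va (?I w)" using va_bij by (auto simp: bij_betw_def intro: inj_on_subset)
    ultimately have card: "card (?I w) = d w" by (metis card_image deg_def)
    have "emeasure P (?B w) = (\<Prod>k\<in>(\<lambda>i. Inl (Mark i) :: coin + nat) ` ?I w. emeasure unit_uniform {L / real (d w)<..})"
      by (rule emeasure_unif_Collect[where A="\<lambda>_. {L / real (d w)<..}"]) auto
    also have "\<dots> = ennreal (1 - min 1 (L / real (d w))) ^ d w"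
      using L card by (subst prod.reindex) (simp_all add: inj_on_def emeasure_unit_uniform_greaterThan)
    also have "\<dots> = ennreal ((1 - min 1 (L / real (d w))) ^ d w)"
      by (rule ennreal_power) auto
    also have "\<dots> \<le> ennreal (exp (- L))"
    proof (rule ennreal_leI, cases "L / real (d w) \<le> 1")
      case True
      then have "(1 - min 1 (L / real (d w))) ^ d w \<le> exp (- (L / real (d w))) ^ d w"
        using exp_ge_add_one_self[of "- (L / real (d w))"] by (intro power_mono) auto
      also have "\<dots> = exp (- L)" using dw by (simp flip: exp_of_nat_mult)
      finally show "(1 - min 1 (L / real (d w))) ^ d w \<le> exp (- L)" .
    next
      case False
      then show "(1 - min 1 (L / real (d w))) ^ d w \<le> exp (- L)" using dw by (simp add: power_0_left)
    qed
    finally show ?thesis .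
  qed
  have meas: "?B w \<in> sets P" for w
  proof (rule sets.sets_Collect_finite_All)
    fix k :: "coin + nat" assume "k \<in> (\<lambda>i. Inl (Mark i)) ` ?I w"
    then obtain i where "k = Inl (Mark i)" by auto
    then show "{z \<in> space P. z k \<in> {L / real (d w)<..}} \<in> sets P" by simp
  qed auto
  have "{z \<in> space P. \<not> hit L z} \<subseteq> (\<Union>w\<in>?W. ?B w)" by (auto simp: hit_def not_le)
  then have "emeasure P {z \<in> space P. \<not> hit L z} \<le> emeasure P (\<Union>w\<in>?W. ?B w)"
    using meas by (intro emeasure_mono) auto
  also have "\<dots> \<le> (\<Sum>w\<in>?W. emeasure P (?B w))"
    using meas by (intro emeasure_subadditive_finite) auto
  also have "\<dots> \<le> (\<Sum>w\<in>?W. ennreal (exp (- L)))" using B by (intro sum_mono) auto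
  also have "\<dots> \<le> ennreal (real n * exp (- L))"
  proof -
    have "card ?W \<le> n" unfolding card_verts[symmetric] by (intro card_mono) auto
    then show ?thesis by (auto simp: ennreal_of_nat_eq_real_of_nat simp flip: ennreal_mult intro!: ennreal_leI mult_right_mono)
  qed
  finally show ?thesis .
qed

section \<open>Exactness of the output on the hit event\<close>

definition regular :: "(coin + nat \<Rightarrow> real) \<Rightarrow> bool" where
  "regular z \<longleftrightarrow> (\<forall>k\<in>K. 0 < z k \<and> z k < 1)"

lemma AE_regular: "AE z in P. regular z"
  unfolding regular_def by (rule AE_unif) simp

lemma regularD: "regular z \<Longrightarrow> 0 < z (Inl k)" "regular z \<Longrightarrow> z (Inl k) < 1"
  "regular z \<Longrightarrow> v \<in> verts G \<Longrightarrow> 0 < z (Inr v)" "regular z \<Longrightarrow> v \<in> verts G \<Longrightarrow> z (Inr v) < 1"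
  by (auto simp: regular_def)

lemma rescaled_bounds:
  assumes z: "regular z" and v: "v \<in> verts G" and j: "j \<in> {1..d v}"
  shows "0 \<le> rescaled (d v) (z (Inr v)) (\<lambda>j. z (Inl (Heavy v j))) j"
    and "rescaled (d v) (z (Inr v)) (\<lambda>j. z (Inl (Heavy v j))) j \<le> root (d v) (1 - z (Inr v))"
proof -
  let ?W = "\<lambda>j. z (Inl (Heavy v j))"
  let ?M = "Max (?W ` {1..d v})"
  have Wj: "0 < ?W j" "?W j \<le> ?M" using z j by (auto simp: regularD)
  then have M: "0 < ?M" by linarith
  have r: "0 \<le> root (d v) (1 - z (Inr v))" using regularD(4)[OF z v] by (simp add: real_root_ge_zero)
  show "0 \<le> rescaled (d v) (z (Inr v)) ?W j"
    unfolding rescaled_def using Wj M r by simp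
  have "root (d v) (1 - z (Inr v)) * (?W j / ?M) \<le> root (d v) (1 - z (Inr v)) * 1"
    using Wj M r by (intro mult_left_mono) auto
  then show "rescaled (d v) (z (Inr v)) ?W j \<le> root (d v) (1 - z (Inr v))"
    by (simp add: rescaled_def)
qed

lemma val_nonneg: "regular z \<Longrightarrow> x \<in> slots \<Longrightarrow> 0 \<le> val \<tau> z x"
  using rescaled_bounds(1)[of z "fst x" "snd x"] by (auto simp: val_def slots_def regularD less_imp_le)

lemma active_eq:
  assumes z: "regular z" and hit: "hit L z" and \<tau>: "0 < \<tau>" and L: "1 \<le> L" and p: "0 \<le> p" "p \<le> 1"
  shows "active \<tau> L p z = {x \<in> slots. 1 - p \<le> val \<tau> z x}"
proof -
  have "found \<tau> L p z v" if x: "(v, j) \<in> slots" "1 - p \<le> val \<tau> z (v, j)" and hv: "\<not> real (d v) \<le> \<tau>" for v j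
  proof -
    have v: "v \<in> verts G" and j: "j \<in> {1..d v}" using x by (auto simp: slots_def)
    then have dv: "1 \<le> d v" by auto
    then obtain i where i: "i \<in> {1..n}" "v \<in> neighbors G (va i)" and y: "z (Inl (Mark i)) \<le> L / real (d v)"
      using hit v unfolding hit_def by blast
    let ?y = "z (Inl (Mark i))"
    have y0: "0 < ?y" using z by (rule regularD)
    have "?y \<le> L / \<tau>" using y hv \<tau> L by (meson divide_left_mono less_imp_le mult_pos_pos not_le order_trans zero_le_one le_less_trans)
    moreover have "z (Inr v) \<le> scan_bound n L p ?y"
    proof -
      have "1 - p \<le> root (d v) (1 - z (Inr v))"
        using x(2) hv rescaled_bounds(2)[OF z v j] by (simp add: val_def)
      then have "(1 - p) ^ d v \<le> root (d v) (1 - z (Inr v)) ^ d v" using p by (intro power_mono) auto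
      also have "\<dots> = 1 - z (Inr v)" using dv regularD(4)[OF z v] by (intro real_root_pow_pos2) auto
      finally have "z (Inr v) \<le> 1 - (1 - p) ^ d v" by simp
      also have "\<dots> \<le> p * real (d v)" using Bernoulli_inequality[of "- p" "d v"] p by (simp add: algebra_simps)
      also have "\<dots> \<le> p * (L * min (real n) (1 / ?y))"
      proof (rule mult_left_mono)
        \<comment> \<open>Here the cap in \<open>scan_bound\<close> is seen to cut off
          nothing.\<close>
        have "real (d v) \<le> 1 * real n" using deg_le[OF v] by simp
        also have "\<dots> \<le> L * real n" using L by (intro mult_right_mono) auto
        finally have 1: "real (d v) \<le> L * real n" .
        have "real (d v) * ?y \<le> L" using y dv by (simp add: field_simps)
        then have "real (d v) \<le> L * (1 / ?y)" using y0 by (simp add: field_simps)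
        with 1 show "real (d v) \<le> L * min (real n) (1 / ?y)" by (simp add: min_def)
      qed (rule p)
      finally show ?thesis by (simp add: scan_bound_def mult.assoc)
    qed
    ultimately show ?thesis unfolding found_def using i by blast
  qed
  then have "x \<in> active \<tau> L p z \<longleftrightarrow> x \<in> {x \<in> slots. 1 - p \<le> val \<tau> z x}" for x
    by (cases x) (auto simp: active_def)
  then show ?thesis by blast
qed

text \<open>Whichever round ends the search, its active slots are all slots above some level, and
  either there are at least \<open>s\<close> of them or the level is 0. Their top entries are then
  the global ones, so stopping early introduces no bias.\<close>

lemma rounds_output_eq:
  assumes z: "regular z" and hit: "hit L z" and \<tau>: "0 < \<tau>" and L: "1 \<le> L"
  shows "rounds_output \<tau> L z g = chosen \<tau> z"
proof (induction g)
  case 0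
  have "active \<tau> L 1 z = slots"
    using active_eq[OF assms, of 1] val_nonneg[OF z] by auto
  then show ?case by (simp add: chosen_def)
next
  case (Suc g)
  let ?p = "1 / 2 ^ Suc g :: real"
  have a: "active \<tau> L ?p z = {x \<in> slots. 1 - ?p \<le> val \<tau> z x}"
    by (rule active_eq[OF assms]) (simp_all add: one_le_power del: power_Suc)
  show ?case
  proof (cases "s \<le> card (active \<tau> L ?p z)")
    case True
    then have "top_entries s (active \<tau> L ?p z) (val \<tau> z) = top_entries s slots (val \<tau> z)"
      unfolding a by (intro top_entries_upper) auto
    with True show ?thesis by (simp add: chosen_def del: power_Suc)
  qed (simp add: Suc del: power_Suc)
qed

lemma light_bound_pos: "1 \<le> t \<Longrightarrow> 0 < light_bound n s t"
  using n_ge_2 s_pos by (simp add: light_bound_def)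

lemma mark_rate_ge_1:
  assumes "0 < \<delta>" "\<delta> < 1"
  shows "1 \<le> mark_rate n \<delta>"
proof -
  have "2 * \<delta> \<le> 2" using assms by simp
  also have "\<dots> \<le> real n" using n_ge_2 by simp
  finally have "2 \<le> real n / \<delta>" using assms by (simp add: field_simps)
  then have "ln 2 \<le> ln (real n / \<delta>)" by simp
  then show ?thesis using ln2_ge_two_thirds by (simp add: mark_rate_def)
qed

lemma exp_mark_rate:
  assumes "0 < \<delta>" "\<delta> < 1"
  shows "exp (- mark_rate n \<delta>) = (\<delta> / real n) ^ 4"
proof -
  have "exp (- mark_rate n \<delta>) = exp (- ln (real n / \<delta>)) ^ 4"
    by (simp add: mark_rate_def flip: exp_of_nat_mult)
  also have "exp (- ln (real n / \<delta>)) = \<delta> / real n"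
    using assms n_ge_2 by (simp add: exp_minus)
  finally show ?thesis .
qed

lemma emeasure_not_hit_mark_rate:
  assumes "0 < \<delta>" "\<delta> < 1"
  shows "emeasure P {z \<in> space P. \<not> hit (mark_rate n \<delta>) z} \<le> ennreal (\<delta> / real n ^ 3)"
proof -
  have "emeasure P {z \<in> space P. \<not> hit (mark_rate n \<delta>) z} \<le> ennreal (real n * (\<delta> / real n) ^ 4)"
    using emeasure_not_hit[of "mark_rate n \<delta>"] mark_rate_ge_1[OF assms] by (simp add: exp_mark_rate[OF assms])
  also have "\<dots> \<le> ennreal (\<delta> / real n ^ 3)"
  proof (rule ennreal_leI)
    have "\<delta> ^ 4 \<le> \<delta> ^ 1" using assms by (intro power_decreasing) auto
    then show "real n * (\<delta> / real n) ^ 4 \<le> \<delta> / real n ^ 3"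
      using n_ge_2 by (simp add: power_divide field_simps power4_eq_xxxx power3_eq_cube)
  qed
  finally show ?thesis .
qed

lemma prob_hit:
  assumes "0 < \<delta>" "\<delta> < 1"
  shows "1 - \<delta> \<le> measure P {z \<in> space P. hit (mark_rate n \<delta>) z}"
proof -
  interpret prob_space P by (rule prob_space_unif)
  have "{z \<in> space P. hit (mark_rate n \<delta>) z} = space P - {z \<in> space P. \<not> hit (mark_rate n \<delta>) z}" by auto
  then have "prob {z \<in> space P. hit (mark_rate n \<delta>) z} = 1 - prob {z \<in> space P. \<not> hit (mark_rate n \<delta>) z}"
    by (simp only:) (subst prob_compl, auto)
  moreover have "prob {z \<in> space P. \<not> hit (mark_rate n \<delta>) z} \<le> \<delta> / real n ^ 3"
    using emeasure_not_hit_mark_rate[OF assms] assms by (simp add: emeasure_eq_measure)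
  moreover have "\<delta> / real n ^ 3 \<le> \<delta>"
    using assms n_ge_2 by (intro divide_le_eq[THEN iffD2]) (auto intro!: mult_le_cancel_left1[THEN iffD2])
  ultimately show ?thesis by linarith
qed

lemma stop_time_cong:
  assumes "\<And>t. z (Inl (Idx t)) = z' (Inl (Idx t)) \<and> z (Inl (Thr t)) = z' (Inl (Thr t))"
  shows "stop_time z = stop_time z'"
  unfolding stop_time_def using assms
  by (intro conjunct1[OF estimate_cong]) (simp add: stop_def sampled_vertex_def)

lemma chosen_cong:
  assumes "\<And>k. k \<in> (\<Union>v\<in>verts G. block v) \<Longrightarrow> z k = z' k"
  shows "chosen \<tau> z = chosen \<tau> z'"
proof -
  have h: "z (Inr v) = z' (Inr v)" if "v \<in> verts G" for v
    using assms that by (auto simp: block_def)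
  have "nl z v = nl z' v" for v
    unfolding neighbor_list_def using neighbors_verts h by (intro sort_key_agree) auto
  moreover have "val \<tau> z x = val \<tau> z' x" if "x \<in> slots" for x
  proof -
    obtain v j where x: "x = (v, j)" "v \<in> verts G" using \<open>x \<in> slots\<close> by (auto simp: slots_def)
    show ?thesis unfolding x(1) by (rule val_cong) (use assms x in blast)
  qed
  then have "top_entries s slots (val \<tau> z) = top_entries s slots (val \<tau> z')" by (rule top_entries_cong)
  ultimately show ?thesis by (simp add: chosen_def edge_at_def)
qed

text \<open>Given \<open>stop_time z = t\<close>, the threshold is fixed and disjoint groups of
  coordinates govern the hit event, the stopping time and the chosen set. Since the law of
  \<open>chosen \<tau>\<close> is the same for every \<open>\<tau>\<close>, it can be taken out of
  the sum over \<open>t\<close>.\<close>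

lemma emeasure_sample:
  assumes \<delta>: "0 < \<delta>" "\<delta> < 1"
  shows "emeasure P {z \<in> space P. hit (mark_rate n \<delta>) z \<and> sample \<delta> z \<in> A} =
    emeasure P {z \<in> space P. hit (mark_rate n \<delta>) z} * emeasure (measure_pmf (pmf_of_set {Y. Y \<subseteq> oriented_edges G \<and> card Y = s})) A"
proof -
  interpret prob_space P by (rule prob_space_unif)
  let ?L = "mark_rate n \<delta>"
  let ?\<mu> = "emeasure (measure_pmf (pmf_of_set {Y. Y \<subseteq> oriented_edges G \<and> card Y = s})) A"
  let ?T = "{k. \<exists>t. k = Inl (Idx t) \<or> k = Inl (Thr t)} :: (coin + nat) set"
  let ?M = "{k. \<exists>t. k = Inl (Mark t)} :: (coin + nat) set"
  let ?B = "\<Union>v\<in>verts G. block v"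
  have T_pred [measurable]: "Measurable.pred P (\<lambda>z. stop_time z = t)" for t
    by (rule pred_count_space[OF measurable_estimate(1)])
  have c_pred [measurable]: "Measurable.pred P (\<lambda>z. chosen \<tau> z \<in> A)" for \<tau>
    by (rule pred_count_space[OF measurable_chosen])
  have s_pred [measurable]: "Measurable.pred P (\<lambda>z. sample \<delta> z \<in> A)"
    by (rule pred_count_space[OF measurable_sample])
  have c_meas: "emeasure P {z \<in> space P. chosen \<tau> z \<in> A} = ?\<mu>" for \<tau>
    unfolding distr_chosen[of \<tau>, symmetric] using measurable_chosen[of \<tau>]
    by (subst emeasure_distr) (auto intro!: arg_cong2[where f=emeasure])
  have one: "emeasure P {z \<in> space P. hit ?L z \<and> stop_time z = t \<and> sample \<delta> z \<in> A} =
      emeasure P {z \<in> space P. hit ?L z} * ?\<mu> * emeasure P {z \<in> space P. stop_time z = t}" if t: "t \<in> {1..n}" for t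
  proof -
    let ?c = "chosen (light_bound n s t)"
    have "emeasure P {z \<in> space P. hit ?L z \<and> stop_time z = t \<and> sample \<delta> z \<in> A} = emeasure P {z \<in> space P. (hit ?L z \<and> stop_time z = t) \<and> ?c z \<in> A}"
    proof (rule emeasure_eq_AE)
      show "AE z in P. (z \<in> {z \<in> space P. hit ?L z \<and> stop_time z = t \<and> sample \<delta> z \<in> A}) = (z \<in> {z \<in> space P. (hit ?L z \<and> stop_time z = t) \<and> ?c z \<in> A})"
        using AE_regular
      proof eventually_elim
        case (elim z)
        have "sample \<delta> z = ?c z" if "hit ?L z" "stop_time z = t"
          unfolding sample_def that(2) using t \<delta>
          by (intro rounds_output_eq[OF elim that(1)]) (auto intro: light_bound_pos mark_rate_ge_1)
        then show ?case by auto
      qed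
    qed measurable
    also have "\<dots> = emeasure P {z \<in> space P. hit ?L z \<and> stop_time z = t} * emeasure P {z \<in> space P. ?c z \<in> A}"
    proof (rule emeasure_Int_disjoint_coords)
      show "?T \<union> ?M \<subseteq> K" "?B \<subseteq> K" "(?T \<union> ?M) \<inter> ?B = {}"
        using block_sub by (auto simp: block_def)
      fix x y :: "coin + nat \<Rightarrow> real"
      { assume *: "\<And>i. i \<in> ?T \<union> ?M \<Longrightarrow> x i = y i"
        have "hit ?L x = hit ?L y" by (rule hit_cong) (use * in auto)
        moreover have "stop_time x = stop_time y" by (rule stop_time_cong) (use * in auto)
        ultimately show "(hit ?L x \<and> stop_time x = t) = (hit ?L y \<and> stop_time y = t)" by simp }
      { assume "\<And>i. i \<in> ?B \<Longrightarrow> x i = y i"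
        from chosen_cong[of x y, OF this] show "(?c x \<in> A) = (?c y \<in> A)" by simp }
    qed measurable
    also have "emeasure P {z \<in> space P. hit ?L z \<and> stop_time z = t} = emeasure P {z \<in> space P. hit ?L z} * emeasure P {z \<in> space P. stop_time z = t}"
    proof (rule emeasure_Int_disjoint_coords)
      show "?M \<subseteq> K" "?T \<subseteq> K" "?M \<inter> ?T = {}" by auto
      fix x y :: "coin + nat \<Rightarrow> real"
      { assume *: "\<And>i. i \<in> ?M \<Longrightarrow> x i = y i"
        show "hit ?L x = hit ?L y" by (rule hit_cong) (use * in auto) }
      { assume *: "\<And>i. i \<in> ?T \<Longrightarrow> x i = y i"
        have "stop_time x = stop_time y" by (rule stop_time_cong) (use * in auto)
        then show "(stop_time x = t) = (stop_time y = t)" by simp }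
    qed measurable
    finally show ?thesis by (simp add: c_meas mult_ac)
  qed
  have split: "emeasure P {z \<in> space P. Q z} = (\<Sum>t\<in>{1..n}. emeasure P {z \<in> space P. stop_time z = t \<and> Q z})"
    if [measurable]: "Measurable.pred P Q" for Q
  proof -
    have "{z \<in> space P. Q z} = (\<Union>t\<in>{1..n}. {z \<in> space P. stop_time z = t \<and> Q z})" using stop_time(1,2) by auto
    then show ?thesis by (simp only:) (subst sum_emeasure, auto simp: disjoint_family_on_def)
  qed
  have "emeasure P {z \<in> space P. hit ?L z \<and> sample \<delta> z \<in> A} = (\<Sum>t\<in>{1..n}. emeasure P {z \<in> space P. hit ?L z \<and> stop_time z = t \<and> sample \<delta> z \<in> A})"
    by (subst split) (auto intro!: sum.cong arg_cong2[where f=emeasure])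
  also have "\<dots> = (\<Sum>t\<in>{1..n}. emeasure P {z \<in> space P. hit ?L z} * ?\<mu> * emeasure P {z \<in> space P. stop_time z = t})"
    by (intro sum.cong refl one)
  also have "\<dots> = emeasure P {z \<in> space P. hit ?L z} * ?\<mu> * (\<Sum>t\<in>{1..n}. emeasure P {z \<in> space P. stop_time z = t \<and> True})"
    by (simp add: sum_distrib_left)
  also have "(\<Sum>t\<in>{1..n}. emeasure P {z \<in> space P. stop_time z = t \<and> True}) = 1"
    by (subst split[symmetric]) (auto simp: emeasure_space_1)
  finally show ?thesis by simp
qed

text \<open>The conditioning event is the preimage of the hit event. It has positive probability
  because \<open>\<delta> < 1\<close>, so the product formula can be divided by it.\<close>

lemma samples_edge_sampler:
  assumes \<delta>: "0 < \<delta>" "\<delta> < 1"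
  shows "samples_without_replacement (edge_sampler_alg n s \<delta>) G (oriented_edges G) s \<delta>"
proof -
  let ?H = "{z \<in> space P. hit (mark_rate n \<delta>) z}"
  let ?S = "enc -` ?H \<inter> space (run_space G)"
  have H: "?H \<in> sets P" by measurable
  have S: "?S \<in> sets (run_space G)" by (rule measurable_sets[OF measurable_enc H])
  have law: "emeasure (run_space G) (enc -` B \<inter> space (run_space G)) = emeasure P B" if "B \<in> sets P" for B
    using emeasure_distr[OF measurable_enc that] by (simp add: distr_run_space)
  have prob: "1 - \<delta> \<le> measure (run_space G) ?S"
    using prob_hit[OF \<delta>] law[OF H] by (simp add: measure_def)
  interpret prob_space P by (rule prob_space_unif)
  have fin: "emeasure P ?H \<noteq> \<infinity>" "emeasure P ?H \<noteq> 0"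
    using prob_hit[OF \<delta>] \<delta> by (auto simp: emeasure_eq_measure)
  have alg: "alg_output (edge_sampler_alg n s \<delta>) G = (\<lambda>x. sample \<delta> (enc x))"
    using alg_output_enc by auto
  have m: "(\<lambda>x. sample \<delta> (enc x)) \<in> run_space G \<rightarrow>\<^sub>M count_space UNIV"
    using measurable_compose[OF measurable_enc measurable_sample] .
  have "distr (uniform_measure (run_space G) ?S) (count_space UNIV) (\<lambda>x. sample \<delta> (enc x)) =
      measure_pmf (pmf_of_set {Y. Y \<subseteq> oriented_edges G \<and> card Y = s})"
  proof (rule measure_eqI)
    fix A
    have A: "{z \<in> space P. hit (mark_rate n \<delta>) z \<and> sample \<delta> z \<in> A} \<in> sets P"
    proof -
      have [measurable]: "Measurable.pred P (\<lambda>z. sample \<delta> z \<in> A)"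
        by (rule pred_count_space[OF measurable_sample])
      show ?thesis by measurable
    qed
    have "emeasure (distr (uniform_measure (run_space G) ?S) (count_space UNIV) (\<lambda>x. sample \<delta> (enc x))) A =
        emeasure (uniform_measure (run_space G) ?S) ((\<lambda>x. sample \<delta> (enc x)) -` A \<inter> space (run_space G))"
      using m by (subst emeasure_distr) auto
    also have "\<dots> = emeasure (run_space G) (?S \<inter> ((\<lambda>x. sample \<delta> (enc x)) -` A \<inter> space (run_space G))) / emeasure (run_space G) ?S"
      using m S by (intro emeasure_uniform_measure) (auto intro: measurable_sets)
    also have "?S \<inter> ((\<lambda>x. sample \<delta> (enc x)) -` A \<inter> space (run_space G)) =
        enc -` {z \<in> space P. hit (mark_rate n \<delta>) z \<and> sample \<delta> z \<in> A} \<inter> space (run_space G)" by auto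
    also have "emeasure (run_space G) \<dots> = emeasure P ?H * emeasure (measure_pmf (pmf_of_set {Y. Y \<subseteq> oriented_edges G \<and> card Y = s})) A"
      by (simp only: law[OF A] emeasure_sample[OF \<delta>])
    also have "\<dots> / emeasure (run_space G) ?S = emeasure (measure_pmf (pmf_of_set {Y. Y \<subseteq> oriented_edges G \<and> card Y = s})) A"
      unfolding law[OF H] using fin by (simp add: ennreal_mult_divide_eq mult.commute)
    finally show "emeasure (distr (uniform_measure (run_space G) ?S) (count_space UNIV) (\<lambda>x. sample \<delta> (enc x))) A =
        emeasure (measure_pmf (pmf_of_set {Y. Y \<subseteq> oriented_edges G \<and> card Y = s})) A" .
  qed simp
  with S prob show ?thesis unfolding samples_without_replacement_def alg by blast
qed

subsection \<open>The stopping time of the estimation phase\<close>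

text \<open>Counting the edges by their heavy and light endpoints: at most \<open>F\<^sup>2\<close> adjacent pairs are
  heavy on both sides, and the degrees of the light vertices sum to at most \<open>F * sqrt m\<close>,
  where \<open>F\<close> is the sum below.\<close>

lemma truncated_degree_sum: "sqrt (real m) / 2 \<le> (\<Sum>v\<in>verts G. min 1 (real (d v) / sqrt (real m)))"
proof -
  let ?r = "sqrt (real m)"
  define F where "F = (\<Sum>v\<in>verts G. min 1 (real (d v) / ?r))"
  have r: "0 < ?r" using m_pos by simp
  \<comment> \<open>Not the heavy vertices of the search: here the cut lies at
    \<open>sqrt m\<close>.\<close>
  define H where "H = {v \<in> verts G. ?r \<le> real (d v)}"
  define B where "B = verts G - H"
  have HB: "H \<subseteq> verts G" "finite H" "finite B" "verts G = H \<union> B" "H \<inter> B = {}" by (auto simp: H_def B_def)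
  have F0: "0 \<le> F" unfolding F_def using r by (intro sum_nonneg) auto
  have "real (card H) = (\<Sum>v\<in>H. min 1 (real (d v) / ?r))"
    using r by (simp add: H_def min_def sum.If_cases)
  also have "\<dots> \<le> F" unfolding F_def using HB r by (intro sum_mono2) auto
  finally have cH: "real (card H) \<le> F" .
  have "(\<Sum>v\<in>B. real (d v)) = ?r * (\<Sum>v\<in>B. min 1 (real (d v) / ?r))"
    unfolding sum_distrib_left using r by (intro sum.cong) (auto simp: B_def H_def min_def field_simps)
  also have "\<dots> \<le> ?r * F" unfolding F_def using HB r by (intro mult_left_mono sum_mono2) auto
  finally have dB: "(\<Sum>v\<in>B. real (d v)) \<le> ?r * F" .
  have cd: "card {w \<in> X. w \<in> neighbors G v} = (\<Sum>w\<in>X. if w \<in> neighbors G v then 1 else 0)" if "finite X" for X v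
    using that by (simp add: sum.If_cases Int_def)
  have dsplit: "d v = card {w \<in> H. w \<in> neighbors G v} + card {w \<in> B. w \<in> neighbors G v}" for v
  proof -
    have "neighbors G v = {w \<in> H. w \<in> neighbors G v} \<union> {w \<in> B. w \<in> neighbors G v}"
      using neighbors_verts HB by auto
    then show ?thesis unfolding deg_def using HB by (subst card_Un_disjoint[symmetric]) auto
  qed
  have "(\<Sum>v\<in>H. d v) = (\<Sum>v\<in>H. card {w \<in> H. w \<in> neighbors G v}) + (\<Sum>v\<in>H. card {w \<in> B. w \<in> neighbors G v})"
    by (subst dsplit) (rule sum.distrib)
  also have "(\<Sum>v\<in>H. card {w \<in> H. w \<in> neighbors G v}) \<le> (\<Sum>v\<in>H. card H)"
    using HB by (intro sum_mono card_mono) auto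
  \<comment> \<open>Adjacent pairs between \<open>H\<close> and \<open>B\<close> are recounted from
    the side of \<open>B\<close>, where the degree sum is controlled.\<close>
  also have "(\<Sum>v\<in>H. card {w \<in> B. w \<in> neighbors G v}) = (\<Sum>w\<in>B. card {v \<in> H. v \<in> neighbors G w})"
    using HB by (simp add: cd) (subst sum.swap, simp add: neighbors_sym)
  also have "\<dots> \<le> (\<Sum>w\<in>B. d w)"
    by (intro sum_mono) (simp add: dsplit)
  finally have dH: "(\<Sum>v\<in>H. d v) \<le> card H * card H + (\<Sum>w\<in>B. d w)" by simp
  have "2 * m = (\<Sum>v\<in>H. d v) + (\<Sum>v\<in>B. d v)"
    unfolding sum_deg[symmetric] HB(4) using HB by (intro sum.union_disjoint) auto
  with dH have "2 * m \<le> card H * card H + 2 * (\<Sum>w\<in>B. d w)" by simp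
  then have "real (2 * m) \<le> real (card H * card H + 2 * (\<Sum>w\<in>B. d w))" by (rule of_nat_mono)
  then have "2 * real m \<le> real (card H) * real (card H) + 2 * (\<Sum>w\<in>B. real (d w))" by simp
  also have "\<dots> \<le> F * F + 2 * (?r * F)"
  proof -
    have "real (card H) * real (card H) \<le> F * F" using cH F0 by (intro mult_mono) auto
    with dB show ?thesis by linarith
  qed
  finally have le: "2 * (?r * ?r) \<le> F * F + 2 * (?r * F)" by simp
  show ?thesis
  proof (rule ccontr)
    \<comment> \<open>With \<open>F \<le> sqrt m / 2\<close> the inequality just proved would give
      \<open>2 * m \<le> m / 4 + m\<close>.\<close>
    assume "\<not> ?thesis"
    then have "F \<le> ?r / 2" by (simp add: F_def)
    then have "F * F \<le> (?r / 2) * (?r / 2)" "?r * F \<le> ?r * (?r / 2)"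
      using mult_mono[of F "?r / 2" F "?r / 2"] mult_left_mono[of F "?r / 2" ?r] F0 r by linarith+
    moreover have "(?r / 2) * (?r / 2) = real m / 4" "?r * (?r / 2) = real m / 2" "?r * ?r = real m" by simp_all
    ultimately have "2 * real m \<le> real m / 4 + 2 * (real m / 2)" using le by linarith
    then show False using m_pos by simp
  qed
qed

text \<open>Rounding up assigns to each index an interval of length \<open>1 / n\<close> of coin
  values; the clamping matters only at the excluded boundary values.\<close>

lemma emeasure_sampled_vertex:
  assumes i: "i \<in> {1..n}"
  shows "emeasure P {z \<in> space P. sampled_vertex z t = i} = ennreal (1 / real n)"
proof -
  have n0: "0 < real n" using n_ge_2 by simp
  have m[measurable]: "Measurable.pred P (\<lambda>z. sampled_vertex z t = i)" unfolding sampled_vertex_def by measurable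
  have "emeasure P {z \<in> space P. sampled_vertex z t = i} = emeasure P {z \<in> space P. z (Inl (Idx t)) \<in> {(real i - 1) / real n<..real i / real n}}"
  proof (rule emeasure_eq_AE)
    show "AE z in P. (z \<in> {z \<in> space P. sampled_vertex z t = i}) = (z \<in> {z \<in> space P. z (Inl (Idx t)) \<in> {(real i - 1) / real n<..real i / real n}})"
      using AE_regular
    proof eventually_elim
      case (elim z)
      let ?y = "real n * z (Inl (Idx t))"
      have y: "0 < ?y" "?y < real n" using regularD(1,2)[OF elim, of "Idx t"] n0 by auto
      have c0: "0 < \<lceil>?y\<rceil>" using y(1) by simp
      have c1: "\<lceil>?y\<rceil> \<le> int n" by (rule ceiling_le) (use y in linarith)
      have "1 \<le> nat \<lceil>?y\<rceil>" "nat \<lceil>?y\<rceil> \<le> n" using c0 c1 by linarith+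
      then have "sampled_vertex z t = nat \<lceil>?y\<rceil>" by (simp add: sampled_vertex_def)
      then have "sampled_vertex z t = i \<longleftrightarrow> \<lceil>?y\<rceil> = int i" using c0 by auto
      also have "\<dots> \<longleftrightarrow> real i - 1 < ?y \<and> ?y \<le> real i" by (simp add: ceiling_eq_iff)
      also have "\<dots> \<longleftrightarrow> z (Inl (Idx t)) \<in> {(real i - 1) / real n<..real i / real n}"
        using n0 by (simp add: field_simps)
      finally show ?case by auto
    qed
  qed (use m in \<open>auto intro!: predE\<close>)
  also have "\<dots> = emeasure unit_uniform {(real i - 1) / real n<..real i / real n}"
    by (rule emeasure_unif_component) auto
  also have "\<dots> = ennreal (real i / real n - (real i - 1) / real n)"
    using i n0 by (intro emeasure_unit_uniform_Ioc) (auto simp: divide_right_mono)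
  also have "real i / real n - (real i - 1) / real n = 1 / real n" by (simp add: diff_divide_distrib)
  finally show ?thesis .
qed

definition stop_prob :: "nat \<Rightarrow> real" where
  "stop_prob t = (\<Sum>v\<in>verts G. min 1 (real (d v) * real t / real n)) / real n"

lemma emeasure_stop: "emeasure P {z \<in> space P. stop z t} = ennreal (stop_prob t)"
proof -
  have m1[measurable]: "Measurable.pred P (\<lambda>z. sampled_vertex z t = i)" for i unfolding sampled_vertex_def by measurable
  let ?c = "\<lambda>i. real (d (va i)) * real t / real n"
  have rng: "sampled_vertex z t \<in> {1..n}" for z using n_ge_2 by (auto simp: sampled_vertex_def)
  have "{z \<in> space P. stop z t} = (\<Union>i\<in>{1..n}. {z \<in> space P. sampled_vertex z t = i \<and> z (Inl (Thr t)) \<le> ?c i})"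
    using rng by (auto simp: stop_def)
  then have "emeasure P {z \<in> space P. stop z t} = (\<Sum>i\<in>{1..n}. emeasure P {z \<in> space P. sampled_vertex z t = i \<and> z (Inl (Thr t)) \<le> ?c i})"
    by (simp only:) (subst sum_emeasure, auto simp: disjoint_family_on_def)
  also have "\<dots> = (\<Sum>i\<in>{1..n}. ennreal (min 1 (?c i) / real n))"
  proof (rule sum.cong[OF refl])
    fix i assume i: "i \<in> {1..n}"
    have "emeasure P {z \<in> space P. sampled_vertex z t = i \<and> z (Inl (Thr t)) \<le> ?c i} =
        emeasure P {z \<in> space P. sampled_vertex z t = i} * emeasure P {z \<in> space P. z (Inl (Thr t)) \<le> ?c i}"
    proof (rule emeasure_Int_disjoint_coords)
      show "{Inl (Idx t)} \<subseteq> K" "{Inl (Thr t)} \<subseteq> K" "{Inl (Idx t)} \<inter> {Inl (Thr t)} = ({} :: (coin + nat) set)" by auto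
      fix x y :: "coin + nat \<Rightarrow> real"
      show "(\<And>i. i \<in> {Inl (Idx t)} \<Longrightarrow> x i = y i) \<Longrightarrow> (sampled_vertex x t = i) = (sampled_vertex y t = i)"
        by (simp add: sampled_vertex_def)
      show "(\<And>i. i \<in> {Inl (Thr t)} \<Longrightarrow> x i = y i) \<Longrightarrow> (x (Inl (Thr t)) \<le> ?c i) = (y (Inl (Thr t)) \<le> ?c i)" by simp
    qed measurable
    also have "emeasure P {z \<in> space P. z (Inl (Thr t)) \<le> ?c i} = ennreal (min 1 (?c i))"
      using emeasure_unif_component[of "Inl (Thr t)" K "{..?c i}"] by (simp add: emeasure_unit_uniform_atMost)
    finally show "emeasure P {z \<in> space P. sampled_vertex z t = i \<and> z (Inl (Thr t)) \<le> ?c i} = ennreal (min 1 (?c i) / real n)"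
      unfolding emeasure_sampled_vertex[OF i] by (simp flip: ennreal_mult)
  qed
  also have "\<dots> = ennreal (\<Sum>i\<in>{1..n}. min 1 (?c i) / real n)" by (rule sum_ennreal) simp
  also have "(\<Sum>i\<in>{1..n}. min 1 (?c i) / real n) = (\<Sum>v\<in>verts G. min 1 (real (d v) * real t / real n) / real n)"
    using va_bij by (rule sum.reindex_bij_betw)
  finally show ?thesis by (simp add: stop_prob_def sum_divide_distrib)
qed

lemma stop_prob_le: "stop_prob t \<le> 2 * real m * real t / (real n)\<^sup>2"
proof -
  have "(\<Sum>v\<in>verts G. min 1 (real (d v) * real t / real n)) \<le> (\<Sum>v\<in>verts G. real (d v) * real t / real n)"
    by (intro sum_mono) simp
  also have "\<dots> = (\<Sum>v\<in>verts G. real (d v)) * real t / real n" by (simp add: sum_distrib_right sum_divide_distrib)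
  also have "(\<Sum>v\<in>verts G. real (d v)) = 2 * real m" using arg_cong[OF sum_deg, of real] by simp
  finally show ?thesis using n_ge_2 by (simp add: stop_prob_def field_simps power2_eq_square)
qed

text \<open>From \<open>t = n / sqrt m\<close> on, the acceptance threshold \<open>d * t / n\<close>
  dominates the truncated degree \<open>d / sqrt m\<close>, so every further attempt succeeds with
  probability at least of order \<open>sqrt m / n\<close>.\<close>

lemma stop_prob_ge:
  assumes t: "real n / sqrt (real m) \<le> real t"
  shows "sqrt (real m) / (2 * real n) \<le> stop_prob t"
proof -
  have "1 / sqrt (real m) \<le> real t / real n"
    using t m_pos n_ge_2 by (simp add: field_simps)
  then have "real (d v) * (1 / sqrt (real m)) \<le> real (d v) * (real t / real n)" for v by (rule mult_left_mono) simp
  then have "min 1 (real (d v) / sqrt (real m)) \<le> min 1 (real (d v) * real t / real n)" for v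
    by (intro min.mono) auto
  then have "(\<Sum>v\<in>verts G. min 1 (real (d v) / sqrt (real m))) \<le> (\<Sum>v\<in>verts G. min 1 (real (d v) * real t / real n))"
    by (intro sum_mono)
  with truncated_degree_sum have "sqrt (real m) / 2 \<le> (\<Sum>v\<in>verts G. min 1 (real (d v) * real t / real n))" by linarith
  then have "sqrt (real m) / 2 / real n \<le> stop_prob t" unfolding stop_prob_def by (rule divide_right_mono) simp
  then show ?thesis by simp
qed

text \<open>Different attempts read different coins, so their failure probabilities
  multiply.\<close>

lemma emeasure_no_stop:
  assumes x: "0 \<le> x" "x \<le> 1" "\<And>t. a \<le> t \<Longrightarrow> x \<le> stop_prob t"
  shows "emeasure P {z \<in> space P. \<forall>t\<in>{a..<a + k}. \<not> stop z t} \<le> ennreal ((1 - x) ^ k)"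
proof (induction k)
  case 0
  then show ?case by (simp add: prob_space.emeasure_space_1[OF prob_space_unif])
next
  interpret prob_space P by (rule prob_space_unif)
  case (Suc k)
  have "{z \<in> space P. \<forall>t\<in>{a..<a + Suc k}. \<not> stop z t} = {z \<in> space P. (\<forall>t\<in>{a..<a + k}. \<not> stop z t) \<and> \<not> stop z (a + k)}"
    by (auto simp: less_Suc_eq)
  also have "emeasure P \<dots> = emeasure P {z \<in> space P. \<forall>t\<in>{a..<a + k}. \<not> stop z t} * emeasure P {z \<in> space P. \<not> stop z (a + k)}"
  proof (rule emeasure_Int_disjoint_coords)
    let ?c = "\<lambda>t. {Inl (Idx t), Inl (Thr t)} :: (coin + nat) set"
    have sc: "stop x t = stop y t" if "\<And>i. i \<in> ?c t \<Longrightarrow> x i = y i" for x y :: "coin + nat \<Rightarrow> real" and t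
      using that by (simp add: stop_def sampled_vertex_def)
    show "(\<Union>t\<in>{a..<a + k}. ?c t) \<subseteq> K" "?c (a + k) \<subseteq> K" "(\<Union>t\<in>{a..<a + k}. ?c t) \<inter> ?c (a + k) = {}" by auto
    fix x y :: "coin + nat \<Rightarrow> real"
    { assume *: "\<And>i. i \<in> (\<Union>t\<in>{a..<a + k}. ?c t) \<Longrightarrow> x i = y i"
      have "stop x t = stop y t" if "t \<in> {a..<a + k}" for t by (rule sc) (use * that in blast)
      then show "(\<forall>t\<in>{a..<a + k}. \<not> stop x t) = (\<forall>t\<in>{a..<a + k}. \<not> stop y t)" by simp }
    { assume "\<And>i. i \<in> ?c (a + k) \<Longrightarrow> x i = y i"
      from sc[OF this] show "(\<not> stop x (a + k)) = (\<not> stop y (a + k))" by simp }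
  qed measurable
  also have "\<dots> \<le> ennreal ((1 - x) ^ k) * ennreal (1 - x)"
  proof (rule mult_mono)
    have "{z \<in> space P. \<not> stop z (a + k)} = space P - {z \<in> space P. stop z (a + k)}" by auto
    then have "emeasure P {z \<in> space P. \<not> stop z (a + k)} = 1 - ennreal (stop_prob (a + k))"
      by (simp only:) (subst emeasure_compl, auto simp: emeasure_stop emeasure_space_1)
    also have "\<dots> \<le> 1 - ennreal x" using x by (intro ennreal_minus_mono ennreal_leI) auto
    also have "\<dots> = ennreal (1 - x)" using x by (simp add: ennreal_minus flip: ennreal_1)
    finally show "emeasure P {z \<in> space P. \<not> stop z (a + k)} \<le> ennreal (1 - x)" .
  qed (use Suc in auto)
  also have "\<dots> = ennreal ((1 - x) ^ Suc k)" using x by (simp add: mult.commute flip: ennreal_mult)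
  finally show ?case .
qed

section \<open>Expectations of the stopping time and of its inverse\<close>

abbreviation T_prob :: "nat \<Rightarrow> real" where
  "T_prob t \<equiv> measure P {z \<in> space P. stop_time z = t}"

lemma T_pred [measurable]: "Measurable.pred P (\<lambda>z. Q (stop_time z))"
  by (rule pred_count_space[OF measurable_estimate(1)])

lemma T_prob_sum: "measure P {z \<in> space P. k \<le> stop_time z} = (\<Sum>t\<in>{k..n}. T_prob t)"
proof -
  interpret prob_space P by (rule prob_space_unif)
  have "{z \<in> space P. k \<le> stop_time z} = (\<Union>t\<in>{k..n}. {z \<in> space P. stop_time z = t})" using stop_time(2) by auto
  then show ?thesis by (simp only:) (subst finite_measure_finite_Union, auto simp: disjoint_family_on_def)
qed

lemma T_prob_total: "(\<Sum>t\<in>{1..n}. T_prob t) = 1"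
proof -
  interpret prob_space P by (rule prob_space_unif)
  have "{z \<in> space P. 1 \<le> stop_time z} = space P" using stop_time(1) by auto
  then show ?thesis using T_prob_sum[of 1] prob_space by simp
qed

text \<open>Below \<open>n / sqrt m\<close> the probability of stopping at \<open>t\<close> is at
  most \<open>2 * m * t / n^2\<close>, so each term is at most \<open>2 * m / n^2\<close>, and at
  most \<open>n / sqrt m\<close> such terms contribute \<open>2 * sqrt m / n\<close>. Later terms
  have \<open>1 / t \<le> sqrt m / n\<close> and total probability at most 1.\<close>

lemma expectation_inverse_stop_time: "(\<Sum>t\<in>{1..n}. T_prob t / real t) \<le> 3 * sqrt (real m) / real n"
proof -
  interpret prob_space P by (rule prob_space_unif)
  let ?r = "sqrt (real m)"
  have n0: "0 < real n" and r: "0 < ?r" "1 \<le> ?r" using n_ge_2 m_pos by auto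
  let ?E = "{t \<in> {1..n}. real t < real n / ?r}"
  have each: "T_prob t / real t \<le> (if real t < real n / ?r then 2 * real m / (real n)\<^sup>2 else 0) + T_prob t * (?r / real n)"
    if t: "t \<in> {1..n}" for t
  proof (cases "real t < real n / ?r")
    case True
    \<comment> \<open>This secures \<open>t < n\<close>, where stopping at \<open>t\<close> means
      that attempt \<open>t\<close> succeeded; the value \<open>n\<close> could be the
      default.\<close>
    have "real n / ?r \<le> real n" using r n0 by (simp add: field_simps)
    with True have "t < n" by linarith
    then have "T_prob t \<le> measure P {z \<in> space P. stop z t}"
      using stop_time(4) by (intro finite_measure_mono) auto
    also have "\<dots> = stop_prob t"
      using emeasure_stop[of t] by (simp add: measure_def stop_prob_def sum_nonneg)
    also have "\<dots> \<le> 2 * real m * real t / (real n)\<^sup>2" by (rule stop_prob_le)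
    finally have "T_prob t / real t \<le> 2 * real m * real t / (real n)\<^sup>2 / real t" by (rule divide_right_mono) simp
    also have "\<dots> = 2 * real m / (real n)\<^sup>2" using t by simp
    finally show ?thesis using True r n0 by (simp add: add_increasing2)
  next
    case False
    then have "1 / real t \<le> ?r / real n" using t r n0 by (simp add: field_simps)
    then have "T_prob t * (1 / real t) \<le> T_prob t * (?r / real n)" by (rule mult_left_mono) simp
    then show ?thesis using False by simp
  qed
  have "(\<Sum>t\<in>{1..n}. T_prob t / real t) \<le> (\<Sum>t\<in>{1..n}. (if real t < real n / ?r then 2 * real m / (real n)\<^sup>2 else 0) + T_prob t * (?r / real n))"
    by (rule sum_mono) (rule each)
  also have "\<dots> = (\<Sum>t\<in>{1..n}. if real t < real n / ?r then 2 * real m / (real n)\<^sup>2 else 0) + (\<Sum>t\<in>{1..n}. T_prob t) * (?r / real n)"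
    by (simp add: sum.distrib sum_distrib_right sum_divide_distrib)
  also have "(\<Sum>t\<in>{1..n}. if real t < real n / ?r then 2 * real m / (real n)\<^sup>2 else 0) = real (card ?E) * (2 * real m / (real n)\<^sup>2)"
    by (subst sum.inter_filter[symmetric]) auto
  also have "real (card ?E) * (2 * real m / (real n)\<^sup>2) \<le> (real n / ?r) * (2 * real m / (real n)\<^sup>2)"
  proof (rule mult_right_mono)
    have "?E \<subseteq> {1..nat \<lfloor>real n / ?r\<rfloor>}" by (auto simp: le_nat_floor less_imp_le)
    then have "card ?E \<le> nat \<lfloor>real n / ?r\<rfloor>" using card_mono[of "{1..nat \<lfloor>real n / ?r\<rfloor>}" ?E] by simp
    then have "real (card ?E) \<le> real (nat \<lfloor>real n / ?r\<rfloor>)" by (rule of_nat_mono)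
    also have "\<dots> \<le> real n / ?r" using n0 r by (intro of_nat_floor) auto
    finally show "real (card ?E) \<le> real n / ?r" .
  qed simp
  also have "(real n / ?r) * (2 * real m / (real n)\<^sup>2) = 2 * (?r / real n)"
  proof -
    have "real m = ?r * ?r" by simp
    then show ?thesis using n0 r by (simp add: field_simps power2_eq_square del: real_sqrt_mult_self)
  qed
  finally show ?thesis using T_prob_total by simp
qed

text \<open>Beyond \<open>a\<close>, which is \<open>n / sqrt m\<close> rounded up, each attempt
  stops with probability at least \<open>x = sqrt m / (2 * n)\<close>. The excess over
  \<open>a\<close> has a geometric tail with sum at most \<open>1 / x\<close>, that is
  \<open>2 * n / sqrt m\<close>, and the rounding costs at most one more
  \<open>n / sqrt m\<close>.\<close>

lemma expectation_stop_time: "(\<Sum>t\<in>{1..n}. T_prob t * real t) \<le> 4 * real n / sqrt (real m)"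
proof -
  interpret prob_space P by (rule prob_space_unif)
  let ?r = "sqrt (real m)"
  have n0: "0 < real n" and r: "0 < ?r" "1 \<le> ?r" using n_ge_2 m_pos by auto
  have rn: "?r \<le> real n" using m_le by (simp add: real_le_lsqrt flip: of_nat_power)
  define a where "a = nat \<lceil>real n / ?r\<rceil>"
  have a: "real n / ?r \<le> real a" "real a \<le> real n / ?r + 1" "1 \<le> a"
    using divide_pos_pos[OF n0 r(1)] unfolding a_def by linarith+
  define x where "x = ?r / (2 * real n)"
  have "0 < x" unfolding x_def using n0 r by (intro divide_pos_pos) linarith+
  moreover have "x \<le> 1" unfolding x_def using n0 rn by (subst pos_divide_le_eq) linarith+
  ultimately have x: "0 < x" "x \<le> 1" .
  have tail: "measure P {z \<in> space P. k \<le> stop_time z} \<le> (1 - x) ^ (k - a)" if "a \<le> k" for k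
  proof -
    have "emeasure P {z \<in> space P. k \<le> stop_time z} \<le> emeasure P {z \<in> space P. \<forall>t\<in>{a..<a + (k - a)}. \<not> stop z t}"
      using that a stop_time(3) by (intro emeasure_mono) auto
    also have "\<dots> \<le> ennreal ((1 - x) ^ (k - a))"
    proof (rule emeasure_no_stop)
      fix t assume "a \<le> t"
      then have "real n / ?r \<le> real t" using a by linarith
      then show "x \<le> stop_prob t" unfolding x_def by (rule stop_prob_ge)
    qed (use x in auto)
    finally show ?thesis using x by (simp add: emeasure_eq_measure)
  qed
  \<comment> \<open>The excess of \<open>t\<close> over \<open>a\<close> is the number of
    \<open>k\<close> with \<open>a < k \<le> t\<close>; exchanging the sums turns it into tail
    probabilities.\<close>
  have "(\<Sum>t\<in>{1..n}. T_prob t * real t) \<le> (\<Sum>t\<in>{1..n}. T_prob t * (real a + (\<Sum>k\<in>{Suc a..n}. if k \<le> t then 1 else 0)))"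
  proof (intro sum_mono mult_left_mono)
    fix t assume "t \<in> {1..n}"
    then have "{Suc a..n} \<inter> {k. k \<le> t} = {Suc a..t}" by auto
    then have "(\<Sum>k\<in>{Suc a..n}. if k \<le> t then 1 else (0::real)) = real (card {Suc a..t})"
      by (simp add: sum.If_cases)
    then show "real t \<le> real a + (\<Sum>k\<in>{Suc a..n}. if k \<le> t then 1 else 0)" by simp
  qed auto
  also have "\<dots> = real a * (\<Sum>t\<in>{1..n}. T_prob t) + (\<Sum>t\<in>{1..n}. \<Sum>k\<in>{Suc a..n}. if k \<le> t then T_prob t else 0)"
  proof -
    have "T_prob t * (real a + (\<Sum>k\<in>{Suc a..n}. if k \<le> t then 1 else 0)) =
        real a * T_prob t + (\<Sum>k\<in>{Suc a..n}. if k \<le> t then T_prob t else 0)" for t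
      unfolding distrib_left sum_distrib_left by (intro arg_cong2[where f="(+)"] sum.cong) auto
    then show ?thesis by (simp only: sum.distrib sum_distrib_left)
  qed
  also have "(\<Sum>t\<in>{1..n}. \<Sum>k\<in>{Suc a..n}. if k \<le> t then T_prob t else 0) = (\<Sum>k\<in>{Suc a..n}. \<Sum>t\<in>{1..n}. if k \<le> t then T_prob t else 0)"
    by (rule sum.swap)
  also have "\<dots> = (\<Sum>k\<in>{Suc a..n}. measure P {z \<in> space P. k \<le> stop_time z})"
  proof (rule sum.cong[OF refl])
    fix k assume k: "k \<in> {Suc a..n}"
    have "(\<Sum>t\<in>{1..n}. if k \<le> t then T_prob t else 0) = (\<Sum>t\<in>{t \<in> {1..n}. k \<le> t}. T_prob t)"
      by (rule sum.inter_filter[symmetric]) simp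
    also have "{t \<in> {1..n}. k \<le> t} = {k..n}" using k by auto
    finally show "(\<Sum>t\<in>{1..n}. if k \<le> t then T_prob t else 0) = measure P {z \<in> space P. k \<le> stop_time z}"
      by (simp add: T_prob_sum)
  qed
  also have "\<dots> \<le> (\<Sum>k\<in>{Suc a..n}. (1 - x) ^ (k - a))" using tail by (intro sum_mono) auto
  also have "\<dots> \<le> 1 / x"
  proof -
    have "(\<Sum>k\<in>{Suc a..n}. (1 - x) ^ (k - a)) = (\<Sum>j\<in>{1..n - a}. (1 - x) ^ j)"
      by (rule sum.reindex_bij_witness[of _ "\<lambda>j. j + a" "\<lambda>k. k - a"]) auto
    also have "\<dots> \<le> (\<Sum>j<Suc (n - a). (1 - x) ^ j)" using x by (intro sum_mono2) auto
    also have "\<dots> = (1 - (1 - x) ^ Suc (n - a)) / x"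
      using x by (subst sum_gp_strict) auto
    also have "\<dots> \<le> 1 / x" using x by (intro divide_right_mono) auto
    finally show ?thesis .
  qed
  finally have "(\<Sum>t\<in>{1..n}. T_prob t * real t) \<le> real a + 1 / x" using T_prob_total by simp
  also have "\<dots> \<le> (real n / ?r + 1) + 2 * (real n / ?r)" using a by (simp add: x_def)
  also have "\<dots> \<le> 4 * real n / ?r"
  proof -
    have "1 \<le> real n / ?r" using rn r by (subst pos_le_divide_eq) linarith+
    then show ?thesis by simp
  qed
  finally show ?thesis .
qed

end

lemma measurable_of_bool: "Measurable.pred M Q \<Longrightarrow> (\<lambda>z. of_bool (Q z) :: ennreal) \<in> borel_measurable M"
  by (rule measurable_compose[of Q M "count_space UNIV"]) auto

lemma nn_integral_of_bool:
  assumes Q: "Measurable.pred M Q"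
  shows "(\<integral>\<^sup>+z. of_bool (Q z) \<partial>M) = emeasure M {z \<in> space M. Q z}"
proof -
  have "(\<integral>\<^sup>+z. of_bool (Q z) \<partial>M) = (\<integral>\<^sup>+z. indicator {z \<in> space M. Q z} z \<partial>M)"
    by (intro nn_integral_cong) (auto simp: indicator_def)
  then show ?thesis using predE[OF Q] by simp
qed

text \<open>Split at \<open>1 / n\<close>: the constant part contributes 1 and the integral of
  \<open>1 / y\<close> over the rest contributes \<open>ln n\<close>.\<close>

lemma nn_integral_min_inverse:
  assumes n: "1 \<le> n"
  shows "(\<integral>\<^sup>+y. ennreal (min (real n) (1 / y)) \<partial>unit_uniform) \<le> ennreal (1 + ln (real n))"
proof -
  have n0: "0 < real n" using n by simp
  have "(\<integral>\<^sup>+y. ennreal (min (real n) (1 / y)) \<partial>unit_uniform) = (\<integral>\<^sup>+y. ennreal (min (real n) (1 / y)) * indicator {0..1} y \<partial>lborel)"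
    unfolding unit_uniform_def by (subst nn_integral_uniform_measure) (auto simp: divide_ennreal_def)
  also have "\<dots> \<le> (\<integral>\<^sup>+y. ennreal (real n) * indicator {0..1 / real n} y + ennreal (1 / y) * indicator {1 / real n..1} y \<partial>lborel)"
  proof (rule nn_integral_mono)
    fix y :: real
    show "ennreal (min (real n) (1 / y)) * indicator {0..1} y \<le> ennreal (real n) * indicator {0..1 / real n} y + ennreal (1 / y) * indicator {1 / real n..1} y"
    proof (cases "y \<le> 1 / real n")
      case True
      have "ennreal (min (real n) (1 / y)) * indicator {0..1} y \<le> ennreal (real n) * indicator {0..1 / real n} y"
        using True by (auto simp: indicator_def intro!: ennreal_leI)
      then show ?thesis by (rule order_trans) simp
    next
      case False
      have "ennreal (min (real n) (1 / y)) * indicator {0..1} y \<le> ennreal (1 / y) * indicator {1 / real n..1} y"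
        using False by (auto simp: indicator_def intro!: ennreal_leI)
      then show ?thesis by (rule order_trans) simp
    qed
  qed
  also have "\<dots> = (\<integral>\<^sup>+y. ennreal (real n) * indicator {0..1 / real n} y \<partial>lborel) + (\<integral>\<^sup>+y. ennreal (1 / y) * indicator {1 / real n..1} y \<partial>lborel)"
    by (rule nn_integral_add) auto
  also have "(\<integral>\<^sup>+y. ennreal (real n) * indicator {0..1 / real n} y \<partial>lborel) = 1"
    using n0 by (simp add: nn_integral_cmult flip: ennreal_mult)
  also have "(\<integral>\<^sup>+y. ennreal (1 / y) * indicator {1 / real n..1} y \<partial>lborel) = ennreal (ln 1 - ln (1 / real n))"
  proof (rule nn_integral_FTC_Icc)
    fix x :: real assume "x \<in> {1 / real n..1}"
    then have "0 < x" using n0 by (auto intro: less_le_trans[of 0 "1 / real n"])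
    then show "DERIV ln x :> 1 / x" "0 \<le> 1 / x"
      by (auto intro!: derivative_eq_intros simp: field_simps)
  qed (use n0 n in \<open>auto simp: field_simps\<close>)
  also have "1 + ennreal (ln 1 - ln (1 / real n)) = ennreal (1 + ln (real n))"
    using n by (simp add: ln_div flip: ennreal_1 ennreal_plus)
  finally show ?thesis .
qed

context graph_run
begin

subsection \<open>Cost of the search rounds\<close>

text \<open>For a fixed mark \<open>y\<close> the hash value is within the bound with probability at
  most \<open>p * L * min n (1 / y)\<close>; averaging over the independent uniform mark produces
  the logarithm.\<close>

lemma emeasure_scan:
  assumes w: "w \<in> verts G" and p: "0 \<le> p" and L: "0 \<le> L"
  shows "emeasure P {z \<in> space P. z (Inr w) \<le> scan_bound n L p (z (Inl (Mark i)))} \<le> ennreal (p * L * (1 + ln (real n)))"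
proof -
  let ?U = "unit_uniform \<Otimes>\<^sub>M unit_uniform"
  let ?XY = "\<lambda>z. (z (Inl (Mark i)), z (Inr w)) :: real \<times> real"
  let ?D = "{v \<in> space ?U. snd v \<le> scan_bound n L p (fst v)}"
  have U: "sets ?U = sets (borel \<Otimes>\<^sub>M borel)" by (intro sets_pair_measure_cong) auto
  have [measurable]: "(\<lambda>v :: real \<times> real. scan_bound n L p (fst v)) \<in> borel_measurable (borel \<Otimes>\<^sub>M borel)"
    unfolding scan_bound_def by measurable
  have "{v \<in> space (borel \<Otimes>\<^sub>M borel). snd v \<le> scan_bound n L p (fst v)} \<in> sets (borel \<Otimes>\<^sub>M borel)" by measurable
  then have D: "?D \<in> sets ?U" unfolding U by (simp add: space_pair_measure)
  have c: "(\<lambda>z. z (Inl (Mark i))) \<in> P \<rightarrow>\<^sub>M unit_uniform" "(\<lambda>z. z (Inr w)) \<in> P \<rightarrow>\<^sub>M unit_uniform"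
    using w by (auto intro!: measurable_component_singleton)
  then have XY: "?XY \<in> P \<rightarrow>\<^sub>M ?U" by (rule measurable_Pair)
  have law: "distr P ?U ?XY = ?U"
    using distr_pair_disjoint_coords[OF c, of "{Inl (Mark i)}" "{Inr w}"] w by (simp add: distr_unif_component)
  have "emeasure P {z \<in> space P. z (Inr w) \<le> scan_bound n L p (z (Inl (Mark i)))} = emeasure (distr P ?U ?XY) ?D"
    using XY D by (subst emeasure_distr) (auto intro!: arg_cong2[where f=emeasure] simp: space_pair_measure)
  also have "\<dots> = (\<integral>\<^sup>+y. emeasure unit_uniform (Pair y -` ?D) \<partial>unit_uniform)"
    unfolding law by (rule sigma_finite_measure.emeasure_pair_measure_alt[OF sigma_finite_unit_uniform D])
  also have "\<dots> \<le> (\<integral>\<^sup>+y. ennreal (p * L) * ennreal (min (real n) (1 / y)) \<partial>unit_uniform)"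
  proof (rule nn_integral_mono)
    fix y :: real
    have "Pair y -` ?D = {..scan_bound n L p y}" by (auto simp: space_pair_measure)
    then have "emeasure unit_uniform (Pair y -` ?D) = ennreal (min 1 (scan_bound n L p y))"
      by (simp add: emeasure_unit_uniform_atMost)
    also have "\<dots> \<le> ennreal (p * L * min (real n) (1 / y))"
      unfolding scan_bound_def by (rule ennreal_leI) simp
    also have "\<dots> = ennreal (p * L) * ennreal (min (real n) (1 / y))"
      using p L by (intro ennreal_mult') auto
    finally show "emeasure unit_uniform (Pair y -` ?D) \<le> ennreal (p * L) * ennreal (min (real n) (1 / y))" .
  qed
  also have "\<dots> = ennreal (p * L) * (\<integral>\<^sup>+y. ennreal (min (real n) (1 / y)) \<partial>unit_uniform)"
  proof (rule nn_integral_cmult)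
    have "(\<lambda>y. ennreal (min (real n) (1 / y))) \<in> borel_measurable borel" by measurable
    then show "(\<lambda>y. ennreal (min (real n) (1 / y))) \<in> borel_measurable unit_uniform"
      by (simp cong: measurable_cong_sets)
  qed
  also have "\<dots> \<le> ennreal (p * L) * ennreal (1 + ln (real n))"
    using n_ge_2 by (intro mult_left_mono nn_integral_min_inverse) auto
  also have "\<dots> = ennreal (p * L * (1 + ln (real n)))"
    using p L by (intro ennreal_mult'[symmetric]) auto
  finally show ?thesis .
qed

section \<open>Decoupling a query from the event that its round is reached\<close>

definition others :: "nat \<Rightarrow> (nat \<times> nat) set" where
  "others v = {x \<in> slots. fst x \<noteq> v}"

lemma finite_others [simp]: "finite (others v)" and others_slots: "others v \<subseteq> slots"
  by (auto simp: others_def)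

text \<open>There are \<open>2 * m\<close> slots, and a vertex owns at most \<open>m\<close> of them
  because its incident edges are distinct.\<close>

lemma card_others: "m \<le> card (others v)"
proof -
  have "slots \<subseteq> others v \<union> Pair v ` {1..d v}" by (auto simp: others_def slots_def)
  then have "card slots \<le> card (others v \<union> Pair v ` {1..d v})" by (intro card_mono) auto
  also have "\<dots> \<le> card (others v) + card (Pair v ` {1..d v})" by (rule card_Un_le)
  also have "card (Pair v ` {1..d v}) \<le> d v" using card_image_le[of "{1..d v}" "Pair v"] by simp
  finally show ?thesis using card_slots card_oriented deg_le_m[of v] by simp
qed

lemma pred_val_ge: "x \<in> slots \<Longrightarrow> Measurable.pred P (\<lambda>z. b \<le> val \<tau> z x)"
  using measurable_val[of x \<tau>] unfolding pred_def by measurable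

lemma pred_few: "Measurable.pred P (\<lambda>z. card {x \<in> others v. b \<le> val \<tau> z x} < s)"
  by (rule pred_card_less) (auto intro!: pred_val_ge simp: others_def)

text \<open>This stands in for a tail bound on the number of large slots: an independent query of
  probability \<open>p\<close>, asked only while fewer than \<open>s\<close> values reach
  \<open>1 - p\<close>, is charged \<open>s / m\<close> whatever \<open>p\<close> is.\<close>

lemma few_others:
  assumes p: "0 \<le> p" "p \<le> 1"
  shows "ennreal p * emeasure P {z \<in> space P. card {x \<in> others v. 1 - p \<le> val \<tau> z x} < s} \<le> ennreal (real s / real m)"
proof -
  let ?e = "ennreal p * emeasure P {z \<in> space P. card {x \<in> others v. 1 - p \<le> val \<tau> z x} < s}"
  let ?B = "{x \<in> space (unif slots). card {e \<in> others v. 1 - p \<le> x e} < s}"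
  have "Measurable.pred (unif slots) (\<lambda>x. card {e \<in> others v. 1 - p \<le> x e} < s)"
  proof (rule pred_card_less)
    fix e assume "e \<in> others v"
    then have "(\<lambda>x. x e) \<in> borel_measurable (unif slots)" using others_slots by (intro measurable_unif_component) auto
    then show "Measurable.pred (unif slots) (\<lambda>x. 1 - p \<le> x e)" unfolding pred_def by measurable
  qed simp
  then have "?B \<in> sets (unif slots)" by (rule predE)
  from emeasure_val[OF this, of \<tau>]
  have "emeasure P {z \<in> space P. (\<lambda>x\<in>slots. val \<tau> z x) \<in> ?B} = emeasure (unif slots) ?B" .
  moreover have "{z \<in> space P. (\<lambda>x\<in>slots. val \<tau> z x) \<in> ?B} = {z \<in> space P. card {x \<in> others v. 1 - p \<le> val \<tau> z x} < s}"
  proof -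
    have "{x \<in> others v. 1 - p \<le> (\<lambda>x\<in>slots. val \<tau> z x) x} = {x \<in> others v. 1 - p \<le> val \<tau> z x}" for z
      using others_slots by auto
    then show ?thesis by (simp add: space_unif)
  qed
  ultimately have "of_nat (card (others v)) * ?e \<le> of_nat s"
    using few_large_coords[of "others v" slots p s] others_slots p by simp
  moreover have "of_nat m * ?e \<le> of_nat (card (others v)) * ?e"
    using card_others by (intro mult_right_mono) auto
  ultimately have "of_nat m * ?e \<le> of_nat s" by (rule order_trans[rotated])
  then have "ennreal (1 / real m) * (of_nat m * ?e) \<le> ennreal (1 / real m) * of_nat s" by (rule mult_left_mono) simp
  moreover have "ennreal (1 / real m) * (of_nat m * ?e) = ?e"
    using m_pos unfolding mult.assoc[symmetric] by (simp add: ennreal_of_nat_eq_real_of_nat flip: ennreal_mult)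
  moreover have "ennreal (1 / real m) * of_nat s = ennreal (real s / real m)"
    by (simp add: ennreal_of_nat_eq_real_of_nat flip: ennreal_mult)
  ultimately show ?thesis by simp
qed

lemma num_rounds_ge: "1 / 2 ^ num_rounds n \<le> real s / real m"
proof -
  have n0: "0 < real n" using n_ge_2 by simp
  have "real m \<le> (real n)\<^sup>2" using m_le by (metis of_nat_le_iff of_nat_power)
  also have "\<dots> = 2 powr (2 * log 2 (real n))"
  proof -
    have "2 powr (2 * log 2 (real n)) = (2 powr log 2 (real n)) powr 2" by (simp only: powr_powr mult.commute)
    also have "\<dots> = (real n)\<^sup>2" using n0 by simp
    finally show ?thesis ..
  qed
  also have "\<dots> \<le> 2 powr real (num_rounds n)"
    unfolding num_rounds_def by (intro powr_mono) (auto simp: real_nat_ceiling_ge)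
  also have "\<dots> = 2 ^ num_rounds n" by (simp add: powr_realpow)
  finally have "1 / 2 ^ num_rounds n \<le> 1 / real m" using m_pos by (intro divide_left_mono) auto
  also have "\<dots> \<le> real s / real m" using s_pos by (intro divide_right_mono) auto
  finally show ?thesis .
qed

text \<open>By \<open>ln 2 \<ge> 2 / 3\<close>, \<open>2 * log 2 n\<close> is at most
  \<open>3 * ln n\<close>. Rounding up and the final round add at most 2, again at most
  \<open>3 * ln n\<close> because \<open>n\<close> is at least 2.\<close>

lemma num_rounds_le: "real (num_rounds n) + 1 \<le> 6 * ln (real n)"
proof -
  have n2: "2 \<le> real n" using n_ge_2 by simp
  then have l2: "2 / 3 \<le> ln (real n)" using ln2_ge_two_thirds ln_mono[of 2 "real n"] by linarith
  have "0 \<le> 2 * log 2 (real n)" using n2 by simp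
  then have "real (num_rounds n) \<le> 2 * log 2 (real n) + 1" unfolding num_rounds_def by linarith
  also have "log 2 (real n) = ln (real n) / ln 2" by (simp add: log_def)
  also have "\<dots> \<le> ln (real n) / (2 / 3)" using l2 ln2_ge_two_thirds by (intro divide_left_mono) auto
  finally show ?thesis using l2 by simp
qed

text \<open>On the hit event this follows from reaching round \<open>g\<close>: either it is the
  first round, or round \<open>Suc g\<close> found fewer than \<open>s\<close> slots. Counting only
  the slots away from \<open>v\<close> makes it independent of the block of
  \<open>v\<close>.\<close>

definition gate :: "real \<Rightarrow> nat \<Rightarrow> nat \<Rightarrow> (coin + nat \<Rightarrow> real) \<Rightarrow> bool" where
  "gate \<tau> g v z \<longleftrightarrow> g = num_rounds n \<or> card {x \<in> others v. 1 - 1 / 2 ^ Suc g \<le> val \<tau> z x} < s"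

lemma pred_gate: "Measurable.pred P (gate \<tau> g v)"
proof -
  note [measurable] = pred_few[of v "1 - 1 / 2 ^ Suc g" \<tau>]
  show ?thesis unfolding gate_def[abs_def] by measurable
qed

lemma gate_cong:
  assumes "\<And>k. k \<in> (\<Union>w\<in>verts G - {v}. block w) \<Longrightarrow> z k = z' k"
  shows "gate \<tau> g v z = gate \<tau> g v z'"
proof -
  have "val \<tau> z x = val \<tau> z' x" if "x \<in> others v" for x
  proof -
    obtain w j where x: "x = (w, j)" "w \<in> verts G" "w \<noteq> v" using \<open>x \<in> others v\<close> by (auto simp: others_def slots_def)
    show ?thesis unfolding x(1) by (rule val_cong) (use assms x in blast)
  qed
  then have "{x \<in> others v. 1 - 1 / 2 ^ Suc g \<le> val \<tau> z x} = {x \<in> others v. 1 - 1 / 2 ^ Suc g \<le> val \<tau> z' x}" by auto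
  then show ?thesis unfolding gate_def by presburger
qed

text \<open>The \<open>p\<close> of round \<open>g\<close> is twice that of the round before, which
  explains the factor 2 in front of the bound from \<open>few_others\<close>. The first round has no
  predecessor, but there \<open>1 / 2 ^ g\<close> is itself at most \<open>s / m\<close>.\<close>

lemma emeasure_gated:
  assumes I: "Measurable.pred P I" "C \<subseteq> K" "C \<inter> (\<Union>w\<in>verts G - {v}. block w) = {}"
    and IC: "\<And>z z'. (\<And>k. k \<in> C \<Longrightarrow> z k = z' k) \<Longrightarrow> I z = I z'"
    and r: "0 \<le> r" "emeasure P {z \<in> space P. I z} \<le> ennreal (r * (1 / 2 ^ g))"
  shows "emeasure P {z \<in> space P. I z \<and> gate \<tau> g v z} \<le> ennreal (2 * r * (real s / real m))"
proof (cases "g = num_rounds n")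
  case True
  have "emeasure P {z \<in> space P. I z \<and> gate \<tau> g v z} \<le> emeasure P {z \<in> space P. I z}"
    using predE[OF I(1)] by (intro emeasure_mono) auto
  also have "\<dots> \<le> ennreal (r * (1 / 2 ^ g))" by (rule r)
  also have "\<dots> \<le> ennreal (2 * r * (real s / real m))"
  proof (rule ennreal_leI)
    have "r * (1 / 2 ^ g) \<le> r * (real s / real m)"
      using num_rounds_ge r unfolding True by (intro mult_left_mono) auto
    moreover have "0 \<le> r * (real s / real m)" using r by simp
    ultimately show "r * (1 / 2 ^ g) \<le> 2 * r * (real s / real m)" by linarith
  qed
  finally show ?thesis .
next
  case False
  let ?p = "1 / 2 ^ Suc g :: real"
  let ?N = "\<lambda>z. card {x \<in> others v. 1 - ?p \<le> val \<tau> z x} < s"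
  have p: "0 \<le> ?p" "?p \<le> 1" by (simp_all add: one_le_power del: power_Suc)
  have gate: "gate \<tau> g v z = ?N z" for z using False by (simp add: gate_def)
  have "emeasure P {z \<in> space P. I z \<and> gate \<tau> g v z} = emeasure P {z \<in> space P. I z} * emeasure P {z \<in> space P. gate \<tau> g v z}"
  proof (rule emeasure_Int_disjoint_coords[where A = C])
    show "(\<Union>w\<in>verts G - {v}. block w) \<subseteq> K" using block_sub by blast
    show "I z = I z'" if "\<And>k. k \<in> C \<Longrightarrow> z k = z' k" for z z' by (rule IC) (rule that)
    show "gate \<tau> g v z = gate \<tau> g v z'" if "\<And>k. k \<in> (\<Union>w\<in>verts G - {v}. block w) \<Longrightarrow> z k = z' k" for z z'
      by (rule gate_cong) (rule that)
  qed (fact I pred_gate)+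
  also have "\<dots> \<le> ennreal (r * (1 / 2 ^ g)) * emeasure P {z \<in> space P. gate \<tau> g v z}"
    using r by (intro mult_right_mono) auto
  also have "ennreal (r * (1 / 2 ^ g)) = ennreal (2 * r) * ennreal ?p"
    using r by (simp flip: ennreal_mult)
  also have "ennreal (2 * r) * ennreal ?p * emeasure P {z \<in> space P. gate \<tau> g v z} =
      ennreal (2 * r) * (ennreal ?p * emeasure P {z \<in> space P. ?N z})"
    by (simp only: gate mult.assoc)
  also have "\<dots> \<le> ennreal (2 * r) * ennreal (real s / real m)"
    using few_others[OF p] by (intro mult_left_mono) auto
  also have "\<dots> = ennreal (2 * r * (real s / real m))" using r by (intro ennreal_mult[symmetric]) auto
  finally show ?thesis .
qed

section \<open>Deterministic bounds on the cost\<close>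

definition adjacent :: "(nat \<times> nat) set" where
  "adjacent = Sigma {1..n} (\<lambda>i. neighbors G (va i))"

lemma finite_adjacent [simp]: "finite adjacent"
  by (simp add: adjacent_def)

lemma card_adjacent: "card adjacent = 2 * m"
proof -
  have "card adjacent = (\<Sum>i\<in>{1..n}. d (va i))" by (simp add: adjacent_def card_SigmaI deg_def)
  also have "\<dots> = (\<Sum>v\<in>verts G. d v)" using va_bij by (rule sum.reindex_bij_betw)
  finally show ?thesis by (simp add: sum_deg)
qed

text \<open>The weights: a light cell asks for vertex, degree and neighbor; a marked vertex asks for
  vertex, degree and the two queries at the neighbor that ends its scan; a neighbor within the bound
  costs two queries in the scan and a degree query later; a large slot of a discovered heavy vertex
  costs one neighbor query.\<close>

lemma search_cost_le:
  "search_cost \<tau> L p z \<le>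
    3 * card {c \<in> {1..n} \<times> {1..nat \<lfloor>\<tau>\<rfloor>}. 1 - p \<le> z (Inl (Light (fst c) (snd c)))} +
    4 * card {i \<in> {1..n}. z (Inl (Mark i)) \<le> L / \<tau>} +
    3 * card {c \<in> adjacent. z (Inr (snd c)) \<le> scan_bound n L p (z (Inl (Mark (fst c))))} +
    card {x \<in> slots. 1 - p \<le> val \<tau> z x}" (is "_ \<le> 3 * card ?C + 4 * card ?M + 3 * card ?A + card ?X")
proof -
  have "light_cost \<tau> p z \<le> (\<Sum>c\<in>{1..n} \<times> {1..nat \<lfloor>\<tau>\<rfloor>}. if 1 - p \<le> z (Inl (Light (fst c) (snd c))) then 3 else 0)"
    unfolding light_cost_def by (intro sum_mono) auto
  also have "\<dots> = 3 * card ?C" by (subst sum.inter_filter[symmetric]) auto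
  finally have 1: "light_cost \<tau> p z \<le> 3 * card ?C" .
  let ?N = "\<lambda>i. {w \<in> neighbors G (va i). z (Inr w) \<le> scan_bound n L p (z (Inl (Mark i)))}"
  have A: "?A = Sigma {1..n} ?N" by (auto simp: adjacent_def)
  have cA: "card ?A = (\<Sum>i\<in>{1..n}. card (?N i))" unfolding A by (simp add: card_SigmaI)
  have "scan_cost \<tau> L p z \<le> (\<Sum>i\<in>{1..n}. (if z (Inl (Mark i)) \<le> L / \<tau> then 4 else 0) + 2 * card (?N i))"
    unfolding scan_cost_def by (intro sum_mono) (auto intro: order_trans[OF mult_le_mono2[OF min.cobounded2]])
  also have "\<dots> = (\<Sum>i\<in>{1..n}. if z (Inl (Mark i)) \<le> L / \<tau> then 4 else 0) + 2 * card ?A"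
    by (simp add: sum.distrib cA sum_distrib_left)
  also have "(\<Sum>i\<in>{1..n}. if z (Inl (Mark i)) \<le> L / \<tau> then 4 else 0) = 4 * card ?M"
    by (subst sum.inter_filter[symmetric]) auto
  finally have 2: "scan_cost \<tau> L p z \<le> 4 * card ?M + 2 * card ?A" .
  let ?F = "{v \<in> verts G. found \<tau> L p z v}"
  have "?F \<subseteq> snd ` ?A" by (force simp: found_def A)
  then have F: "card ?F \<le> card ?A" by (intro surj_card_le) auto
  have X: "?X = Sigma (verts G) (\<lambda>v. {j \<in> {1..d v}. 1 - p \<le> val \<tau> z (v, j)})" by (auto simp: slots_def)
  have "heavy_cost \<tau> L p z \<le> (\<Sum>v\<in>?F. 1 + card {j \<in> {1..d v}. 1 - p \<le> val \<tau> z (v, j)})"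
    unfolding heavy_cost_def by (intro sum_mono) auto
  also have "\<dots> = card ?F + (\<Sum>v\<in>?F. card {j \<in> {1..d v}. 1 - p \<le> val \<tau> z (v, j)})" by (subst sum.distrib) simp
  also have "\<dots> \<le> card ?A + (\<Sum>v\<in>verts G. card {j \<in> {1..d v}. 1 - p \<le> val \<tau> z (v, j)})"
    using F by (intro add_mono sum_mono2) auto
  also have "(\<Sum>v\<in>verts G. card {j \<in> {1..d v}. 1 - p \<le> val \<tau> z (v, j)}) = card ?X" unfolding X by (simp add: card_SigmaI)
  finally have 3: "heavy_cost \<tau> L p z \<le> card ?A + card ?X" .
  from 1 2 3 show ?thesis by (simp add: search_cost_def)
qed

text \<open>Each of the four counts is at most \<open>n^2\<close>, and their weights 3, 4, 3 and 1
  add up to 11.\<close>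

lemma search_cost_le_worst:
  assumes "\<tau> \<le> real n"
  shows "search_cost \<tau> L p z \<le> 11 * n\<^sup>2"
proof -
  have m2: "m \<le> n * n" using m_le by (simp add: power2_eq_square)
  have "nat \<lfloor>\<tau>\<rfloor> \<le> n" using assms by linarith
  then have "card ({1..n} \<times> {1..nat \<lfloor>\<tau>\<rfloor>}) \<le> n * n" by simp
  then have 1: "card {c \<in> {1..n} \<times> {1..nat \<lfloor>\<tau>\<rfloor>}. 1 - p \<le> z (Inl (Light (fst c) (snd c)))} \<le> n * n"
    by (rule order_trans[OF card_mono, rotated 2]) auto
  have "card {i \<in> {1..n}. z (Inl (Mark i)) \<le> L / \<tau>} \<le> card {1..n}" by (intro card_mono) auto
  then have 2: "card {i \<in> {1..n}. z (Inl (Mark i)) \<le> L / \<tau>} \<le> n * n" using le_square[of n] unfolding card_atLeastAtMost by linarith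
  have "card {c \<in> adjacent. z (Inr (snd c)) \<le> scan_bound n L p (z (Inl (Mark (fst c))))} \<le> card adjacent" by (intro card_mono) auto
  moreover have "2 * m \<le> n * n"
  proof -
    have "2 * m \<le> (\<Sum>v\<in>verts G. n)" unfolding sum_deg[symmetric] using deg_le by (intro sum_mono) (auto dest: Suc_leD)
    then show ?thesis by (simp add: card_verts)
  qed
  ultimately have 3: "card {c \<in> adjacent. z (Inr (snd c)) \<le> scan_bound n L p (z (Inl (Mark (fst c))))} \<le> n * n"
    by (simp add: card_adjacent)
  have "card {x \<in> slots. 1 - p \<le> val \<tau> z x} \<le> card slots" by (intro card_mono) auto
  then have 4: "card {x \<in> slots. 1 - p \<le> val \<tau> z x} \<le> n * n"
    using \<open>2 * m \<le> n * n\<close> by (simp add: card_slots card_oriented)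
  show ?thesis using search_cost_le[of \<tau> L p z] 1 2 3 4 unfolding power2_eq_square by linarith
qed

text \<open>Of the condition for reaching a round, only the failure of the round immediately before
  it is kept.\<close>

lemma rounds_cost_le:
  "rounds_cost \<tau> L z g \<le> (\<Sum>k\<in>{0..g}. if k = g \<or> card (active \<tau> L (1 / 2 ^ Suc k) z) < s then search_cost \<tau> L (1 / 2 ^ k) z else 0)"
proof (induction g)
  case (Suc g)
  let ?f = "\<lambda>k. if card (active \<tau> L (1 / 2 ^ Suc k) z) < s then search_cost \<tau> L (1 / 2 ^ k) z else 0"
  let ?f' = "\<lambda>g k. if k = g \<or> card (active \<tau> L (1 / 2 ^ Suc k) z) < s then search_cost \<tau> L (1 / 2 ^ k) z else 0"
  have "(if s \<le> card (active \<tau> L (1 / 2 ^ Suc g) z) then 0 else rounds_cost \<tau> L z g) \<le> (\<Sum>k\<in>{0..g}. ?f' (Suc g) k)"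
  proof (cases "s \<le> card (active \<tau> L (1 / 2 ^ Suc g) z)")
    case False
    note Suc.IH
    also have "(\<Sum>k\<in>{0..g}. ?f' g k) \<le> (\<Sum>k\<in>{0..g}. ?f' (Suc g) k)"
      using False by (intro sum_mono) auto
    finally show ?thesis using False by (simp del: power_Suc)
  qed simp
  then show ?case by (simp del: power_Suc)
qed simp

end

section \<open>Expected cost of one round\<close>

lemma nn_integral_sum_of_bool_le:
  assumes A: "finite A" and Q: "\<And>a. a \<in> A \<Longrightarrow> Measurable.pred M (Q a)"
    and e: "\<And>a. a \<in> A \<Longrightarrow> emeasure M {z \<in> space M. Q a z} \<le> e"
  shows "(\<integral>\<^sup>+z. (\<Sum>a\<in>A. of_bool (Q a z)) \<partial>M) \<le> of_nat (card A) * e"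
proof -
  have "(\<integral>\<^sup>+z. (\<Sum>a\<in>A. of_bool (Q a z)) \<partial>M) = (\<Sum>a\<in>A. \<integral>\<^sup>+z. of_bool (Q a z) \<partial>M)"
    using Q by (intro nn_integral_sum measurable_of_bool) auto
  also have "\<dots> = (\<Sum>a\<in>A. emeasure M {z \<in> space M. Q a z})"
    using Q by (intro sum.cong refl nn_integral_of_bool) auto
  also have "\<dots> \<le> (\<Sum>a\<in>A. e)" using e by (intro sum_mono)
  finally show ?thesis by simp
qed

lemma sum_of_bool_card: "finite A \<Longrightarrow> (\<Sum>a\<in>A. of_bool (Q a)) = (of_nat (card {a \<in> A. Q a}) :: ennreal)"
  by (simp add: of_bool_def sum.If_cases Int_def)

context graph_run
begin

text \<open>Covers both cases: gated counts if the marks hit, the worst case if they do not. The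
  number of marked vertices carries no gate, since its mean \<open>n * L / \<tau>\<close> is
  affordable in every round. Each gate leaves out the vertex whose coins or hash value trigger the
  query.\<close>

definition round_bound :: "real \<Rightarrow> real \<Rightarrow> nat \<Rightarrow> (coin + nat \<Rightarrow> real) \<Rightarrow> ennreal" where
  "round_bound \<tau> L k z =
     4 * (\<Sum>i\<in>{1..n}. of_bool (z (Inl (Mark i)) \<le> L / \<tau>)) +
     3 * (\<Sum>c\<in>{1..n} \<times> {1..nat \<lfloor>\<tau>\<rfloor>}. of_bool (1 - 1 / 2 ^ k \<le> z (Inl (Light (fst c) (snd c))) \<and> gate \<tau> k (va (fst c)) z)) +
     3 * (\<Sum>c\<in>adjacent. of_bool (z (Inr (snd c)) \<le> scan_bound n L (1 / 2 ^ k) (z (Inl (Mark (fst c)))) \<and> gate \<tau> k (snd c) z)) +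
     (\<Sum>x\<in>slots. of_bool (1 - 1 / 2 ^ k \<le> val \<tau> z x \<and> gate \<tau> k (fst x) z)) +
     of_nat (11 * n\<^sup>2) * of_bool (\<not> hit L z)"

lemma rounds_cost_le_round_bound:
  assumes z: "regular z" and \<tau>: "0 < \<tau>" "\<tau> \<le> real n" and L: "1 \<le> L"
  shows "of_nat (rounds_cost \<tau> L z (num_rounds n)) \<le> (\<Sum>k\<in>{0..num_rounds n}. round_bound \<tau> L k z)"
proof -
  let ?c = "\<lambda>k. k = num_rounds n \<or> card (active \<tau> L (1 / 2 ^ Suc k) z) < s"
  have each: "of_nat (if ?c k then search_cost \<tau> L (1 / 2 ^ k) z else 0) \<le> round_bound \<tau> L k z" for k
  proof (cases "?c k")
    case c: True
    show ?thesis
    proof (cases "hit L z")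
      case True
      have act: "active \<tau> L (1 / 2 ^ Suc k) z = {x \<in> slots. 1 - 1 / 2 ^ Suc k \<le> val \<tau> z x}"
        by (rule active_eq[OF z True \<tau>(1) L]) (simp_all add: one_le_power del: power_Suc)
      \<comment> \<open>Unless this is the first round, the preceding one found fewer than
        \<open>s\<close> active slots; on the hit event these are all slots above its level, and
        leaving out \<open>v\<close> only lowers the count.\<close>
      have gate: "gate \<tau> k v z" for v
      proof -
        have "card {x \<in> others v. 1 - 1 / 2 ^ Suc k \<le> val \<tau> z x} \<le> card (active \<tau> L (1 / 2 ^ Suc k) z)"
          unfolding act using others_slots by (intro card_mono) auto
        then show ?thesis using c unfolding gate_def by linarith
      qed
      have "of_nat (search_cost \<tau> L (1 / 2 ^ k) z) \<le> (of_nat (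
        3 * card {c \<in> {1..n} \<times> {1..nat \<lfloor>\<tau>\<rfloor>}. 1 - 1 / 2 ^ k \<le> z (Inl (Light (fst c) (snd c)))} +
        4 * card {i \<in> {1..n}. z (Inl (Mark i)) \<le> L / \<tau>} +
        3 * card {c \<in> adjacent. z (Inr (snd c)) \<le> scan_bound n L (1 / 2 ^ k) (z (Inl (Mark (fst c))))} +
        card {x \<in> slots. 1 - 1 / 2 ^ k \<le> val \<tau> z x}) :: ennreal)"
        by (rule of_nat_mono) (rule search_cost_le)
      also have "\<dots> = round_bound \<tau> L k z"
        unfolding round_bound_def using True by (simp add: gate sum_of_bool_card add_ac del: sum_of_bool_eq)
      finally show ?thesis using c by simp
    next
      case False
      have "of_nat (search_cost \<tau> L (1 / 2 ^ k) z) \<le> (of_nat (11 * n\<^sup>2) :: ennreal)"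
        by (rule of_nat_mono) (rule search_cost_le_worst[OF \<tau>(2)])
      also have "\<dots> \<le> round_bound \<tau> L k z"
        unfolding round_bound_def using False by (intro add_increasing) auto
      finally show ?thesis using c by simp
    qed
  qed simp
  have "of_nat (rounds_cost \<tau> L z (num_rounds n)) \<le> (of_nat (\<Sum>k\<in>{0..num_rounds n}. if ?c k then search_cost \<tau> L (1 / 2 ^ k) z else 0) :: ennreal)"
    by (rule of_nat_mono) (rule rounds_cost_le)
  also have "\<dots> = (\<Sum>k\<in>{0..num_rounds n}. of_nat (if ?c k then search_cost \<tau> L (1 / 2 ^ k) z else 0))" by (rule of_nat_sum)
  also have "\<dots> \<le> (\<Sum>k\<in>{0..num_rounds n}. round_bound \<tau> L k z)" by (intro sum_mono each)
  finally show ?thesis .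
qed

text \<open>Index and threshold coins do not occur here, so for a fixed threshold the bound is
  independent of the stopping time.\<close>

lemma round_bound_cong:
  assumes "\<And>k. k \<in> range (\<lambda>i. Inl (Mark i)) \<union> (\<Union>v\<in>verts G. block v) \<Longrightarrow> z k = z' k"
  shows "round_bound \<tau> L k z = round_bound \<tau> L k z'"
proof -
  have mark: "z (Inl (Mark i)) = z' (Inl (Mark i))" for i using assms by blast
  have hash: "z (Inr w) = z' (Inr w)" if "w \<in> verts G" for w
    using assms that by (auto simp: block_def)
  have light: "z (Inl (Light i j)) = z' (Inl (Light i j))" if "i \<in> {1..n}" for i j
  proof -
    have "Inl (Light i j) \<in> block (va i)" using that by (simp add: block_def)
    moreover have "va i \<in> verts G" using that by simp
    ultimately show ?thesis by (intro assms) blast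
  qed
  have val: "val \<tau> z x = val \<tau> z' x" if "x \<in> slots" for x
  proof -
    obtain v j where x: "x = (v, j)" "v \<in> verts G" using \<open>x \<in> slots\<close> by (auto simp: slots_def)
    show ?thesis unfolding x(1) by (rule val_cong) (use assms x in blast)
  qed
  have gate: "gate \<tau> k v z = gate \<tau> k v z'" for v
    by (rule gate_cong) (use assms in blast)
  have hit: "hit L z = hit L z'" by (rule hit_cong) (rule mark)
  have adj: "snd c \<in> verts G" if "c \<in> adjacent" for c using that neighbors_verts by (auto simp: adjacent_def)
  show ?thesis unfolding round_bound_def
    by (intro arg_cong2[where f="(+)"] arg_cong2[where f="(*)"] sum.cong refl)
      (auto simp: mark light gate hit val hash adj)
qed

lemma pred_light: "Measurable.pred P (\<lambda>z. b \<le> z (Inl (Light i j)))"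
  and pred_mark: "Measurable.pred P (\<lambda>z. z (Inl (Mark i)) \<le> b)"
  by measurable

lemma pred_scan: "w \<in> verts G \<Longrightarrow> Measurable.pred P (\<lambda>z. z (Inr w) \<le> scan_bound n L p (z (Inl (Mark i))))"
proof -
  assume w: "w \<in> verts G"
  have "(\<lambda>z. scan_bound n L p (z (Inl (Mark i)))) \<in> borel_measurable P"
    unfolding scan_bound_def by measurable
  with measurable_hash[OF w] show ?thesis unfolding pred_def by (rule borel_measurable_le)
qed

lemma round_bound_preds:
  "Measurable.pred P (\<lambda>z. 1 - 1 / 2 ^ k \<le> z (Inl (Light (fst c) (snd c))) \<and> gate \<tau> k (va (fst c)) z)"
  "c \<in> adjacent \<Longrightarrow> Measurable.pred P (\<lambda>z. z (Inr (snd c)) \<le> scan_bound n L (1 / 2 ^ k) (z (Inl (Mark (fst c)))) \<and> gate \<tau> k (snd c) z)"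
  "x \<in> slots \<Longrightarrow> Measurable.pred P (\<lambda>z. 1 - 1 / 2 ^ k \<le> val \<tau> z x \<and> gate \<tau> k (fst x) z)"
  "Measurable.pred P (\<lambda>z. \<not> hit L z)"
proof -
  show "Measurable.pred P (\<lambda>z. 1 - 1 / 2 ^ k \<le> z (Inl (Light (fst c) (snd c))) \<and> gate \<tau> k (va (fst c)) z)"
    using pred_light pred_gate by (rule pred_intros_logic)
  show "c \<in> adjacent \<Longrightarrow> Measurable.pred P (\<lambda>z. z (Inr (snd c)) \<le> scan_bound n L (1 / 2 ^ k) (z (Inl (Mark (fst c)))) \<and> gate \<tau> k (snd c) z)"
    using neighbors_verts by (intro pred_intros_logic pred_scan pred_gate) (auto simp: adjacent_def)
  show "x \<in> slots \<Longrightarrow> Measurable.pred P (\<lambda>z. 1 - 1 / 2 ^ k \<le> val \<tau> z x \<and> gate \<tau> k (fst x) z)"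
    by (intro pred_intros_logic pred_val_ge pred_gate)
  show "Measurable.pred P (\<lambda>z. \<not> hit L z)" by measurable
qed

lemma measurable_round_bound: "round_bound \<tau> L k \<in> borel_measurable P"
  unfolding round_bound_def[abs_def]
  by (intro borel_measurable_add borel_measurable_times_ennreal borel_measurable_const borel_measurable_sum
    measurable_of_bool round_bound_preds pred_mark; assumption?)

text \<open>Kept as a function of the stopping time \<open>t\<close>. With
  \<open>\<tau> = n / (t * sqrt s)\<close> the marked vertices give the term linear in
  \<open>t\<close> and the light cells the term in \<open>1 / t\<close>; scanned neighbors, large
  slots and the failure event give the last three.\<close>

definition round_mean :: "real \<Rightarrow> real \<Rightarrow> real" where
  "round_mean L t = 4 * L * sqrt (real s) * t + 6 * ((real n)\<^sup>2 * sqrt (real s) / real m) / t +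
     12 * L * (1 + ln (real n)) * real s + 4 * real s + 11"

lemma nn_integral_round_bound:
  assumes \<delta>: "0 < \<delta>" "\<delta> < 1" and t: "1 \<le> t"
  shows "(\<integral>\<^sup>+z. round_bound (light_bound n s t) (mark_rate n \<delta>) k z \<partial>P) \<le> ennreal (round_mean (mark_rate n \<delta>) (real t))"
proof -
  let ?\<tau> = "light_bound n s t" and ?L = "mark_rate n \<delta>" and ?q = "real s / real m"
  have n0: "0 < real n" and m0: "0 < real m" and s0: "0 < real s" and t0: "0 < real t" using n_ge_2 m_pos s_pos t by auto
  have L: "1 \<le> ?L" by (rule mark_rate_ge_1[OF \<delta>])
  have \<tau>: "0 < ?\<tau>" using t by (rule light_bound_pos)
  have ln0: "0 \<le> ln (real n)" using n_ge_2 by simp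
  have p: "0 \<le> (1 / 2 ^ k :: real)" "(1 / 2 ^ k :: real) \<le> 1" by (simp_all add: one_le_power)
  have b1: "(\<integral>\<^sup>+z. (\<Sum>i\<in>{1..n}. of_bool (z (Inl (Mark i)) \<le> ?L / ?\<tau>)) \<partial>P) \<le> ennreal (real n * (?L / ?\<tau>))"
  proof -
    have "(\<integral>\<^sup>+z. (\<Sum>i\<in>{1..n}. of_bool (z (Inl (Mark i)) \<le> ?L / ?\<tau>)) \<partial>P) \<le> of_nat (card {1..n}) * ennreal (?L / ?\<tau>)"
    proof (rule nn_integral_sum_of_bool_le)
      fix i
      have "emeasure P {z \<in> space P. z (Inl (Mark i)) \<le> ?L / ?\<tau>} = ennreal (min 1 (?L / ?\<tau>))"
        using emeasure_unif_component[of "Inl (Mark i)" K "{..?L / ?\<tau>}"] by (simp add: emeasure_unit_uniform_atMost)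
      also have "\<dots> \<le> ennreal (?L / ?\<tau>)" by (rule ennreal_leI) simp
      finally show "emeasure P {z \<in> space P. z (Inl (Mark i)) \<le> ?L / ?\<tau>} \<le> ennreal (?L / ?\<tau>)" .
    qed (auto intro: pred_mark)
    then show ?thesis using L \<tau> by (simp add: ennreal_of_nat_eq_real_of_nat flip: ennreal_mult)
  qed
  have b2: "(\<integral>\<^sup>+z. (\<Sum>c\<in>{1..n} \<times> {1..nat \<lfloor>?\<tau>\<rfloor>}. of_bool (1 - 1 / 2 ^ k \<le> z (Inl (Light (fst c) (snd c))) \<and> gate ?\<tau> k (va (fst c)) z)) \<partial>P)
      \<le> ennreal (real n * ?\<tau> * (2 * ?q))"
  proof -
    have "(\<integral>\<^sup>+z. (\<Sum>c\<in>{1..n} \<times> {1..nat \<lfloor>?\<tau>\<rfloor>}. of_bool (1 - 1 / 2 ^ k \<le> z (Inl (Light (fst c) (snd c))) \<and> gate ?\<tau> k (va (fst c)) z)) \<partial>P)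
      \<le> of_nat (card ({1..n} \<times> {1..nat \<lfloor>?\<tau>\<rfloor>})) * ennreal (2 * 1 * ?q)"
    proof (rule nn_integral_sum_of_bool_le)
      fix c assume c: "c \<in> {1..n} \<times> {1..nat \<lfloor>?\<tau>\<rfloor>}"
      let ?i = "fst c" and ?j = "snd c"
      show "emeasure P {z \<in> space P. 1 - 1 / 2 ^ k \<le> z (Inl (Light ?i ?j)) \<and> gate ?\<tau> k (va ?i) z} \<le> ennreal (2 * 1 * ?q)"
      \<comment> \<open>The coin of a cell lies in the block of the vertex with that index, which is
        the vertex left out by the gate.\<close>
      proof (rule emeasure_gated[where C = "{Inl (Light ?i ?j)}"])
        show "{Inl (Light ?i ?j)} \<inter> (\<Union>w\<in>verts G - {va ?i}. block w) = {}"
          by (auto simp: block_def)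
        show "emeasure P {z \<in> space P. 1 - 1 / 2 ^ k \<le> z (Inl (Light ?i ?j))} \<le> ennreal (1 * (1 / 2 ^ k))"
          using emeasure_unif_component[of "Inl (Light ?i ?j)" K "{1 - 1 / 2 ^ k..}"] p by (simp add: emeasure_unit_uniform_atLeast)
      qed (auto intro: pred_light)
      show "Measurable.pred P (\<lambda>z. 1 - 1 / 2 ^ k \<le> z (Inl (Light ?i ?j)) \<and> gate ?\<tau> k (va ?i) z)"
        by (rule round_bound_preds)
    qed auto
    also have "\<dots> = ennreal (real n * real (nat \<lfloor>?\<tau>\<rfloor>) * (2 * ?q))"
      by (simp add: ennreal_of_nat_eq_real_of_nat flip: ennreal_mult)
    also have "\<dots> \<le> ennreal (real n * ?\<tau> * (2 * ?q))"
    proof (intro ennreal_leI mult_right_mono mult_left_mono)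
      show "real (nat \<lfloor>?\<tau>\<rfloor>) \<le> ?\<tau>" using \<tau> by (intro of_nat_floor) simp
    qed auto
    finally show ?thesis .
  qed
  have b3: "(\<integral>\<^sup>+z. (\<Sum>c\<in>adjacent. of_bool (z (Inr (snd c)) \<le> scan_bound n ?L (1 / 2 ^ k) (z (Inl (Mark (fst c)))) \<and> gate ?\<tau> k (snd c) z)) \<partial>P)
      \<le> ennreal (2 * real m * (2 * (?L * (1 + ln (real n))) * ?q))"
  proof -
    have "(\<integral>\<^sup>+z. (\<Sum>c\<in>adjacent. of_bool (z (Inr (snd c)) \<le> scan_bound n ?L (1 / 2 ^ k) (z (Inl (Mark (fst c)))) \<and> gate ?\<tau> k (snd c) z)) \<partial>P)
      \<le> of_nat (card adjacent) * ennreal (2 * (?L * (1 + ln (real n))) * ?q)"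
    proof (rule nn_integral_sum_of_bool_le)
      fix c assume c: "c \<in> adjacent"
      let ?i = "fst c" and ?w = "snd c"
      have w: "?w \<in> verts G" using c neighbors_verts by (auto simp: adjacent_def)
      show "emeasure P {z \<in> space P. z (Inr ?w) \<le> scan_bound n ?L (1 / 2 ^ k) (z (Inl (Mark ?i))) \<and> gate ?\<tau> k ?w z} \<le> ennreal (2 * (?L * (1 + ln (real n))) * ?q)"
      \<comment> \<open>The event reads the hash value of the vertex found, on which the slot values
        of that vertex depend, so the gate leaves out \<open>?w\<close> and not the scanning vertex;
        marks lie in no block.\<close>
      proof (rule emeasure_gated[where C = "{Inr ?w, Inl (Mark ?i)}"])
        show "{Inr ?w, Inl (Mark ?i)} \<inter> (\<Union>v\<in>verts G - {?w}. block v) = {}" by (auto simp: block_def)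
        show "emeasure P {z \<in> space P. z (Inr ?w) \<le> scan_bound n ?L (1 / 2 ^ k) (z (Inl (Mark ?i)))} \<le> ennreal (?L * (1 + ln (real n)) * (1 / 2 ^ k))"
          using emeasure_scan[OF w p(1), of ?L ?i] L by (simp add: mult_ac)
      qed (use w L ln0 in \<open>auto intro: pred_scan\<close>)
      show "Measurable.pred P (\<lambda>z. z (Inr ?w) \<le> scan_bound n ?L (1 / 2 ^ k) (z (Inl (Mark ?i))) \<and> gate ?\<tau> k ?w z)"
        using c by (rule round_bound_preds)
    qed auto
    then show ?thesis using L ln0 by (simp add: card_adjacent ennreal_of_nat_eq_real_of_nat flip: ennreal_mult)
  qed
  have b4: "(\<integral>\<^sup>+z. (\<Sum>x\<in>slots. of_bool (1 - 1 / 2 ^ k \<le> val ?\<tau> z x \<and> gate ?\<tau> k (fst x) z)) \<partial>P) \<le> ennreal (2 * real m * (2 * ?q))"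
  proof -
    have "(\<integral>\<^sup>+z. (\<Sum>x\<in>slots. of_bool (1 - 1 / 2 ^ k \<le> val ?\<tau> z x \<and> gate ?\<tau> k (fst x) z)) \<partial>P) \<le> of_nat (card slots) * ennreal (2 * 1 * ?q)"
    proof (rule nn_integral_sum_of_bool_le)
      fix x assume x: "x \<in> slots"
      then have v: "fst x \<in> verts G" by (auto simp: slots_def)
      show "emeasure P {z \<in> space P. 1 - 1 / 2 ^ k \<le> val ?\<tau> z x \<and> gate ?\<tau> k (fst x) z} \<le> ennreal (2 * 1 * ?q)"
      proof (rule emeasure_gated[where C = "block (fst x)"])
        show "block (fst x) \<subseteq> K" using v by (rule block_sub)
        show "block (fst x) \<inter> (\<Union>w\<in>verts G - {fst x}. block w) = {}" using block_disjoint[OF v] by blast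
        show "Measurable.pred P (\<lambda>z. 1 - 1 / 2 ^ k \<le> val ?\<tau> z x)" using x by (rule pred_val_ge)
        show "(1 - 1 / 2 ^ k \<le> val ?\<tau> z x) = (1 - 1 / 2 ^ k \<le> val ?\<tau> z' x)" if "\<And>k. k \<in> block (fst x) \<Longrightarrow> z k = z' k" for z z'
          using val_cong[of "fst x" z z' ?\<tau> "snd x", OF that] by simp
        let ?B = "{y \<in> space (unif slots). y x \<in> {1 - 1 / 2 ^ k..}}"
        have "?B \<in> sets (unif slots)" using sets_unif_Collect[of "{x}" slots "\<lambda>_. {1 - 1 / 2 ^ k..}"] x by simp
        from emeasure_val[OF this, of ?\<tau>] emeasure_unif_component[OF x, of "{1 - 1 / 2 ^ k..}"]
        have "emeasure P {z \<in> space P. (\<lambda>x\<in>slots. val ?\<tau> z x) \<in> ?B} = ennreal (1 / 2 ^ k)"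
          using p by (simp add: emeasure_unit_uniform_atLeast)
        moreover have "{z \<in> space P. (\<lambda>x\<in>slots. val ?\<tau> z x) \<in> ?B} = {z \<in> space P. 1 - 1 / 2 ^ k \<le> val ?\<tau> z x}"
          using x by (auto simp: space_unif)
        ultimately show "emeasure P {z \<in> space P. 1 - 1 / 2 ^ k \<le> val ?\<tau> z x} \<le> ennreal (1 * (1 / 2 ^ k))" by simp
      qed simp
      show "Measurable.pred P (\<lambda>z. 1 - 1 / 2 ^ k \<le> val ?\<tau> z x \<and> gate ?\<tau> k (fst x) z)"
        using x by (rule round_bound_preds)
    qed simp
    then show ?thesis by (simp add: card_slots card_oriented ennreal_of_nat_eq_real_of_nat flip: ennreal_mult)
  qed
  have b5: "of_nat (11 * n\<^sup>2) * emeasure P {z \<in> space P. \<not> hit ?L z} \<le> ennreal 11"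
  proof -
    have "of_nat (11 * n\<^sup>2) * emeasure P {z \<in> space P. \<not> hit ?L z} \<le> of_nat (11 * n\<^sup>2) * ennreal (\<delta> / real n ^ 3)"
      by (intro mult_left_mono emeasure_not_hit_mark_rate[OF \<delta>]) auto
    also have "\<dots> = ennreal (11 * (real n)\<^sup>2 * (\<delta> / real n ^ 3))"
      unfolding ennreal_of_nat_eq_real_of_nat using \<delta> by (subst ennreal_mult[symmetric]) auto
    also have "\<dots> \<le> ennreal 11"
    proof (rule ennreal_leI)
      have "11 * (real n)\<^sup>2 * (\<delta> / real n ^ 3) = 11 * (\<delta> / real n)"
        using n0 by (simp add: power2_eq_square power3_eq_cube)
      also have "\<delta> / real n \<le> 1" using \<delta> n_ge_2 by (subst pos_divide_le_eq) auto
      finally show "11 * (real n)\<^sup>2 * (\<delta> / real n ^ 3) \<le> 11" by simp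
    qed
    finally show ?thesis .
  qed
  let ?f1 = "\<lambda>z. \<Sum>i\<in>{1..n}. of_bool (z (Inl (Mark i)) \<le> ?L / ?\<tau>) :: ennreal"
  let ?f2 = "\<lambda>z. \<Sum>c\<in>{1..n} \<times> {1..nat \<lfloor>?\<tau>\<rfloor>}. of_bool (1 - 1 / 2 ^ k \<le> z (Inl (Light (fst c) (snd c))) \<and> gate ?\<tau> k (va (fst c)) z) :: ennreal"
  let ?f3 = "\<lambda>z. \<Sum>c\<in>adjacent. of_bool (z (Inr (snd c)) \<le> scan_bound n ?L (1 / 2 ^ k) (z (Inl (Mark (fst c)))) \<and> gate ?\<tau> k (snd c) z) :: ennreal"
  let ?f4 = "\<lambda>z. \<Sum>x\<in>slots. of_bool (1 - 1 / 2 ^ k \<le> val ?\<tau> z x \<and> gate ?\<tau> k (fst x) z) :: ennreal"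
  let ?f5 = "\<lambda>z. of_bool (\<not> hit ?L z) :: ennreal"
  have f: "?f1 \<in> borel_measurable P" "?f2 \<in> borel_measurable P" "?f3 \<in> borel_measurable P" "?f4 \<in> borel_measurable P" "?f5 \<in> borel_measurable P"
    by (intro borel_measurable_sum measurable_of_bool round_bound_preds pred_mark; assumption?)+
  have "(\<integral>\<^sup>+z. round_bound ?\<tau> ?L k z \<partial>P) = 4 * (\<integral>\<^sup>+z. ?f1 z \<partial>P) + 3 * (\<integral>\<^sup>+z. ?f2 z \<partial>P) + 3 * (\<integral>\<^sup>+z. ?f3 z \<partial>P) + (\<integral>\<^sup>+z. ?f4 z \<partial>P) + of_nat (11 * n\<^sup>2) * (\<integral>\<^sup>+z. ?f5 z \<partial>P)"
  proof -
    have "(\<integral>\<^sup>+z. 4 * f1 z + 3 * f2 z + 3 * f3 z + f4 z + c * f5 z \<partial>P) =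
      4 * (\<integral>\<^sup>+z. f1 z \<partial>P) + 3 * (\<integral>\<^sup>+z. f2 z \<partial>P) + 3 * (\<integral>\<^sup>+z. f3 z \<partial>P) + (\<integral>\<^sup>+z. f4 z \<partial>P) + c * (\<integral>\<^sup>+z. f5 z \<partial>P)"
      if [measurable]: "f1 \<in> borel_measurable P" "f2 \<in> borel_measurable P" "f3 \<in> borel_measurable P" "f4 \<in> borel_measurable P" "f5 \<in> borel_measurable P"
      for f1 f2 f3 f4 f5 :: "(coin + nat \<Rightarrow> real) \<Rightarrow> ennreal" and c
      by (simp add: nn_integral_add nn_integral_cmult)
    from this[OF f] show ?thesis unfolding round_bound_def .
  qed
  also have "(\<integral>\<^sup>+z. ?f5 z \<partial>P) = emeasure P {z \<in> space P. \<not> hit ?L z}"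
    by (rule nn_integral_of_bool) (rule round_bound_preds)
  also have "4 * (\<integral>\<^sup>+z. ?f1 z \<partial>P) + 3 * (\<integral>\<^sup>+z. ?f2 z \<partial>P) + 3 * (\<integral>\<^sup>+z. ?f3 z \<partial>P) + (\<integral>\<^sup>+z. ?f4 z \<partial>P) + of_nat (11 * n\<^sup>2) * \<dots> \<le>
      4 * ennreal (real n * (?L / ?\<tau>)) + 3 * ennreal (real n * ?\<tau> * (2 * ?q)) + 3 * ennreal (2 * real m * (2 * (?L * (1 + ln (real n))) * ?q)) + ennreal (2 * real m * (2 * ?q)) + ennreal 11"
    using b1 b2 b3 b4 b5 by (intro add_mono mult_left_mono) auto
  also have "\<dots> = ennreal (4 * (real n * (?L / ?\<tau>)) + 3 * (real n * ?\<tau> * (2 * ?q)) + 3 * (2 * real m * (2 * (?L * (1 + ln (real n))) * ?q)) + 2 * real m * (2 * ?q) + 11)"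
  proof -
    have "4 * ennreal a + 3 * ennreal b + 3 * ennreal c + ennreal e + ennreal 11 = ennreal (4 * a + 3 * b + 3 * c + e + 11)"
      if "0 \<le> a" "0 \<le> b" "0 \<le> c" "0 \<le> e" for a b c e
      using that by (simp add: ennreal_mult')
    then show ?thesis using L \<tau> ln0 by simp
  qed
  also have "\<dots> = ennreal (round_mean ?L (real t))"
  proof -
    have e1: "real n * (?L / ?\<tau>) = ?L * sqrt (real s) * real t"
      using n0 t0 s0 by (simp add: light_bound_def)
    have "sqrt (real s) * sqrt (real s) = real s" by simp
    then have e2: "real n * ?\<tau> * (2 * ?q) = 2 * ((real n)\<^sup>2 * sqrt (real s) / real m) / real t"
      using n0 t0 s0 m0 by (simp add: light_bound_def field_simps power2_eq_square)
    have e3: "2 * real m * (2 * (?L * (1 + ln (real n))) * ?q) = 4 * ?L * (1 + ln (real n)) * real s" using m0 by simp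
    have e4: "2 * real m * (2 * ?q) = 4 * real s" using m0 by simp
    show ?thesis unfolding e1 e2 e3 e4 round_mean_def by (intro arg_cong[where f=ennreal]) simp
  qed
  finally show ?thesis .
qed

section \<open>Expected cost of the whole run\<close>

lemma nn_integral_cost:
  assumes \<delta>: "0 < \<delta>" "\<delta> < 1"
  shows "(\<integral>\<^sup>+z. of_nat (cost \<delta> z) \<partial>P) \<le>
    (\<Sum>t\<in>{1..n}. ennreal (T_prob t) * ennreal (2 * real t + (real (num_rounds n) + 1) * round_mean (mark_rate n \<delta>) (real t)))"
proof -
  interpret prob_space P by (rule prob_space_unif)
  let ?L = "mark_rate n \<delta>" and ?R = "num_rounds n"
  let ?g = "\<lambda>t z. ennreal (2 * real t) + (\<Sum>k\<in>{0..?R}. round_bound (light_bound n s t) ?L k z)"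
  have L: "1 \<le> ?L" by (rule mark_rate_ge_1[OF \<delta>])
  have g[measurable]: "?g t \<in> borel_measurable P" for t
    by (intro borel_measurable_add borel_measurable_const borel_measurable_sum measurable_round_bound)
  have T[measurable]: "(\<lambda>z. of_bool (stop_time z = t) :: ennreal) \<in> borel_measurable P" for t
    by (intro measurable_of_bool T_pred)
  have pos: "0 \<le> round_mean ?L (real t)" for t
    unfolding round_mean_def using L n_ge_2 by (intro add_nonneg_nonneg mult_nonneg_nonneg divide_nonneg_nonneg) auto
  have "(\<integral>\<^sup>+z. of_nat (cost \<delta> z) \<partial>P) \<le> (\<integral>\<^sup>+z. (\<Sum>t\<in>{1..n}. of_bool (stop_time z = t) * ?g t z) \<partial>P)"
  proof (rule nn_integral_mono_AE)
    show "AE z in P. of_nat (cost \<delta> z) \<le> (\<Sum>t\<in>{1..n}. of_bool (stop_time z = t) * ?g t z)"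
      using AE_regular
    proof eventually_elim
      case (elim z)
      let ?t = "stop_time z"
      have t: "?t \<in> {1..n}" using stop_time(1,2) by simp
      have "light_bound n s ?t \<le> real n"
      proof -
        have "1 \<le> real ?t * sqrt (real s)" using t s_pos mult_mono[of 1 "real ?t" 1 "sqrt (real s)"] by simp
        then show ?thesis unfolding light_bound_def using n_ge_2 by (subst pos_divide_le_eq) auto
      qed
      moreover have "0 < light_bound n s ?t" using t by (intro light_bound_pos) simp
      ultimately have "of_nat (rounds_cost (light_bound n s ?t) ?L z ?R) \<le> (\<Sum>k\<in>{0..?R}. round_bound (light_bound n s ?t) ?L k z)"
        by (intro rounds_cost_le_round_bound elim L)
      moreover have "of_nat (cost \<delta> z) \<le> (of_nat (2 * ?t + rounds_cost (light_bound n s ?t) ?L z ?R) :: ennreal)"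
        by (rule of_nat_mono) (rule cost_le)
      moreover have "of_nat (2 * ?t) = ennreal (2 * real ?t)" by (simp add: ennreal_of_nat_eq_real_of_nat)
      ultimately have "of_nat (cost \<delta> z) \<le> ?g ?t z"
        unfolding of_nat_add by (metis (no_types, lifting) add_left_mono order_trans)
      also have "?g ?t z = (\<Sum>t\<in>{1..n}. if ?t = t then ?g t z else 0)" using t by (subst sum.delta') auto
      also have "\<dots> = (\<Sum>t\<in>{1..n}. of_bool (?t = t) * ?g t z)" by (intro sum.cong) auto
      finally show ?case .
    qed
  qed
  also have "\<dots> = (\<Sum>t\<in>{1..n}. \<integral>\<^sup>+z. of_bool (stop_time z = t) * ?g t z \<partial>P)"
    by (intro nn_integral_sum borel_measurable_times_ennreal T g)
  \<comment> \<open>The threshold is random, but for each fixed \<open>t\<close> the round bounds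
    and the event \<open>stop_time z = t\<close> use disjoint coordinates, so the integral
    factors.\<close>
  also have "\<dots> = (\<Sum>t\<in>{1..n}. (\<integral>\<^sup>+z. of_bool (stop_time z = t) \<partial>P) * (\<integral>\<^sup>+z. ?g t z \<partial>P))"
  proof (rule sum.cong[OF refl])
    fix t
    let ?A = "{k. \<exists>t. k = Inl (Idx t) \<or> k = Inl (Thr t)} :: (coin + nat) set"
    let ?B = "range (\<lambda>i. Inl (Mark i)) \<union> (\<Union>v\<in>verts G. block v)"
    show "(\<integral>\<^sup>+z. of_bool (stop_time z = t) * ?g t z \<partial>P) = (\<integral>\<^sup>+z. of_bool (stop_time z = t) \<partial>P) * (\<integral>\<^sup>+z. ?g t z \<partial>P)"
    proof (rule nn_integral_mult_disjoint_coords[OF T g, where A = ?A and B = ?B])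
      show "?A \<subseteq> K" by auto
      show "?B \<subseteq> K" using block_sub by auto
      show "?A \<inter> ?B = {}" by (auto simp: block_def)
      show "of_bool (stop_time x = t) = (of_bool (stop_time y = t) :: ennreal)" if "\<And>i. i \<in> ?A \<Longrightarrow> x i = y i" for x y :: "coin + nat \<Rightarrow> real"
      proof -
        have "stop_time x = stop_time y" by (rule stop_time_cong) (use that in auto)
        then show ?thesis by simp
      qed
      show "?g t x = ?g t y" if "\<And>i. i \<in> ?B \<Longrightarrow> x i = y i" for x y
        using round_bound_cong[of x y, OF that] by simp
    qed
  qed
  also have "\<dots> \<le> (\<Sum>t\<in>{1..n}. ennreal (T_prob t) * ennreal (2 * real t + (real ?R + 1) * round_mean ?L (real t)))"
  proof (rule sum_mono)
    fix t assume t: "t \<in> {1..n}"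
    have "(\<integral>\<^sup>+z. of_bool (stop_time z = t) \<partial>P) = ennreal (T_prob t)"
      using nn_integral_of_bool[OF T_pred, of "\<lambda>u. u = t"] by (simp add: emeasure_eq_measure)
    moreover have "(\<integral>\<^sup>+z. ?g t z \<partial>P) \<le> ennreal (2 * real t + (real ?R + 1) * round_mean ?L (real t))"
    proof -
      have "(\<integral>\<^sup>+z. ?g t z \<partial>P) = ennreal (2 * real t) + (\<Sum>k\<in>{0..?R}. \<integral>\<^sup>+z. round_bound (light_bound n s t) ?L k z \<partial>P)"
        by (subst nn_integral_add) (auto intro!: borel_measurable_sum measurable_round_bound nn_integral_sum simp: emeasure_space_1)
      also have "\<dots> \<le> ennreal (2 * real t) + (\<Sum>k\<in>{0..?R}. ennreal (round_mean ?L (real t)))"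
        using t by (intro add_left_mono sum_mono nn_integral_round_bound \<delta>) auto
      also have "\<dots> = ennreal (2 * real t + (real ?R + 1) * round_mean ?L (real t))"
        using pos[of t] by (simp add: ennreal_of_nat_eq_real_of_nat ennreal_plus ennreal_mult distrib_right)
      finally show ?thesis .
    qed
    ultimately show "(\<integral>\<^sup>+z. of_bool (stop_time z = t) \<partial>P) * (\<integral>\<^sup>+z. ?g t z \<partial>P) \<le> ennreal (T_prob t) * ennreal (2 * real t + (real ?R + 1) * round_mean ?L (real t))"
      by (simp only:) (rule mult_left_mono, auto)
  qed
  finally show ?thesis .
qed

text \<open>\<open>round_mean\<close> is a combination of \<open>t\<close>, \<open>1 / t\<close> and
  a constant, so only the means \<open>ET\<close> and \<open>EI\<close> enter. Weighted by
  \<open>sqrt s\<close> and by \<open>c\<close> respectively, both become multiples of the same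
  quantity \<open>X\<close>: this is the balance behind the choice of the threshold.\<close>

lemma mean_cost_le:
  assumes \<delta>: "0 < \<delta>" "\<delta> < 1"
  shows "(\<Sum>t\<in>{1..n}. T_prob t * (2 * real t + (real (num_rounds n) + 1) * round_mean (mark_rate n \<delta>) (real t))) \<le>
    1000 * (sqrt (real s) * (real n * ln (real n) * ln (real n / \<delta>) / sqrt (real m)) + real s * (ln (real n))\<^sup>2 * ln (real n / \<delta>))"
proof -
  let ?r = "sqrt (real m)"
  define \<Lambda> where "\<Lambda> = ln (real n / \<delta>)"
  define l where "l = ln (real n)"
  define X where "X = sqrt (real s) * (real n / ?r)"
  define ET where "ET = (\<Sum>t\<in>{1..n}. T_prob t * real t)"
  define EI where "EI = (\<Sum>t\<in>{1..n}. T_prob t / real t)"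
  define R where "R = real (num_rounds n) + 1"
  define L where "L = mark_rate n \<delta>"
  define D where "D = 12 * L * (1 + l) * real s + 4 * real s + 11"
  define c where "c = (real n)\<^sup>2 * sqrt (real s) / real m"
  have n0: "0 < real n" and r: "0 < ?r" and s1: "1 \<le> real s" using n_ge_2 m_pos s_pos by auto
  have n2: "2 \<le> real n" using n_ge_2 by simp
  have l: "2 / 3 \<le> l" unfolding l_def using ln2_ge_two_thirds ln_mono[of 2 "real n"] n2 by linarith
  have "real n \<le> real n / \<delta>" using \<delta> n0 by (simp add: field_simps)
  then have \<Lambda>: "2 / 3 \<le> \<Lambda>" using l n0 ln_mono[of "real n" "real n / \<delta>"] unfolding \<Lambda>_def l_def by linarith
  have LL: "L = 4 * \<Lambda>" by (simp add: L_def \<Lambda>_def mark_rate_def)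
  have R: "0 \<le> R" "R \<le> 6 * l" using num_rounds_le by (auto simp: R_def l_def)
  have X0: "0 \<le> X" using n0 r by (simp add: X_def)
  have s0: "1 \<le> sqrt (real s)" using s1 by simp
  have ET: "sqrt (real s) * ET \<le> 4 * X"
  proof -
    have "ET \<le> 4 * (real n / ?r)" using expectation_stop_time by (simp add: ET_def)
    then have "sqrt (real s) * ET \<le> sqrt (real s) * (4 * (real n / ?r))" by (rule mult_left_mono) simp
    then show ?thesis by (simp add: X_def mult_ac)
  qed
  have ET0: "0 \<le> ET" unfolding ET_def by (intro sum_nonneg) auto
  have "1 * ET \<le> sqrt (real s) * ET" using s0 ET0 by (rule mult_right_mono)
  then have ET': "ET \<le> 4 * X" using ET by linarith
  have EI: "c * EI \<le> 3 * X"
  proof -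
    have "c * EI \<le> c * (3 * ?r / real n)"
      using expectation_inverse_stop_time by (intro mult_left_mono) (auto simp: EI_def c_def)
    also have "\<dots> = 3 * X"
    proof -
      have "real m = ?r * ?r" by simp
      then show ?thesis unfolding c_def X_def using n0 r by (simp add: field_simps power2_eq_square del: real_sqrt_mult_self)
    qed
    finally show ?thesis .
  qed
  \<comment> \<open>Since \<open>s\<close> is at least 1, the constant 11 is absorbed into
    \<open>15 * s\<close>.\<close>
  have D: "D \<le> 48 * (\<Lambda> * (1 + l) * real s) + 15 * real s" unfolding D_def LL using s1 by simp
  have "(\<Sum>t\<in>{1..n}. T_prob t * (2 * real t + R * round_mean L (real t))) =
      (\<Sum>t\<in>{1..n}. (2 + R * (4 * L * sqrt (real s))) * (T_prob t * real t) + R * (6 * c) * (T_prob t / real t) + R * D * T_prob t)"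
    by (intro sum.cong refl) (simp add: round_mean_def c_def D_def l_def algebra_simps)
  also have "\<dots> = (2 + R * (4 * L * sqrt (real s))) * ET + R * (6 * c) * EI + R * D * (\<Sum>t\<in>{1..n}. T_prob t)"
    by (simp only: sum.distrib ET_def EI_def sum_distrib_left)
  also have "\<dots> = 2 * ET + R * (16 * \<Lambda> * (sqrt (real s) * ET) + 6 * (c * EI) + D)"
    unfolding T_prob_total LL by (simp add: algebra_simps)
  also have "\<dots> \<le> 2 * (4 * X) + 6 * l * (16 * \<Lambda> * (4 * X) + 6 * (3 * X) + (48 * (\<Lambda> * (1 + l) * real s) + 15 * real s))"
  proof -
    let ?u = "16 * \<Lambda> * (sqrt (real s) * ET) + 6 * (c * EI) + D"
    let ?v = "16 * \<Lambda> * (4 * X) + 6 * (3 * X) + (48 * (\<Lambda> * (1 + l) * real s) + 15 * real s)"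
    have "0 \<le> ?u"
      using \<Lambda> ET0 s1 l unfolding D_def LL c_def EI_def
      by (intro add_nonneg_nonneg mult_nonneg_nonneg sum_nonneg divide_nonneg_nonneg) auto
    moreover have "16 * \<Lambda> * (sqrt (real s) * ET) \<le> 16 * \<Lambda> * (4 * X)" using ET \<Lambda> by (intro mult_left_mono) auto
    then have "?u \<le> ?v" using EI D by linarith
    ultimately have "R * ?u \<le> 6 * l * ?v" using R l by (intro mult_mono) auto
    then show ?thesis using ET' by linarith
  qed
  also have "\<dots> = 8 * X + 384 * (l * \<Lambda> * X) + 108 * (l * X) + 288 * (l * \<Lambda> * real s) + 288 * (l\<^sup>2 * \<Lambda> * real s) + 90 * (l * real s)"
    by (simp add: algebra_simps power2_eq_square)
  also have "\<dots> \<le> 1000 * (l * \<Lambda> * X + l\<^sup>2 * \<Lambda> * real s)"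
  proof -
    have ll: "0 \<le> l * X" "0 \<le> l * real s" "0 \<le> l * \<Lambda> * real s" using l \<Lambda> X0 by auto
    have 1: "l * X \<le> 3 / 2 * (l * \<Lambda> * X)" using mult_right_mono[OF \<Lambda> ll(1)] by (simp add: mult_ac)
    have "X \<le> 3 / 2 * (l * X)" using mult_right_mono[OF l X0] by simp
    then have 2: "X \<le> 9 / 4 * (l * \<Lambda> * X)" using 1 by simp
    have 3: "l * \<Lambda> * real s \<le> 3 / 2 * (l\<^sup>2 * \<Lambda> * real s)"
      using mult_right_mono[OF l ll(3)] by (simp add: mult_ac power2_eq_square)
    have "l * real s \<le> 3 / 2 * (l * \<Lambda> * real s)" using mult_right_mono[OF \<Lambda> ll(2)] by (simp add: mult_ac)
    then have 4: "l * real s \<le> 9 / 4 * (l\<^sup>2 * \<Lambda> * real s)" using 3 by simp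
    have 5: "0 \<le> l * \<Lambda> * X" "0 \<le> l\<^sup>2 * \<Lambda> * real s" using l \<Lambda> X0 by auto
    \<comment> \<open>\<open>l\<close> and \<open>\<Lambda>\<close> are at least
      \<open>2 / 3\<close>, so a missing logarithm is supplied at the price of a factor
      \<open>3 / 2\<close>. The totals are 18 + 384 + 162 = 564 for \<open>a\<close> and 288 + 432 +
      203 = 923 for \<open>b\<close>, which explains the constant 1000.\<close>
    have "8 * x + 384 * a + 108 * u + 288 * v + 288 * b + 90 * w \<le> 1000 * (a + b)"
      if *: "u \<le> 3 / 2 * a" "x \<le> 9 / 4 * a" "v \<le> 3 / 2 * b" "w \<le> 9 / 4 * b" "0 \<le> a" "0 \<le> b" for a b u v w x :: real
    proof -
      have "8 * x \<le> 18 * a" "108 * u \<le> 162 * a" "288 * v \<le> 432 * b" "90 * w \<le> 203 * b"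
        using * by linarith+
      then show ?thesis using *(5,6) by (simp add: algebra_simps)
    qed
    from this[OF 1 2 3 4 5] show ?thesis .
  qed
  also have "l * \<Lambda> * X = sqrt (real s) * (real n * ln (real n) * ln (real n / \<delta>) / ?r)" by (simp add: X_def l_def \<Lambda>_def)
  finally show ?thesis unfolding R_def L_def l_def \<Lambda>_def by (simp add: mult_ac)
qed

lemma expected_queries_edge_sampler:
  assumes \<delta>: "0 < \<delta>" "\<delta> < 1"
  shows "expected_queries (edge_sampler_alg n s \<delta>) G \<le>
    ennreal (1000 * (sqrt (real s) * (real n * ln (real n) * ln (real n / \<delta>) / sqrt (real m)) + real s * (ln (real n))\<^sup>2 * ln (real n / \<delta>)))"
proof -
  have "(\<lambda>z. of_nat (cost \<delta> z) :: ennreal) \<in> borel_measurable P"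
    by (rule measurable_compose[OF measurable_cost]) simp
  then have "(\<integral>\<^sup>+z. of_nat (cost \<delta> z) \<partial>P) = (\<integral>\<^sup>+x. of_nat (cost \<delta> (enc x)) \<partial>run_space G)"
    using nn_integral_distr[OF measurable_enc, of "\<lambda>z. of_nat (cost \<delta> z)"] by (simp add: distr_run_space)
  then have "expected_queries (edge_sampler_alg n s \<delta>) G = (\<integral>\<^sup>+z. of_nat (cost \<delta> z) \<partial>P)"
    by (simp add: expected_queries_def alg_cost_enc)
  also have "\<dots> \<le> (\<Sum>t\<in>{1..n}. ennreal (T_prob t) * ennreal (2 * real t + (real (num_rounds n) + 1) * round_mean (mark_rate n \<delta>) (real t)))"
    by (rule nn_integral_cost[OF \<delta>])
  also have "\<dots> = ennreal (\<Sum>t\<in>{1..n}. T_prob t * (2 * real t + (real (num_rounds n) + 1) * round_mean (mark_rate n \<delta>) (real t)))"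
  proof -
    have "0 \<le> round_mean (mark_rate n \<delta>) (real t)" for t
      unfolding round_mean_def using mark_rate_ge_1[OF \<delta>] n_ge_2
      by (intro add_nonneg_nonneg mult_nonneg_nonneg divide_nonneg_nonneg) auto
    then have nn: "0 \<le> 2 * real t + (real (num_rounds n) + 1) * round_mean (mark_rate n \<delta>) (real t)" for t
      by (intro add_nonneg_nonneg mult_nonneg_nonneg) auto
    then have "ennreal (T_prob t) * ennreal (2 * real t + (real (num_rounds n) + 1) * round_mean (mark_rate n \<delta>) (real t)) =
        ennreal (T_prob t * (2 * real t + (real (num_rounds n) + 1) * round_mean (mark_rate n \<delta>) (real t)))" for t
      by (intro ennreal_mult[symmetric]) auto
    then show ?thesis using nn by (simp only:) (intro sum_ennreal mult_nonneg_nonneg; simp)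
  qed
  also have "\<dots> \<le> ennreal (1000 * (sqrt (real s) * (real n * ln (real n) * ln (real n / \<delta>) / sqrt (real m)) + real s * (ln (real n))\<^sup>2 * ln (real n / \<delta>)))"
    by (rule ennreal_leI) (rule mean_cost_le[OF \<delta>])
  finally show ?thesis .
qed

end

theorem mainTheorem3:
  "\<exists>(A :: nat \<Rightarrow> nat \<Rightarrow> real \<Rightarrow> (nat \<times> nat) set rand_alg) (C :: real). C > 0 \<and>
     (\<forall>(G :: access_graph) (n :: nat) (m :: nat) (s :: nat) (\<delta> :: real).
        wf_access_graph G \<and> card (verts G) = n \<and> card (edges G) = m \<and>
        0 < s \<and> s \<le> card (oriented_edges G) \<and> 0 < \<delta> \<and> \<delta> < 1 \<longrightarrow>
          alg_measurable (A n s \<delta>) G \<and>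
          samples_without_replacement (A n s \<delta>) G (oriented_edges G) s \<delta> \<and>
          expected_queries (A n s \<delta>) G \<le>
            ennreal (C * (sqrt (real s) * (real n * ln (real n) * ln (real n / \<delta>) / sqrt (real m))
                          + real s * (ln (real n))\<^sup>2 * ln (real n / \<delta>))))"
proof (intro exI[of _ edge_sampler_alg] exI[of _ 1000] conjI allI impI; (elim conjE)?)
  fix G n m s \<delta>
  assume "wf_access_graph G" "card (verts G) = n" "card (edges G) = m"
    "0 < s" "s \<le> card (oriented_edges G)" and \<delta>: "0 < \<delta>" "\<delta> < (1 :: real)"
  then interpret graph_run G n m s by unfold_locales auto
  show "alg_measurable (edge_sampler_alg n s \<delta>) G" by (rule alg_measurable_edge_sampler)
  show "samples_without_replacement (edge_sampler_alg n s \<delta>) G (oriented_edges G) s \<delta>" by (rule samples_edge_sampler[OF \<delta>])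
  show "expected_queries (edge_sampler_alg n s \<delta>) G \<le>
      ennreal (1000 * (sqrt (real s) * (real n * ln (real n) * ln (real n / \<delta>) / sqrt (real m))
        + real s * (ln (real n))\<^sup>2 * ln (real n / \<delta>)))" by (rule expected_queries_edge_sampler[OF \<delta>])
qed simp

end
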